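(* Suppose $w$ satisfies (A1), and that (A2s) and (A3) hold for every $\delta\in(0,1/2)$. Let $f\in L^2(\Omega)$, let $u_0\in H^1_0(\Omega)$ be the weak solution of $-u''=f$ in $\Omega$, $u(0)=u(1)=0$, and for $\delta$ sufficiently small let $u_\delta\in L^2(\Omega)$ be the solution of $\widetilde{\mathcal N}_\delta u_\delta=f$. Then $\lim_{\delta\to0}\|u_\delta-u_0\|_{L^2(\Omega)}=0$.
   Context: Throughout, $\Omega=(0,1)$, $\delta\in(0,1/2)$, $|\cdot|$ applied to a set denotes Lebesgue measure, and $\chi_A$ denotes the indicator function of a set $A$. A function $w:[0,\infty)\to[0,\infty)$ satisfies (A1) if $w$ is continuous and nonincreasing on $[0,1)$, positive on $(0,1)$, $w(r)=0$ for $r\ge 1$, and $\int_{\mathbb R} w(|z|)|z|^2\,dz=2$. Set $w_\delta(x,y)=\delta^{-3}w(|x-y|/\delta)$, $a_\delta(x)=\int_0^1 w_\delta(x,y)\,dy$, and $b_\delta(x)=\frac{2}{(x+\delta)^2}\int_{x-\delta}^{0}(x-y)w_\delta(x,y)\,dy$ for $x\in(0,\delta)$, $b_\delta(x)=\frac{2}{(1-x+\delta)^2}\int_{1}^{x+\delta}(y-x)w_\delta(x,y)\,dy$ for $x\in(1-\delta,1)$, and $b_\delta(x)=0$ otherwise. The operator $\widetilde{\mathcal N}_\delta$ on $L^2(\Omega)$ is $\widetilde{\mathcal N}_\delta u(x)=a_\delta(x)u(x)-\int_0^1 u(y)\big(w_\delta(x,y)-b_\delta(x)\chi_{[0,\delta]}(|y-x|)\big)\,dy$.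 Define $\widetilde w_\delta(x,y)=|w_\delta(x,y)-b_\delta(x)\chi_{(0,\delta)}(|y-x|)|$. Condition (A2s) (for a given $\delta$): for every $x\in\Omega$, $|\{y\in\Omega: w_\delta(x,y)-b_\delta(x)\chi_{[0,\delta]}(|y-x|)\ge 0\}|\ge|\{y\in\Omega: w_\delta(x,y)-b_\delta(x)\chi_{[0,\delta]}(|y-x|)\le 0\}|$. Condition (A3) (for a given $\delta$): $a_\delta(x)\ge\int_0^1\widetilde w_\delta(y,x)\,dy$ for all $x\in\Omega$. *)

theory Defs
  imports "HOL-Analysis.Analysis"
begin

definition Om :: "real set" where "Om = {0<..<1}"

abbreviation Lint_on :: "real set \<Rightarrow> (real \<Rightarrow> real) \<Rightarrow> real" where
  "Lint_on S h \<equiv> integral\<^sup>L (lebesgue_on S) h"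

definition A1 :: "(real \<Rightarrow> real) \<Rightarrow> bool" where
  "A1 w \<longleftrightarrow> (\<forall>r\<ge>0. w r \<ge> 0)
     \<and> continuous_on {0..<1} w
     \<and> (\<forall>r s. 0 \<le> r \<and> r \<le> s \<and> s < 1 \<longrightarrow> w s \<le> w r)
     \<and> (\<forall>r. 0 < r \<and> r < 1 \<longrightarrow> w r > 0)
     \<and> (\<forall>r\<ge>1. w r = 0)
     \<and> has_bochner_integral lborel (\<lambda>z. w \<bar>z\<bar> * z\<^sup>2) 2"

definition w_d :: "(real \<Rightarrow> real) \<Rightarrow> real \<Rightarrow> real \<Rightarrow> real \<Rightarrow> real" where
  "w_d w \<delta> x y = w (\<bar>x - y\<bar> / \<delta>) / \<delta> ^ 3"

definition a_d :: "(real \<Rightarrow> real) \<Rightarrow> real \<Rightarrow> real \<Rightarrow> real" where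
  "a_d w \<delta> x = Lint_on Om (\<lambda>y. w_d w \<delta> x y)"

definition b_d :: "(real \<Rightarrow> real) \<Rightarrow> real \<Rightarrow> real \<Rightarrow> real" where
  "b_d w \<delta> x =
     (if 0 < x \<and> x < \<delta> then
        2 / (x + \<delta>)\<^sup>2 * Lint_on {x - \<delta>..0} (\<lambda>y. (x - y) * w_d w \<delta> x y)
      else if 1 - \<delta> < x \<and> x < 1 then
        2 / (1 - x + \<delta>)\<^sup>2 * Lint_on {1..x + \<delta>} (\<lambda>y. (y - x) * w_d w \<delta> x y)
      else 0)"

definition K_d :: "(real \<Rightarrow> real) \<Rightarrow> real \<Rightarrow> real \<Rightarrow> real \<Rightarrow> real" where
  "K_d w \<delta> x y = w_d w \<delta> x y - b_d w \<delta> x * indicator {0..\<delta>} \<bar>y - x\<bar>"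

definition wt_d :: "(real \<Rightarrow> real) \<Rightarrow> real \<Rightarrow> real \<Rightarrow> real \<Rightarrow> real" where
  "wt_d w \<delta> x y = \<bar>w_d w \<delta> x y - b_d w \<delta> x * indicator {0<..<\<delta>} \<bar>y - x\<bar>\<bar>"

definition N_d :: "(real \<Rightarrow> real) \<Rightarrow> real \<Rightarrow> (real \<Rightarrow> real) \<Rightarrow> real \<Rightarrow> real" where
  "N_d w \<delta> u x = a_d w \<delta> x * u x - Lint_on Om (\<lambda>y. u y * K_d w \<delta> x y)"

definition A2s :: "(real \<Rightarrow> real) \<Rightarrow> real \<Rightarrow> bool" where
  "A2s w \<delta> \<longleftrightarrow> (\<forall>x\<in>Om.
     measure lebesgue {y\<in>Om. K_d w \<delta> x y \<ge> 0} \<ge> measure lebesgue {y\<in>Om. K_d w \<delta> x y \<le> 0})"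

definition A3 :: "(real \<Rightarrow> real) \<Rightarrow> real \<Rightarrow> bool" where
  "A3 w \<delta> \<longleftrightarrow> (\<forall>x\<in>Om. a_d w \<delta> x \<ge> Lint_on Om (\<lambda>y. wt_d w \<delta> y x))"

definition L2 :: "(real \<Rightarrow> real) \<Rightarrow> bool" where
  "L2 u \<longleftrightarrow> u \<in> borel_measurable (lebesgue_on Om) \<and> integrable (lebesgue_on Om) (\<lambda>x. (u x)\<^sup>2)"

definition L2_norm :: "(real \<Rightarrow> real) \<Rightarrow> real" where
  "L2_norm u = sqrt (Lint_on Om (\<lambda>x. (u x)\<^sup>2))"

definition test_fun :: "(real \<Rightarrow> real) \<Rightarrow> bool" where
  "test_fun \<phi> \<longleftrightarrow> (\<forall>k x. ((deriv ^^ k) \<phi>) differentiable (at x))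
     \<and> (\<exists>a b. 0 < a \<and> a \<le> b \<and> b < 1 \<and> (\<forall>x. x \<notin> {a..b} \<longrightarrow> \<phi> x = 0))"

definition weak_deriv :: "(real \<Rightarrow> real) \<Rightarrow> (real \<Rightarrow> real) \<Rightarrow> bool" where
  "weak_deriv u g \<longleftrightarrow> L2 u \<and> L2 g \<and>
     (\<forall>\<phi>. test_fun \<phi> \<longrightarrow> Lint_on Om (\<lambda>x. u x * deriv \<phi> x) = - Lint_on Om (\<lambda>x. g x * \<phi> x))"

definition H10 :: "(real \<Rightarrow> real) \<Rightarrow> (real \<Rightarrow> real) \<Rightarrow> bool" where
  "H10 u g \<longleftrightarrow> weak_deriv u g \<and>
     (\<exists>\<phi>. (\<forall>n. test_fun (\<phi> n)) \<and>
        (\<lambda>n. L2_norm (\<lambda>x. \<phi> n x - u x) + L2_norm (\<lambda>x. deriv (\<phi> n) x - g x)) \<longlonglongrightarrow> 0)"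

definition weak_sol :: "(real \<Rightarrow> real) \<Rightarrow> (real \<Rightarrow> real) \<Rightarrow> bool" where
  "weak_sol f u \<longleftrightarrow> (\<exists>g. H10 u g \<and>
     (\<forall>\<phi>. test_fun \<phi> \<longrightarrow> Lint_on Om (\<lambda>x. g x * deriv \<phi> x) = Lint_on Om (\<lambda>x. f x * \<phi> x)))"

end

theory Submission
  imports Defs "HOL-Computational_Algebra.Polynomial" "HOL-Real_Asymp.Real_Asymp"
begin

text \<open>The theorem is stability plus consistency. By (A2s) and (A3) the kernel is diagonally dominant in
  rows and columns, so \<open>\<langle>N\<^sub>\<delta> v, v\<rangle>\<close> controls \<open>\<delta>\<close>-close differences of \<open>v\<close> in the interior, where the kernel is
  nonnegative, and \<open>\<delta>\<^sup>-\<^sup>2 \<integral> v\<^sup>2\<close> near the end points, where the row surplus is bounded below. A nonlocal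
  Poincare inequality turns this into \<open>\<parallel>v\<parallel> \<le> C \<parallel>N\<^sub>\<delta> v\<parallel>\<close> with \<open>C\<close> independent of \<open>\<delta>\<close>. For a polynomial \<open>z\<close> vanishing at
  the end points, \<open>N\<^sub>\<delta> z + z'' = O(\<delta>)\<close> in the interior and \<open>O(1)\<close> in the boundary layers, because \<open>b\<^sub>\<delta>\<close> makes
  \<open>N\<^sub>\<delta>\<close> annihilate linear functions vanishing at the nearby end point. Polynomials are dense in \<open>L\<^sup>2\<close>, so \<open>-z''\<close> can be
  taken close to \<open>f\<close>; both \<open>u\<^sub>\<delta>\<close> and \<open>u\<^sub>0\<close> are then close to \<open>z\<close>.\<close>

subsection \<open>Test functions\<close>

text \<open>Two features of the kernel shape the argument. It is not symmetric, because
  \<open>b_d\<close> depends on the first variable only, so rows and columns come from different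
  conditions: counting signs with (A2s) gives the rows, (A3) gives the columns. And its negative
  part sits in rows near the end points, so the energy keeps only rows x in [d, 1 - d], while the
  row surplus is used only within 3/4 d of an end point, since \<open>b_d\<close> degenerates at
  distance d. The strip in between is reached by comparing it with neighbouring sets, at distances
  where the kernel is at least w(15/16) / d^3. Polynomials are the comparison functions because -z''
  = p with Dirichlet conditions then has a polynomial solution. The nonlocal side reduces to Taylor
  expansion, and the weak side to a duality argument whose dual problem is again polynomial. A
  bounded consistency error on layers of total length 2 d costs only the order of the square root of
  d in L2, so it does not spoil convergence.\<close>

definition Cn :: "nat \<Rightarrow> (real \<Rightarrow> real) \<Rightarrow> bool" where
  "Cn k f \<longleftrightarrow> (\<forall>j\<le>k. \<forall>x. ((deriv ^^ j) f) differentiable (at x))"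

lemma Cn_0: "Cn 0 f \<longleftrightarrow> (\<forall>x. f differentiable (at x))"
  by (simp add: Cn_def)

text \<open>\<open>Cn k\<close> asks for the derivatives of order 0 to k to be differentiable, so it
  amounts to k + 1 derivatives. Peeling off the innermost \<open>deriv\<close> rather than the
  outermost lets the closure proofs below use induction on k with the function arbitrary.\<close>

lemma Cn_Suc: "Cn (Suc k) f \<longleftrightarrow> (\<forall>x. f differentiable (at x)) \<and> Cn k (deriv f)"
proof -
  have "(\<forall>j\<le>Suc k. Q j) \<longleftrightarrow> Q 0 \<and> (\<forall>j\<le>k. Q (Suc j))" for Q :: "nat \<Rightarrow> bool"
    by (metis Suc_le_mono le0 not0_implies_Suc)
  then show ?thesis
    unfolding Cn_def by (simp del: funpow.simps add: funpow_Suc_right)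
qed

lemma Cn_SucI:
  assumes "\<And>x. (f has_field_derivative f' x) (at x)" "Cn k f'"
  shows "Cn (Suc k) f"
proof -
  have "deriv f = f'"
    using assms(1) DERIV_imp_deriv by blast
  moreover have "f differentiable (at x)" for x
    using assms(1) real_differentiable_def by blast
  ultimately show ?thesis
    using assms(2) by (simp add: Cn_Suc)
qed

lemma Cn_antimono: "Cn k f \<Longrightarrow> j \<le> k \<Longrightarrow> Cn j f"
  by (auto simp: Cn_def)

lemma Cn_DERIV: "Cn k f \<Longrightarrow> (f has_field_derivative deriv f x) (at x)"
  unfolding Cn_def by (metis DERIV_deriv_iff_real_differentiable funpow_0 le0)

lemma Cn_add: "Cn k f \<Longrightarrow> Cn k g \<Longrightarrow> Cn k (\<lambda>x. f x + g x)"
proof (induction k arbitrary: f g)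
  case 0
  then show ?case by (simp add: Cn_0)
next
  case (Suc k)
  show ?case
  proof (rule Cn_SucI)
    show "((\<lambda>x. f x + g x) has_field_derivative deriv f x + deriv g x) (at x)" for x
      using Suc.prems by (intro DERIV_add Cn_DERIV)
    show "Cn k (\<lambda>x. deriv f x + deriv g x)"
      using Suc by (auto simp: Cn_Suc)
  qed
qed

lemma Cn_mult: "Cn k f \<Longrightarrow> Cn k g \<Longrightarrow> Cn k (\<lambda>x. f x * g x)"
proof (induction k arbitrary: f g)
  case 0
  then show ?case by (simp add: Cn_0)
next
  case (Suc k)
  show ?case
  proof (rule Cn_SucI)
    show "((\<lambda>x. f x * g x) has_field_derivative deriv f x * g x + deriv g x * f x) (at x)" for x
      using Suc.prems by (intro DERIV_mult Cn_DERIV)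
    show "Cn k (\<lambda>x. deriv f x * g x + deriv g x * f x)"
      using Suc Cn_antimono[of "Suc k" _ k] by (intro Cn_add Suc.IH) (auto simp: Cn_Suc)
  qed
qed

lemma Cn_poly: "Cn k (poly p)"
proof (induction k arbitrary: p)
  case 0
  then show ?case by (simp add: Cn_0)
next
  case (Suc k)
  then show ?case by (intro Cn_SucI[of _ "poly (pderiv p)"] poly_DERIV)
qed

section \<open>Smooth cutoffs built from exp(-1/t)\<close>

definition flat :: "real poly \<Rightarrow> real \<Rightarrow> real" where
  "flat p t = (if t > 0 then poly p (1 / t) * exp (- 1 / t) else 0)"

lemma poly_times_exp_minus_tendsto_0:
  "((\<lambda>s::real. poly p s * exp (- s)) \<longlongrightarrow> 0) at_top"
proof -
  have "((\<lambda>s. \<Sum>i\<le>degree p. coeff p i * (s ^ i / exp s)) \<longlongrightarrow> (\<Sum>i\<le>degree p. coeff p i * 0)) at_top"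
    by (intro tendsto_sum tendsto_mult tendsto_const tendsto_power_div_exp_0)
  then show ?thesis
    by (simp add: poly_altdef sum_distrib_right exp_minus divide_inverse mult.assoc)
qed

text \<open>With s = 1/t the function is p(s) exp(-s), and the chain rule replaces p by s^2 (p -
  p'). The family is closed under differentiation, so one induction gives smoothness to every order.
  At 0 the right difference quotient is s p(s) exp(-s), which tends to 0 as s grows.\<close>

lemma flat_DERIV:
  "(flat p has_field_derivative flat ([:0,0,1:] * (p - pderiv p)) t) (at t)"
proof -
  consider "t > 0" | "t < 0" | "t = 0" by linarith
  then show ?thesis
  proof cases
    case 1
    have "((\<lambda>t. poly p (1 / t) * exp (- 1 / t)) has_field_derivative
            flat ([:0,0,1:] * (p - pderiv p)) t) (at t)"
      using 1 by (auto intro!: derivative_eq_intros simp: flat_def field_simps power2_eq_square)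
    then show ?thesis
      by (rule has_field_derivative_transform_within_open[where S = "{0<..}"])
        (use 1 in \<open>auto simp: flat_def\<close>)
  next
    case 2
    have "((\<lambda>t. 0) has_field_derivative flat ([:0,0,1:] * (p - pderiv p)) t) (at t)"
      using 2 by (simp add: flat_def)
    then show ?thesis
      by (rule has_field_derivative_transform_within_open[where S = "{..<0}"])
        (use 2 in \<open>auto simp: flat_def\<close>)
  next
    case 3
    have "((\<lambda>s. poly ([:0,1:] * p) s * exp (- s)) \<longlongrightarrow> 0) at_top"
      by (rule poly_times_exp_minus_tendsto_0)
    then have "((\<lambda>t. poly ([:0,1:] * p) (inverse t) * exp (- inverse t)) \<longlongrightarrow> 0) (at_right 0)"
      by (rule filterlim_compose[OF _ filterlim_inverse_at_top_right])
    moreover have "\<forall>\<^sub>F t in at_right 0.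
        poly ([:0,1:] * p) (inverse t) * exp (- inverse t) = flat p t / t"
      by (auto simp: eventually_at_filter flat_def divide_inverse mult_ac)
    ultimately have "((\<lambda>t. flat p t / t) \<longlongrightarrow> 0) (at_right 0)"
      by (rule Lim_transform_eventually)
    moreover have "((\<lambda>t. flat p t / t) \<longlongrightarrow> 0) (at_left 0)"
      by (rule Lim_transform_eventually[OF tendsto_const])
        (auto simp: eventually_at_filter flat_def)
    ultimately have "((\<lambda>t. flat p t / t) \<longlongrightarrow> 0) (at 0)"
      by (simp add: filterlim_at_split)
    then show ?thesis
      by (simp add: 3 has_field_derivative_iff flat_def)
  qed
qed

lemma Cn_flat_poly: "Cn k (\<lambda>x. flat p (poly q x))"
proof (induction k arbitrary: p)
  case 0
  have "((\<lambda>x. flat p (poly q x)) has_field_derivative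
      flat ([:0,0,1:] * (p - pderiv p)) (poly q x) * poly (pderiv q) x) (at x)" for x
    by (rule DERIV_chain2[OF flat_DERIV poly_DERIV])
  then show ?case by (auto simp: Cn_0 real_differentiable_def)
next
  case (Suc k)
  show ?case
    by (rule Cn_SucI[OF DERIV_chain2[OF flat_DERIV poly_DERIV]]) (intro Cn_mult Suc Cn_poly)
qed

lemma test_funI:
  assumes "\<And>k. Cn k \<phi>" "0 < a" "a \<le> b" "b < 1" "\<And>x. x \<notin> {a..b} \<Longrightarrow> \<phi> x = 0"
  shows "test_fun \<phi>"
  using assms unfolding test_fun_def Cn_def by blast

lemma test_fun_Cn: "test_fun \<phi> \<Longrightarrow> Cn k \<phi>"
  unfolding test_fun_def Cn_def by blast

text \<open>For n > 0 the argument n x (1 - x) - 1 is positive exactly where x (1 - x) > 1/n, so the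
  support stays inside (0,1), while the values tend to exp(0) = 1 at each interior point. No plateau
  at height 1 is built: dominated convergence asks only for the pointwise limit and a uniform
  bound.\<close>

definition cutoff :: "nat \<Rightarrow> real \<Rightarrow> real" where
  "cutoff n x = flat 1 (real n * (x * (1 - x)) - 1)"

definition cutoff' :: "nat \<Rightarrow> real \<Rightarrow> real" where
  "cutoff' n x = flat [:0,0,1:] (real n * (x * (1 - x)) - 1) * (real n * (1 - 2 * x))"

lemma cutoff_DERIV: "(cutoff n has_field_derivative cutoff' n x) (at x)"
proof -
  have "((\<lambda>x. flat 1 (real n * (x * (1 - x)) - 1)) has_field_derivative cutoff' n x) (at x)"
    by (rule DERIV_chain2[OF flat_DERIV, THEN DERIV_cong])
      (auto intro!: derivative_eq_intros simp: cutoff'_def algebra_simps pderiv_1)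
  then show ?thesis by (simp add: cutoff_def[abs_def])
qed

lemma test_fun_poly_cutoff:
  assumes "n \<ge> 2"
  shows "test_fun (\<lambda>x. poly z x * cutoff n x)"
proof (rule test_funI[where a = "1 / n" and b = "1 - 1 / n"])
  have cutoff_eq: "cutoff n = (\<lambda>x. flat 1 (poly [:-1, real n, - real n:] x))"
    by (auto simp: cutoff_def fun_eq_iff algebra_simps)
  show "Cn k (\<lambda>x. poly z x * cutoff n x)" for k
    unfolding cutoff_eq by (intro Cn_mult Cn_poly Cn_flat_poly)
  show "poly z x * cutoff n x = 0" if "x \<notin> {1 / n..1 - 1 / n}" for x
  proof -
    have n2: "1 / n \<le> 1 / 2" using assms by simp
    have "x * (1 - x) \<le> 1 / n"
    proof (cases "x < 1/2")
      case True
      then have "x < 1 / n" using that n2 by auto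
      moreover have "x * (1 - x) \<le> 1 / n" if "x \<le> 0"
        using mult_nonpos_nonneg[of x "1 - x"] that by (simp add: order_trans[of _ 0])
      moreover have "x * (1 - x) \<le> x" if "x > 0"
        using that by (simp add: algebra_simps)
      ultimately show ?thesis
        by (meson le_less_trans less_imp_le not_le)
    next
      case False
      then have "1 - x < 1 / n" using that n2 by auto
      moreover have "x * (1 - x) \<le> 1 / n" if "x \<ge> 1"
        using mult_nonneg_nonpos[of x "1 - x"] that by (simp add: order_trans[of _ 0])
      moreover have "x * (1 - x) \<le> 1 * (1 - x)" if "x < 1"
        using that by (intro mult_right_mono) auto
      ultimately show ?thesis
        by (metis le_less_trans less_imp_le mult_1 not_le)
    qed
    then have "real n * (x * (1 - x)) \<le> 1"
      using assms by (simp add: field_simps)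
    then show ?thesis by (simp add: cutoff_def flat_def)
  qed
qed (use assms in \<open>auto simp: field_simps\<close>)

lemma flat_one_le: "\<bar>flat 1 t\<bar> \<le> 1"
  by (simp add: flat_def)

text \<open>Substituting s = 1/t turns the left side into (s + s^2) exp(-s), which is bounded
  because exp(s) dominates its quadratic Taylor polynomial. The weight t + 1 stands for n x (1 - x)
  in \<open>cutoff'\<close>.\<close>

lemma flat_square_weighted_le: "(t + 1) * \<bar>flat [:0,0,1:] t\<bar> \<le> 4" if "t > -1"
proof (cases "t > 0")
  case True
  define s where "s = 1 / t"
  have s: "s > 0" "t = 1 / s" using True by (auto simp: s_def)
  have e: "exp s \<ge> 1 + s + s\<^sup>2 / 2" using exp_lower_Taylor_quadratic[of s] s by simp
  have "s + s\<^sup>2 \<le> 4 * (1 + s + s\<^sup>2 / 2)" using s by auto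
  also have "\<dots> \<le> 4 * exp s" using e by simp
  finally have "(s + s\<^sup>2) * exp (- s) \<le> 4" by (simp add: exp_minus field_simps)
  moreover have "(t + 1) * \<bar>flat [:0,0,1:] t\<bar> = (s + s\<^sup>2) * exp (- s)"
    unfolding s(2) using s(1) by (simp add: flat_def field_simps power2_eq_square)
  ultimately show ?thesis by simp
qed (simp add: flat_def)

lemma cutoff_tendsto:
  assumes "0 < x" "x < 1"
  shows "(\<lambda>n. cutoff n x) \<longlonglongrightarrow> 1"
    and "(\<lambda>n. cutoff' n x) \<longlonglongrightarrow> 0"
proof -
  define c where "c = x * (1 - x)"
  have c: "c > 0" using assms by (simp add: c_def)
  have *: "filterlim (\<lambda>n. real n * c - 1) at_top sequentially"
    using c by real_asymp
  have "((\<lambda>t::real. exp (- 1 / t)) \<longlongrightarrow> 1) at_top" by real_asymp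
  then have "((\<lambda>t. flat 1 t) \<longlongrightarrow> 1) at_top"
    by (rule Lim_transform_eventually)
      (auto simp: flat_def intro!: eventually_mono[OF eventually_gt_at_top[of 0]])
  from filterlim_compose[OF this *] show "(\<lambda>n. cutoff n x) \<longlonglongrightarrow> 1"
    by (simp add: cutoff_def c_def)
  have "((\<lambda>t::real. (t + 1) / t\<^sup>2 * exp (- 1 / t)) \<longlongrightarrow> 0) at_top" by real_asymp
  then have "((\<lambda>t. (t + 1) * flat [:0,0,1:] t) \<longlongrightarrow> 0) at_top"
    by (rule Lim_transform_eventually)
      (auto simp: flat_def field_simps power2_eq_square intro!: eventually_mono[OF eventually_gt_at_top[of 0]])
  from filterlim_compose[OF this *]
  have "(\<lambda>n. real n * c * flat [:0,0,1:] (real n * c - 1)) \<longlonglongrightarrow> 0" by simp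
  then have "(\<lambda>n. real n * c * flat [:0,0,1:] (real n * c - 1) * ((1 - 2 * x) / c)) \<longlonglongrightarrow> 0 * ((1 - 2 * x) / c)"
    by (rule tendsto_mult_right)
  then show "(\<lambda>n. cutoff' n x) \<longlonglongrightarrow> 0"
    using c by (simp add: cutoff'_def c_def[symmetric] mult_ac)
qed

text \<open>With the factor x (1 - x) moved in, the growth factor n of the derivative appears only
  as t + 1 = n x (1 - x), and the weighted bound for \<open>flat\<close> removes it. The remaining
  factor 1 - 2 x has modulus at most 1.\<close>

lemma cutoff'_bound:
  assumes "0 < x" "x < 1"
  shows "\<bar>x * (1 - x) * cutoff' n x\<bar> \<le> 4"
proof -
  define t where "t = real n * (x * (1 - x)) - 1"
  have "\<bar>x * (1 - x) * cutoff' n x\<bar> = ((t + 1) * \<bar>flat [:0,0,1:] t\<bar>) * \<bar>1 - 2 * x\<bar>"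
    using assms by (simp add: cutoff'_def t_def abs_mult mult_ac)
  also have "\<dots> \<le> 4 * 1"
  proof (rule mult_mono)
    show "(t + 1) * \<bar>flat [:0,0,1:] t\<bar> \<le> 4"
    proof (cases "t > -1")
      \<comment> \<open>t = -1 occurs only for n = 0; the claim is then trivial because the weight t
        + 1 vanishes.\<close>
      case False
      moreover have "t \<ge> -1" using assms by (simp add: t_def)
      ultimately have "t = -1" by simp
      then show ?thesis by simp
    qed (rule flat_square_weighted_le)
  qed (use assms in auto)
  finally show ?thesis by simp
qed

subsection \<open>Square-integrable functions on the unit interval\<close>

abbreviation LOm :: "real measure" where "LOm \<equiv> lebesgue_on Om"

lemma finite_measure_LOm: "finite_measure LOm"
  by (rule finite_measure_lebesgue_on) (simp add: Om_def)

lemma AE_LOmI: "(\<And>x. x \<in> Om \<Longrightarrow> P x) \<Longrightarrow> AE x in LOm. P x"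
  by (rule AE_I2) simp

lemma borel_measurable_LOm: "h \<in> borel_measurable borel \<Longrightarrow> h \<in> borel_measurable LOm"
  by (rule measurable_restrict_space1) (simp add: measurable_completion)

lemma Om_borel [measurable]: "Om \<in> sets borel"
  by (simp add: Om_def)

text \<open>The definitions integrate over \<open>lebesgue_on\<close>, whereas Fubini is applied on
  the product of two copies of \<open>lborel\<close>. For Borel integrands the two agree, with the
  domain moved into an indicator.\<close>

lemma lebesgue_on_eq_lborel:
  fixes h :: "real \<Rightarrow> real"
  assumes [measurable]: "S \<in> sets borel" "h \<in> borel_measurable borel"
  shows "integrable (lebesgue_on S) h \<longleftrightarrow> integrable lborel (\<lambda>x. indicator S x * h x)"
    and "Lint_on S h = (LINT x|lborel. indicator S x * h x)"
proof -
  have S: "S \<in> sets lebesgue" using assms by simp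
  have "integrable (lebesgue_on S) h \<longleftrightarrow> integrable lebesgue (\<lambda>x. indicator S x *\<^sub>R h x)"
    by (rule integrable_restrict_space) (use S in simp)
  also have "\<dots> \<longleftrightarrow> integrable lborel (\<lambda>x. indicator S x *\<^sub>R h x)"
    by (rule integrable_completion) measurable
  finally show "integrable (lebesgue_on S) h \<longleftrightarrow> integrable lborel (\<lambda>x. indicator S x * h x)" by simp
  have "Lint_on S h = (LINT x|lebesgue. indicator S x *\<^sub>R h x)"
    by (rule integral_restrict_space) (use S in simp)
  also have "\<dots> = (LINT x|lborel. indicator S x *\<^sub>R h x)"
    by (rule integral_completion) measurable
  finally show "Lint_on S h = (LINT x|lborel. indicator S x * h x)" by simp
qed

lemma integrable_LOm_bounded:
  assumes "h \<in> borel_measurable LOm" "\<And>x. x \<in> Om \<Longrightarrow> \<bar>h x\<bar> \<le> (B::real)"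
  shows "integrable LOm h"
  by (rule finite_measure.integrable_const_bound[OF finite_measure_LOm, where B = B])
    (use assms in \<open>auto intro!: AE_LOmI\<close>)

lemma L2_bounded:
  assumes "h \<in> borel_measurable LOm" "\<And>x. x \<in> Om \<Longrightarrow> \<bar>h x\<bar> \<le> (B::real)"
  shows "L2 h"
  unfolding L2_def
proof
  show "integrable LOm (\<lambda>x. (h x)\<^sup>2)"
  proof (rule integrable_LOm_bounded[where B = "B\<^sup>2"])
    show "\<bar>(h x)\<^sup>2\<bar> \<le> B\<^sup>2" if "x \<in> Om" for x
      using assms(2)[OF that] by (simp add: power2_le_iff_abs_le)
  qed (use assms in measurable)
qed fact

lemma L2_continuous:
  assumes "continuous_on UNIV h"
  shows "L2 h"
proof -
  have "bounded (h ` {0..1})"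
    using assms by (intro compact_imp_bounded compact_continuous_image) (auto intro: continuous_on_subset)
  then obtain B where "\<forall>x\<in>{0..1}. \<bar>h x\<bar> \<le> B"
    unfolding bounded_iff by auto
  then show ?thesis
    by (intro L2_bounded[of h B] borel_measurable_LOm borel_measurable_continuous_onI assms)
      (auto simp: Om_def)
qed

lemma L2_poly: "L2 (poly p)"
  by (intro L2_continuous continuous_intros)

lemma L2_mult_integrable:
  assumes "L2 f" "L2 g"
  shows "integrable LOm (\<lambda>x. f x * g x)"
proof (rule Bochner_Integration.integrable_bound)
  show "integrable LOm (\<lambda>x. (f x)\<^sup>2 + (g x)\<^sup>2)"
    using assms by (simp add: L2_def)
  show "(\<lambda>x. f x * g x) \<in> borel_measurable LOm"
    using assms by (intro borel_measurable_times) (auto simp: L2_def)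
  have "\<bar>a * b\<bar> \<le> \<bar>a\<^sup>2 + b\<^sup>2\<bar>" for a b :: real
    using sum_squares_bound[of a b] sum_squares_bound[of a "- b"] by (auto simp: abs_le_iff)
  then show "AE x in LOm. norm (f x * g x) \<le> norm ((f x)\<^sup>2 + (g x)\<^sup>2)" by simp
qed

lemma L2_integrable: "L2 f \<Longrightarrow> integrable LOm f"
  using L2_mult_integrable[of f "\<lambda>x. 1"] L2_continuous[of "\<lambda>x. 1"] by simp

lemma L2_add: "L2 f \<Longrightarrow> L2 g \<Longrightarrow> L2 (\<lambda>x. f x + g x)"
  using L2_mult_integrable[of f g]
  by (auto simp: L2_def power2_sum mult.assoc)

lemma L2_cmult: "L2 f \<Longrightarrow> L2 (\<lambda>x. c * f x)"
  by (auto simp: L2_def power_mult_distrib)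

lemma L2_minus: "L2 f \<Longrightarrow> L2 (\<lambda>x. - f x)"
  using L2_cmult[of f "-1"] by simp

lemma L2_diff: "L2 f \<Longrightarrow> L2 g \<Longrightarrow> L2 (\<lambda>x. f x - g x)"
  using L2_add[of f "\<lambda>x. - g x"] L2_minus[of g] by simp

lemma L2_norm_nonneg: "L2_norm f \<ge> 0"
  by (simp add: L2_norm_def)

lemma L2_norm_power2: "(L2_norm f)\<^sup>2 = Lint_on Om (\<lambda>x. (f x)\<^sup>2)"
  by (simp add: L2_norm_def)

text \<open>Stated for an arbitrary measure because it serves both on the unit interval and, in the
  nonlocal Poincare inequality, on the plane. It expresses that the quadratic in t given by the
  integral of (f - t g)^2 is nonnegative.\<close>

lemma Cauchy_Schwarz_integral:
  fixes f g :: "'a \<Rightarrow> real"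
  assumes "integrable M (\<lambda>x. (f x)\<^sup>2)" "integrable M (\<lambda>x. (g x)\<^sup>2)" "integrable M (\<lambda>x. f x * g x)"
  shows "(LINT x|M. f x * g x)\<^sup>2 \<le> (LINT x|M. (f x)\<^sup>2) * (LINT x|M. (g x)\<^sup>2)"
proof -
  define A B C where "A = (LINT x|M. (f x)\<^sup>2)" and "B = (LINT x|M. f x * g x)"
    and "C = (LINT x|M. (g x)\<^sup>2)"
  have *: "A - 2 * t * B + t\<^sup>2 * C \<ge> 0" for t
  proof -
    have "0 \<le> (LINT x|M. (f x - t * g x)\<^sup>2)" by simp
    also have "(\<lambda>x. (f x - t * g x)\<^sup>2) = (\<lambda>x. (f x)\<^sup>2 - (2 * t) * (f x * g x) + t\<^sup>2 * (g x)\<^sup>2)"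
      by (auto simp: power2_eq_square algebra_simps)
    also have "(LINT x|M. \<dots> x) = A - 2 * t * B + t\<^sup>2 * C"
      using assms by (simp add: A_def B_def C_def)
    finally show ?thesis .
  qed
  have C: "C \<ge> 0" by (simp add: C_def)
  show ?thesis
  proof (cases "C = 0")
    case True
    have "B = 0"
    proof (rule ccontr)
      assume "B \<noteq> 0"
      \<comment> \<open>With C = 0 the quadratic is linear in t, and this t gives it the value
        -1.\<close>
      then show False using *[of "(A + 1) / (2 * B)"] True by (simp add: field_simps)
    qed
    then show ?thesis using True by (simp add: A_def B_def C_def)
  next
    case False
    then have "B\<^sup>2 \<le> A * C"
      using *[of "B / C"] C by (simp add: field_simps power2_eq_square)
    then show ?thesis by (simp add: A_def B_def C_def)
  qed
qed

lemma L2_Cauchy_Schwarz: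
  assumes "L2 f" "L2 g"
  shows "\<bar>Lint_on Om (\<lambda>x. f x * g x)\<bar> \<le> L2_norm f * L2_norm g"
proof (rule power2_le_imp_le)
  show "\<bar>Lint_on Om (\<lambda>x. f x * g x)\<bar>\<^sup>2 \<le> (L2_norm f * L2_norm g)\<^sup>2"
    using Cauchy_Schwarz_integral[of LOm f g] assms L2_mult_integrable[OF assms]
    by (simp add: L2_def power_mult_distrib L2_norm_power2)
qed (simp add: L2_norm_nonneg)

lemma L2_norm_triangle:
  assumes "L2 f" "L2 g"
  shows "L2_norm (\<lambda>x. f x + g x) \<le> L2_norm f + L2_norm g"
proof (rule power2_le_imp_le)
  have "(L2_norm (\<lambda>x. f x + g x))\<^sup>2 = (L2_norm f)\<^sup>2 + (L2_norm g)\<^sup>2 + 2 * Lint_on Om (\<lambda>x. f x * g x)"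
    using assms L2_mult_integrable[OF assms]
    by (simp add: L2_norm_power2 power2_sum L2_def mult.assoc)
  also have "\<dots> \<le> (L2_norm f + L2_norm g)\<^sup>2"
    using L2_Cauchy_Schwarz[OF assms] by (simp add: power2_sum)
  finally show "(L2_norm (\<lambda>x. f x + g x))\<^sup>2 \<le> (L2_norm f + L2_norm g)\<^sup>2" .
qed (simp add: L2_norm_nonneg)

lemma L2_norm_minus_commute: "L2_norm (\<lambda>x. f x - g x) = L2_norm (\<lambda>x. g x - f x)"
  by (simp add: L2_norm_def power2_commute)

lemma L2_norm_le_sup:
  assumes "h \<in> borel_measurable LOm" "\<And>x. x \<in> Om \<Longrightarrow> \<bar>h x\<bar> \<le> B"
  shows "L2_norm h \<le> B"
proof -
  have "\<bar>h (1/2)\<bar> \<le> B" by (rule assms(2)) (simp add: Om_def)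
  then have B: "B \<ge> 0" by linarith
  have "Lint_on Om (\<lambda>x. (h x)\<^sup>2) \<le> Lint_on Om (\<lambda>x. B\<^sup>2)"
  proof (rule integral_mono)
    show "integrable LOm (\<lambda>x. (h x)\<^sup>2)" using L2_bounded[OF assms] by (simp add: L2_def)
    show "integrable LOm (\<lambda>x. B\<^sup>2)" using finite_measure_LOm by (rule finite_measure.integrable_const)
    show "(h x)\<^sup>2 \<le> B\<^sup>2" if "x \<in> space LOm" for x
      using assms(2)[of x] that B by (simp add: abs_le_square_iff[symmetric])
  qed
  also have "\<dots> = B\<^sup>2"
    by (simp add: measure_restrict_space Om_def)
  finally have "L2_norm h \<le> sqrt (B\<^sup>2)"
    unfolding L2_norm_def by (rule real_sqrt_le_mono)
  with B show ?thesis by simp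
qed

lemma LOm_FTC:
  assumes "\<And>x. (F has_field_derivative f x) (at x)" "continuous_on UNIV f"
  shows "Lint_on Om f = F 1 - F 0"
proof -
  have [measurable]: "f \<in> borel_measurable borel"
    by (rule borel_measurable_continuous_onI) fact
  have "Lint_on Om f = (LINT x|lborel. indicator Om x * f x)"
    by (rule lebesgue_on_eq_lborel) measurable
  also have "\<dots> = (LINT x|lborel. f x * indicator {0..1} x)"
  proof (rule integral_cong_AE)
    have "AE x in lborel. x \<noteq> (0::real)" "AE x in lborel. x \<noteq> (1::real)"
      by (rule AE_lborel_singleton)+
    then show "AE x in lborel. indicator Om x * f x = f x * indicator {0..1} x"
      by eventually_elim (auto simp: Om_def indicator_def)
  qed measurable
  also have "\<dots> = F 1 - F 0"
    using assms by (intro integral_FTC_Icc_real) (auto simp: continuous_on_eq_continuous_at)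
  finally show ?thesis .
qed

lemma continuous_on_deriv_test_fun:
  assumes "test_fun \<phi>"
  shows "continuous_on UNIV \<phi>" "continuous_on UNIV (deriv \<phi>)"
proof -
  show "continuous_on UNIV \<phi>"
    using Cn_DERIV[OF test_fun_Cn[OF assms]] DERIV_isCont by (fastforce simp: continuous_on_eq_continuous_at)
  have "Cn 0 (deriv \<phi>)" using test_fun_Cn[OF assms, of "Suc 0"] by (simp add: Cn_Suc)
  then show "continuous_on UNIV (deriv \<phi>)"
    using Cn_DERIV DERIV_isCont by (fastforce simp: continuous_on_eq_continuous_at)
qed

lemma test_fun_endpoints: "test_fun \<phi> \<Longrightarrow> \<phi> 0 = 0 \<and> \<phi> 1 = 0"
  unfolding test_fun_def by (metis atLeastAtMost_iff not_le)

section \<open>Dirichlet problems with polynomial data\<close>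

lemma exists_pderiv: "\<exists>p. pderiv p = (q :: real poly)"
proof
  have "pderiv (\<Sum>i\<le>degree q. monom (coeff q i / real (Suc i)) (Suc i)) = (\<Sum>i\<le>degree q. monom (coeff q i) i)"
    by (simp add: higher_pderiv_sum[of 1, simplified] pderiv_monom del: of_nat_Suc)
  also have "\<dots> = q" by (rule poly_as_sum_of_monoms)
  finally show "pderiv (\<Sum>i\<le>degree q. monom (coeff q i / real (Suc i)) (Suc i)) = q" .
qed

lemma exists_poly_Dirichlet:
  obtains z :: "real poly" where "pderiv (pderiv z) = - q" "poly z 0 = 0" "poly z 1 = 0"
proof -
  obtain p1 where p1: "pderiv p1 = - q" using exists_pderiv by blast
  obtain p where p: "pderiv p = p1" using exists_pderiv by blast
  \<comment> \<open>Subtracting the chord makes both end values zero and leaves the second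
    derivative unchanged.\<close>
  define z where "z = p - [:poly p 0, poly p 1 - poly p 0:]"
  show thesis
    by (rule that[of z]) (auto simp: z_def p p1 pderiv_diff pderiv_pCons)
qed

text \<open>The factor F is only continuously differentiable here: besides polynomials, the rule is
  applied to the test functions that approximate a weak solution.\<close>

lemma integral_by_parts_LOm:
  assumes "\<And>x. (F has_field_derivative F' x) (at x)" "continuous_on UNIV F'"
    and "F 0 * poly z 0 = F 1 * poly z 1"
  shows "Lint_on Om (\<lambda>x. F x * poly (pderiv z) x) = - Lint_on Om (\<lambda>x. F' x * poly z x)"
proof -
  have F: "continuous_on UNIV F"
    using assms(1) DERIV_isCont by (fastforce simp: continuous_on_eq_continuous_at)
  have "Lint_on Om (\<lambda>x. F x * poly (pderiv z) x + F' x * poly z x) = F 1 * poly z 1 - F 0 * poly z 0"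
    using assms F by (intro LOm_FTC[where F = "\<lambda>x. F x * poly z x"])
      (auto intro!: derivative_eq_intros continuous_intros simp: mult_ac)
  moreover have "Lint_on Om (\<lambda>x. F x * poly (pderiv z) x + F' x * poly z x) =
    Lint_on Om (\<lambda>x. F x * poly (pderiv z) x) + Lint_on Om (\<lambda>x. F' x * poly z x)"
    using assms F by (intro Bochner_Integration.integral_add L2_mult_integrable L2_continuous)
      (auto intro!: continuous_intros)
  ultimately show ?thesis using assms(3) by simp
qed

text \<open>The energy identity bounds ||z'||^2 by ||z''|| ||z||. Integrating z^2 against the
  derivative of x turns ||z||^2 into -2 times the integral of x z z', hence the Poincare bound ||z||
  \<le> 2 ||z'||. Together they give ||z'|| \<le> 2 ||z''||, and 4 = 2 * 2.\<close>

lemma poly_Dirichlet_estimate: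
  assumes "poly z 0 = 0" "poly z 1 = 0"
  shows "L2_norm (poly z) \<le> 4 * L2_norm (poly (pderiv (pderiv z)))"
proof -
  let ?z = "L2_norm (poly z)" and ?z' = "L2_norm (poly (pderiv z))"
    and ?q = "L2_norm (poly (pderiv (pderiv z)))"
  have "?z'\<^sup>2 = Lint_on Om (\<lambda>x. poly (pderiv z) x * poly (pderiv z) x)"
    unfolding L2_norm_power2 by (simp add: power2_eq_square)
  also have "\<dots> = - Lint_on Om (\<lambda>x. poly (pderiv (pderiv z)) x * poly z x)"
    using assms by (intro integral_by_parts_LOm) (auto intro!: derivative_eq_intros continuous_intros)
  also have "\<dots> \<le> ?q * ?z"
    using L2_Cauchy_Schwarz[OF L2_poly L2_poly, of "pderiv (pderiv z)" z] by linarith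
  finally have 1: "?z'\<^sup>2 \<le> ?q * ?z" .
  have "?z\<^sup>2 = Lint_on Om (\<lambda>x. (poly z x)\<^sup>2 * poly (pderiv [:0,1:]) x)"
    unfolding L2_norm_power2 by (simp add: pderiv_pCons)
  also have "\<dots> = - Lint_on Om (\<lambda>x. 2 * poly z x * poly (pderiv z) x * poly [:0,1:] x)"
    using assms by (intro integral_by_parts_LOm) (auto intro!: derivative_eq_intros continuous_intros)
  also have "\<dots> = - 2 * Lint_on Om (\<lambda>x. poly ([:0,1:] * z) x * poly (pderiv z) x)"
  proof -
    have "(\<lambda>x. 2 * poly z x * poly (pderiv z) x * poly [:0,1:] x) = (\<lambda>x. 2 * (poly ([:0,1:] * z) x * poly (pderiv z) x))"
      by (simp add: mult_ac)
    then show ?thesis by simp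
  qed
  also have "\<dots> \<le> 2 * (L2_norm (poly ([:0,1:] * z)) * ?z')"
    using L2_Cauchy_Schwarz[OF L2_poly L2_poly, of "[:0,1:] * z" "pderiv z"] by linarith
  also have "\<dots> \<le> 2 * (?z * ?z')"
  proof -
    have "Lint_on Om (\<lambda>x. (poly ([:0,1:] * z) x)\<^sup>2) \<le> Lint_on Om (\<lambda>x. (poly z x)\<^sup>2)"
    proof (rule integral_mono)
      show "integrable LOm (\<lambda>x. (poly ([:0,1:] * z) x)\<^sup>2)" "integrable LOm (\<lambda>x. (poly z x)\<^sup>2)"
        using L2_poly by (simp_all only: L2_def)
      show "(poly ([:0,1:] * z) x)\<^sup>2 \<le> (poly z x)\<^sup>2" if "x \<in> space LOm" for x
        using that by (auto simp: Om_def abs_le_square_iff[symmetric] abs_mult intro!: mult_left_le_one_le)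
    qed
    then have "L2_norm (poly ([:0,1:] * z)) \<le> ?z"
      unfolding L2_norm_def by (rule real_sqrt_le_mono)
    then show ?thesis by (intro mult_left_mono mult_right_mono L2_norm_nonneg) auto
  qed
  finally have "?z * ?z \<le> (2 * ?z') * ?z" by (simp add: power2_eq_square mult_ac)
  then have 2: "?z \<le> 2 * ?z'"
    using L2_norm_nonneg[of "poly z"] L2_norm_nonneg[of "poly (pderiv z)"]
    by (cases "?z = 0") (auto simp: mult_le_cancel_right)
  have "?z' * ?z' \<le> (2 * ?q) * ?z'"
    using 1 mult_left_mono[OF 2 L2_norm_nonneg[of "poly (pderiv (pderiv z))"]]
    by (simp add: power2_eq_square mult_ac)
  then have "?z' \<le> 2 * ?q"
    using L2_norm_nonneg[of "poly (pderiv z)"] L2_norm_nonneg[of "poly (pderiv (pderiv z))"]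
    by (cases "?z' = 0") (auto simp: mult_le_cancel_right)
  with 2 show ?thesis by linarith
qed

text \<open>Test with \<open>z\<close> times a cutoff: the derivative of the cutoff blows up only like the inverse distance to
  the boundary, which the zeros of \<open>z\<close> absorb.\<close>
lemma weak_form_poly:
  assumes g: "L2 g" and f: "L2 f"
    and weak: "\<And>\<phi>. test_fun \<phi> \<Longrightarrow> Lint_on Om (\<lambda>x. g x * deriv \<phi> x) = Lint_on Om (\<lambda>x. f x * \<phi> x)"
    and z: "poly z 0 = 0" "poly z 1 = 0"
  shows "Lint_on Om (\<lambda>x. g x * poly (pderiv z) x) = Lint_on Om (\<lambda>x. f x * poly z x)"
proof -
  \<comment> \<open>Both zeros are divided out, leaving z = -x (1 - x) r. The factor x (1 - x) is
    the weight in \<open>cutoff'_bound\<close>.\<close>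
  obtain r1 where r1: "z = [:0,1:] * r1"
    using z(1) poly_eq_0_iff_dvd[of z 0] by (auto elim: dvdE)
  then have "poly r1 1 = 0" using z(2) by simp
  then obtain r where r: "r1 = [:-1,1:] * r"
    using poly_eq_0_iff_dvd[of r1 1] by (auto elim: dvdE)
  then have zr: "poly z x = - (x * (1 - x)) * poly r x" for x
    by (simp add: r1 r algebra_simps)
  have "\<exists>B. \<forall>x\<in>Om. \<bar>poly p x\<bar> \<le> B" for p :: "real poly"
  proof -
    have "bounded (poly p ` {0..1})"
      by (intro compact_imp_bounded compact_continuous_image continuous_intros) auto
    then show ?thesis by (fastforce simp: bounded_iff Om_def)
  qed
  then obtain B B1 B2 where B: "\<And>x. x \<in> Om \<Longrightarrow> \<bar>poly r x\<bar> \<le> B"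
    and B1: "\<And>x. x \<in> Om \<Longrightarrow> \<bar>poly z x\<bar> \<le> B1" and B2: "\<And>x. x \<in> Om \<Longrightarrow> \<bar>poly (pderiv z) x\<bar> \<le> B2"
    by metis
  \<comment> \<open>The shift by 2 meets the requirement n \<ge> 2 of
    \<open>test_fun_poly_cutoff\<close>, under which the support interval [1/n, 1 - 1/n] is
    nonempty.\<close>
  define \<phi> where "\<phi> n x = poly z x * cutoff (n + 2) x" for n x
  have test: "test_fun (\<phi> n)" for n
    unfolding \<phi>_def by (rule test_fun_poly_cutoff) simp
  have "((\<phi> n) has_field_derivative (poly (pderiv z) x * cutoff (n + 2) x + cutoff' (n + 2) x * poly z x)) (at x)" for n x
    unfolding \<phi>_def by (intro DERIV_mult cutoff_DERIV poly_DERIV)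
  then have d\<phi>: "deriv (\<phi> n) x = poly (pderiv z) x * cutoff (n + 2) x + cutoff' (n + 2) x * poly z x" for n x
    by (rule DERIV_imp_deriv)
  have meas: "\<phi> n \<in> borel_measurable LOm" "deriv (\<phi> n) \<in> borel_measurable LOm" for n
    using continuous_on_deriv_test_fun[OF test]
    by (auto intro!: borel_measurable_LOm borel_measurable_continuous_onI)
  have gm [measurable]: "g \<in> borel_measurable LOm" "f \<in> borel_measurable LOm"
    using f g by (auto simp: L2_def)
  have pm [measurable]: "poly p \<in> borel_measurable LOm" for p
    by (intro borel_measurable_LOm borel_measurable_continuous_onI continuous_intros)
  have c1: "\<bar>cutoff n x\<bar> \<le> 1" for n x
    by (simp add: cutoff_def flat_one_le)
  have lim_g: "(\<lambda>n. Lint_on Om (\<lambda>x. g x * deriv (\<phi> n) x)) \<longlonglongrightarrow> Lint_on Om (\<lambda>x. g x * poly (pderiv z) x)"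
  \<comment> \<open>\<open>B2\<close> dominates z' times the cutoff; \<open>4 * B\<close> dominates
    the derivative of the cutoff times z = -x (1 - x) r.\<close>
  proof (rule integral_dominated_convergence[where w = "\<lambda>x. (B2 + 4 * B) * \<bar>g x\<bar>"])
    show "integrable LOm (\<lambda>x. (B2 + 4 * B) * \<bar>g x\<bar>)"
      using L2_integrable[OF g] by simp
    show "AE x in LOm. (\<lambda>n. g x * deriv (\<phi> n) x) \<longlonglongrightarrow> g x * poly (pderiv z) x"
    proof (rule AE_LOmI)
      fix x assume "x \<in> Om"
      then have "(\<lambda>n. cutoff (n + 2) x) \<longlonglongrightarrow> 1" "(\<lambda>n. cutoff' (n + 2) x) \<longlonglongrightarrow> 0"
        using cutoff_tendsto[of x] unfolding Om_def by (intro LIMSEQ_ignore_initial_segment; simp)+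
      then have "(\<lambda>n. g x * (poly (pderiv z) x * cutoff (n + 2) x + cutoff' (n + 2) x * poly z x))
          \<longlonglongrightarrow> g x * (poly (pderiv z) x * 1 + 0 * poly z x)"
        by (intro tendsto_intros)
      then show "(\<lambda>n. g x * deriv (\<phi> n) x) \<longlonglongrightarrow> g x * poly (pderiv z) x"
        by (simp add: d\<phi>)
    qed
    show "AE x in LOm. norm (g x * deriv (\<phi> n) x) \<le> (B2 + 4 * B) * \<bar>g x\<bar>" for n
    proof (rule AE_LOmI)
      fix x assume x: "x \<in> Om"
      have "\<bar>poly (pderiv z) x * cutoff (n + 2) x\<bar> \<le> B2 * 1"
        unfolding abs_mult using B2[OF x] c1 by (intro mult_mono) auto
      moreover have "\<bar>cutoff' (n + 2) x * poly z x\<bar> \<le> 4 * B"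
      proof -
        have "\<bar>cutoff' (n + 2) x * poly z x\<bar> = \<bar>x * (1 - x) * cutoff' (n + 2) x\<bar> * \<bar>poly r x\<bar>"
          by (simp add: zr abs_mult mult_ac)
        also have "\<dots> \<le> 4 * B"
          using cutoff'_bound[of x "n + 2"] x B[OF x] by (intro mult_mono) (auto simp: Om_def)
        finally show ?thesis .
      qed
      ultimately have "\<bar>deriv (\<phi> n) x\<bar> \<le> B2 + 4 * B"
        unfolding d\<phi> by linarith
      then show "norm (g x * deriv (\<phi> n) x) \<le> (B2 + 4 * B) * \<bar>g x\<bar>"
        using mult_left_mono[of "\<bar>deriv (\<phi> n) x\<bar>" "B2 + 4 * B" "\<bar>g x\<bar>"]
        by (simp add: abs_mult mult.commute)
    qed
  qed (use meas in measurable)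
  have lim_f: "(\<lambda>n. Lint_on Om (\<lambda>x. f x * \<phi> n x)) \<longlonglongrightarrow> Lint_on Om (\<lambda>x. f x * poly z x)"
  proof (rule integral_dominated_convergence[where w = "\<lambda>x. B1 * \<bar>f x\<bar>"])
    show "integrable LOm (\<lambda>x. B1 * \<bar>f x\<bar>)"
      using L2_integrable[OF f] by simp
    show "AE x in LOm. (\<lambda>n. f x * \<phi> n x) \<longlonglongrightarrow> f x * poly z x"
    proof (rule AE_LOmI)
      fix x assume "x \<in> Om"
      then have "(\<lambda>n. cutoff (n + 2) x) \<longlonglongrightarrow> 1"
        using cutoff_tendsto[of x] unfolding Om_def by (intro LIMSEQ_ignore_initial_segment; simp)
      then have "(\<lambda>n. f x * (poly z x * cutoff (n + 2) x)) \<longlonglongrightarrow> f x * (poly z x * 1)"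
        by (intro tendsto_intros)
      then show "(\<lambda>n. f x * \<phi> n x) \<longlonglongrightarrow> f x * poly z x"
        by (simp add: \<phi>_def)
    qed
    show "AE x in LOm. norm (f x * \<phi> n x) \<le> B1 * \<bar>f x\<bar>" for n
    proof (rule AE_LOmI)
      fix x assume x: "x \<in> Om"
      have "\<bar>\<phi> n x\<bar> \<le> B1 * 1"
        unfolding \<phi>_def abs_mult using B1[OF x] c1 by (intro mult_mono) auto
      then show "norm (f x * \<phi> n x) \<le> B1 * \<bar>f x\<bar>"
        using mult_left_mono[of "\<bar>\<phi> n x\<bar>" B1 "\<bar>f x\<bar>"] by (simp add: abs_mult mult.commute)
    qed
  qed (use meas in measurable)
  from lim_f weak[OF test] lim_g show ?thesis
    by (simp add: LIMSEQ_unique)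
qed

text \<open>A Lebesgue measurable f is an almost everywhere limit of continuous functions, but these
  come without a dominating function. Clipping supplies one: f is replaced by its truncation at a
  height M, and the same truncation applied to the continuous approximants keeps them continuous and
  all differences at most 2 M.\<close>

lemma exists_continuous_L2_approx:
  assumes f: "L2 f" and e: "e > 0"
  obtains h where "continuous_on UNIV h" "L2_norm (\<lambda>x. f x - h x) < e"
proof -
  have fm [measurable]: "f \<in> borel_measurable LOm" using f by (simp add: L2_def)
  define clip where "clip M t = max (- M) (min M t)" for M t :: real
  have clipc: "continuous_on UNIV (clip M)" for M
    unfolding clip_def by (intro continuous_intros)
  have clipb: "M \<ge> 0 \<Longrightarrow> \<bar>clip M t\<bar> \<le> M" for M t by (auto simp: clip_def)
  have clipm [measurable]: "clip M \<in> borel_measurable borel" for M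
    by (intro borel_measurable_continuous_onI clipc)
  have "(\<lambda>n. Lint_on Om (\<lambda>x. (f x - clip (real n) (f x))\<^sup>2)) \<longlonglongrightarrow> Lint_on Om (\<lambda>x. 0)"
  proof (rule integral_dominated_convergence[where w = "\<lambda>x. (f x)\<^sup>2"])
    show "integrable LOm (\<lambda>x. (f x)\<^sup>2)" using f by (simp add: L2_def)
    show "AE x in LOm. (\<lambda>n. (f x - clip (real n) (f x))\<^sup>2) \<longlonglongrightarrow> 0"
    proof (rule AE_LOmI)
      fix x
      show "(\<lambda>n. (f x - clip (real n) (f x))\<^sup>2) \<longlonglongrightarrow> 0"
      proof (rule tendsto_eventually)
        obtain N where "real N \<ge> \<bar>f x\<bar>" using real_arch_simple by blast
        then have "(f x - clip (real n) (f x))\<^sup>2 = 0" if "n \<ge> N" for n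
          using that by (auto simp: clip_def max_def min_def)
        then show "\<forall>\<^sub>F n in sequentially. (f x - clip (real n) (f x))\<^sup>2 = 0"
          by (auto simp: eventually_sequentially)
      qed
    qed
    show "AE x in LOm. norm ((f x - clip (real n) (f x))\<^sup>2) \<le> (f x)\<^sup>2" for n
      by (intro AE_LOmI) (auto simp: clip_def abs_le_square_iff[symmetric] max_def min_def)
  qed measurable
  then have "(\<lambda>n. L2_norm (\<lambda>x. f x - clip (real n) (f x))) \<longlonglongrightarrow> 0"
    unfolding L2_norm_def using tendsto_real_sqrt by fastforce
  then have "\<forall>\<^sub>F n in sequentially. L2_norm (\<lambda>x. f x - clip (real n) (f x)) < e / 2"
    using e by (intro order_tendstoD) auto
  then obtain M where M: "L2_norm (\<lambda>x. f x - clip (real M) (f x)) < e / 2"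
    by (auto simp: eventually_sequentially)
  have "f measurable_on Om"
    using fm by (simp add: measurable_on_iff_borel_measurable Om_def)
  then obtain N g where N: "negligible N" and g: "\<And>n. continuous_on UNIV (g n)"
    and lim: "\<And>x. x \<notin> N \<Longrightarrow> (\<lambda>n. g n x) \<longlonglongrightarrow> (if x \<in> Om then f x else 0)"
    unfolding measurable_on_def by blast
  have gc: "continuous_on UNIV (\<lambda>x. clip (real M) (g n x))" for n
    using clipc g by (rule continuous_on_compose2) auto
  have [measurable]: "(\<lambda>x. clip (real M) (g n x)) \<in> borel_measurable LOm" for n
    by (intro borel_measurable_LOm borel_measurable_continuous_onI gc)
  have "(\<lambda>n. Lint_on Om (\<lambda>x. (clip (real M) (f x) - clip (real M) (g n x))\<^sup>2)) \<longlonglongrightarrow> Lint_on Om (\<lambda>x. 0)"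
  proof (rule integral_dominated_convergence[where w = "\<lambda>x. (2 * real M)\<^sup>2"])
    show "integrable LOm (\<lambda>x. (2 * real M)\<^sup>2)"
      using finite_measure_LOm by (rule finite_measure.integrable_const)
    have "AE x in LOm. x \<notin> N"
    proof (rule AE_I)
      show "{x \<in> space LOm. \<not> x \<notin> N} \<subseteq> N \<inter> Om" by auto
      have "N \<inter> Om \<in> null_sets lebesgue"
        using N by (auto simp: negligible_iff_null_sets Om_def intro: null_set_Int2)
      then show "N \<inter> Om \<in> sets LOm" "emeasure LOm (N \<inter> Om) = 0"
        by (auto simp: sets_restrict_space_iff emeasure_restrict_space Om_def)
    qed
    then show "AE x in LOm. (\<lambda>n. (clip (real M) (f x) - clip (real M) (g n x))\<^sup>2) \<longlonglongrightarrow> 0"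
      using AE_space
    proof eventually_elim
      case (elim x)
      then have "(\<lambda>n. g n x) \<longlonglongrightarrow> f x" using lim[of x] by simp
      then have "(\<lambda>n. clip (real M) (g n x)) \<longlonglongrightarrow> clip (real M) (f x)"
        unfolding clip_def by (intro tendsto_intros)
      then have "(\<lambda>n. (clip (real M) (f x) - clip (real M) (g n x))\<^sup>2) \<longlonglongrightarrow> (clip (real M) (f x) - clip (real M) (f x))\<^sup>2"
        by (intro tendsto_intros)
      then show ?case by simp
    qed
    show "AE x in LOm. norm ((clip (real M) (f x) - clip (real M) (g n x))\<^sup>2) \<le> (2 * real M)\<^sup>2" for n
    proof (rule AE_LOmI)
      fix x
      have "\<bar>clip (real M) (f x) - clip (real M) (g n x)\<bar> \<le> \<bar>2 * real M\<bar>"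
        using clipb[of "real M" "f x"] clipb[of "real M" "g n x"] by linarith
      then show "norm ((clip (real M) (f x) - clip (real M) (g n x))\<^sup>2) \<le> (2 * real M)\<^sup>2"
        by (simp only: abs_le_square_iff real_norm_def abs_power2)
    qed
  qed measurable
  then have "(\<lambda>n. L2_norm (\<lambda>x. clip (real M) (f x) - clip (real M) (g n x))) \<longlonglongrightarrow> 0"
    unfolding L2_norm_def using tendsto_real_sqrt by fastforce
  then have "\<forall>\<^sub>F n in sequentially. L2_norm (\<lambda>x. clip (real M) (f x) - clip (real M) (g n x)) < e / 2"
    using e by (intro order_tendstoD) auto
  then obtain n where n: "L2_norm (\<lambda>x. clip (real M) (f x) - clip (real M) (g n x)) < e / 2"
    by (auto simp: eventually_sequentially)
  have Lc: "L2 (\<lambda>x. clip (real M) (f x))"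
    by (rule L2_bounded[where B = "real M"]) (measurable, use clipb in auto)
  show thesis
  proof (rule that[OF gc[of n]])
    have "L2_norm (\<lambda>x. (f x - clip (real M) (f x)) + (clip (real M) (f x) - clip (real M) (g n x))) < e"
      using L2_norm_triangle[OF L2_diff[OF f Lc] L2_diff[OF Lc L2_continuous[OF gc]], of n] M n
      by linarith
    then show "L2_norm (\<lambda>x. f x - clip (real M) (g n x)) < e" by simp
  qed
qed

text \<open>Weierstrass on [0,1] applies to the continuous approximant, and a uniform error carries
  over to \<open>L2_norm\<close> because the interval has length 1.\<close>

lemma exists_poly_L2_approx:
  assumes f: "L2 f" and e: "e > 0"
  obtains p where "L2_norm (\<lambda>x. f x - poly p x) < e"
proof -
  obtain h where h: "continuous_on UNIV h" "L2_norm (\<lambda>x. f x - h x) < e / 2"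
    using exists_continuous_L2_approx[OF f, of "e / 2"] e by auto
  obtain P where P: "real_polynomial_function P" "\<And>x. x \<in> {0..1} \<Longrightarrow> \<bar>h x - P x\<bar> < e / 2"
    using Stone_Weierstrass_real_polynomial_function[of "{0..1::real}" h "e / 2"] h(1) e
    by (auto intro: continuous_on_subset)
  obtain a n where an: "P = (\<lambda>x. \<Sum>i\<le>n. a i * x ^ i)"
    using P(1) unfolding real_polynomial_function_iff_sum by blast
  define p where "p = (\<Sum>i\<le>n. monom (a i) i)"
  have Pp: "P x = poly p x" for x
    by (simp add: an p_def poly_sum poly_monom)
  show thesis
  proof (rule that)
    have hm: "(\<lambda>x. h x - poly p x) \<in> borel_measurable LOm"
      by (intro borel_measurable_LOm borel_measurable_continuous_onI continuous_intros h)
    have "L2_norm (\<lambda>x. h x - poly p x) \<le> e / 2"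
      by (rule L2_norm_le_sup[OF hm]) (use P(2) in \<open>auto simp: Om_def Pp less_imp_le\<close>)
    moreover have "L2_norm (\<lambda>x. (f x - h x) + (h x - poly p x))
        \<le> L2_norm (\<lambda>x. f x - h x) + L2_norm (\<lambda>x. h x - poly p x)"
      by (intro L2_norm_triangle L2_diff f L2_continuous[OF h(1)] L2_poly)
    ultimately show "L2_norm (\<lambda>x. f x - poly p x) < e" using h(2) by simp
  qed
qed

text \<open>Duality. Every polynomial q is -y'' for a polynomial y vanishing at the end points, and
  moving derivatives onto y gives <u - z, q> = <f + z'', y> with ||y|| \<le> 4 ||q||. Letting q
  approach u - z in L2 yields the bound.\<close>

lemma weak_sol_poly_estimate:
  assumes sol: "weak_sol f u" and f: "L2 f" and z: "poly z 0 = 0" "poly z 1 = 0"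
  shows "L2 u" and "L2_norm (\<lambda>x. u x - poly z x) \<le> 4 * L2_norm (\<lambda>x. f x + poly (pderiv (pderiv z)) x)"
proof -
  obtain g where H: "H10 u g"
    and weak: "\<And>\<phi>. test_fun \<phi> \<Longrightarrow> Lint_on Om (\<lambda>x. g x * deriv \<phi> x) = Lint_on Om (\<lambda>x. f x * \<phi> x)"
    using sol unfolding weak_sol_def by blast
  have g: "L2 g" and u: "L2 u" using H by (auto simp: H10_def weak_deriv_def)
  show "L2 u" by (fact u)
  obtain \<phi> where \<phi>: "\<And>n. test_fun (\<phi> n)"
    and lim: "(\<lambda>n. L2_norm (\<lambda>x. \<phi> n x - u x) + L2_norm (\<lambda>x. deriv (\<phi> n) x - g x)) \<longlonglongrightarrow> 0"
    using H by (auto simp: H10_def)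
  have \<phi>L: "L2 (\<phi> n)" "L2 (deriv (\<phi> n))" for n
    by (intro L2_continuous continuous_on_deriv_test_fun \<phi>)+
  have lim1: "(\<lambda>n. L2_norm (\<lambda>x. \<phi> n x - u x)) \<longlonglongrightarrow> 0"
    by (rule tendsto_sandwich[OF _ _ tendsto_const lim]) (auto simp: L2_norm_nonneg)
  have lim2: "(\<lambda>n. L2_norm (\<lambda>x. deriv (\<phi> n) x - g x)) \<longlonglongrightarrow> 0"
    by (rule tendsto_sandwich[OF _ _ tendsto_const lim]) (auto simp: L2_norm_nonneg)
  have strong_weak: "(\<lambda>n. Lint_on Om (\<lambda>x. a n x * poly p x)) \<longlonglongrightarrow> Lint_on Om (\<lambda>x. b x * poly p x)"
    if a: "\<And>n. L2 (a n)" and b: "L2 b" and ab: "(\<lambda>n. L2_norm (\<lambda>x. a n x - b x)) \<longlonglongrightarrow> 0" for a b p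
  proof -
    have "(\<lambda>n. Lint_on Om (\<lambda>x. (a n x - b x) * poly p x)) \<longlonglongrightarrow> 0"
    proof (rule tendsto_rabs_zero_cancel, rule tendsto_sandwich[OF _ _ tendsto_const])
      show "(\<lambda>n. L2_norm (\<lambda>x. a n x - b x) * L2_norm (poly p)) \<longlonglongrightarrow> 0"
        using tendsto_mult_right[OF ab, of "L2_norm (poly p)"] by simp
      show "\<forall>\<^sub>F n in sequentially. \<bar>Lint_on Om (\<lambda>x. (a n x - b x) * poly p x)\<bar> \<le> L2_norm (\<lambda>x. a n x - b x) * L2_norm (poly p)"
        using L2_Cauchy_Schwarz[OF L2_diff[OF a b] L2_poly] by auto
    qed auto
    moreover have "Lint_on Om (\<lambda>x. (a n x - b x) * poly p x) = Lint_on Om (\<lambda>x. a n x * poly p x) - Lint_on Om (\<lambda>x. b x * poly p x)" for n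
      using L2_mult_integrable[OF a L2_poly] L2_mult_integrable[OF b L2_poly] by (simp add: left_diff_distrib)
    ultimately show ?thesis by (simp add: LIM_zero_iff)
  qed
  let ?v = "\<lambda>x. u x - poly z x" and ?F = "\<lambda>x. f x + poly (pderiv (pderiv z)) x"
  have v: "L2 ?v" and F: "L2 ?F" by (intro L2_diff L2_add u f L2_poly)+
  have dual: "Lint_on Om (\<lambda>x. ?v x * poly q x) \<le> 4 * L2_norm ?F * L2_norm (poly q)" for q
  proof -
    obtain y where y: "pderiv (pderiv y) = - q" "poly y 0 = 0" "poly y 1 = 0"
      using exists_poly_Dirichlet[of q] by blast
    \<comment> \<open>Integration by parts is available for the smooth approximants, which vanish at
      the end points; both sides then pass to the limit in L2. The second integration by parts, on
      g, is the weak formulation tested with y.\<close>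
    have "Lint_on Om (\<lambda>x. \<phi> n x * poly (pderiv (pderiv y)) x) = - Lint_on Om (\<lambda>x. deriv (\<phi> n) x * poly (pderiv y) x)" for n
      using test_fun_endpoints[OF \<phi>[of n]]
      by (intro integral_by_parts_LOm Cn_DERIV[OF test_fun_Cn[OF \<phi>]] continuous_on_deriv_test_fun \<phi>) auto
    then have "Lint_on Om (\<lambda>x. u x * poly (pderiv (pderiv y)) x) = - Lint_on Om (\<lambda>x. g x * poly (pderiv y) x)"
      using LIMSEQ_unique[OF strong_weak[OF \<phi>L(1) u lim1, of "pderiv (pderiv y)"]]
        tendsto_minus[OF strong_weak[OF \<phi>L(2) g lim2, of "pderiv y"]] by simp
    also have "\<dots> = - Lint_on Om (\<lambda>x. f x * poly y x)"
      using weak_form_poly[OF g f weak y(2,3)] by simp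
    finally have u_eq: "Lint_on Om (\<lambda>x. u x * poly q x) = Lint_on Om (\<lambda>x. f x * poly y x)"
      by (simp add: y(1))
    have "Lint_on Om (\<lambda>x. poly z x * poly (pderiv (pderiv y)) x) = - Lint_on Om (\<lambda>x. poly (pderiv z) x * poly (pderiv y) x)"
      using z by (intro integral_by_parts_LOm poly_DERIV continuous_intros) auto
    also have "Lint_on Om (\<lambda>x. poly (pderiv z) x * poly (pderiv y) x) = - Lint_on Om (\<lambda>x. poly (pderiv (pderiv z)) x * poly y x)"
      using y by (intro integral_by_parts_LOm poly_DERIV continuous_intros) auto
    finally have z_eq: "Lint_on Om (\<lambda>x. poly z x * poly q x) = - Lint_on Om (\<lambda>x. poly (pderiv (pderiv z)) x * poly y x)"
      by (simp add: y(1))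
    have "Lint_on Om (\<lambda>x. ?v x * poly q x) = Lint_on Om (\<lambda>x. u x * poly q x) - Lint_on Om (\<lambda>x. poly z x * poly q x)"
      using L2_mult_integrable[OF u L2_poly] L2_mult_integrable[OF L2_poly L2_poly] by (simp add: left_diff_distrib)
    also have "\<dots> = Lint_on Om (\<lambda>x. ?F x * poly y x)"
      using L2_mult_integrable[OF f L2_poly] L2_mult_integrable[OF L2_poly L2_poly]
      by (simp add: distrib_right u_eq z_eq)
    also have "\<dots> \<le> L2_norm ?F * L2_norm (poly y)"
      using L2_Cauchy_Schwarz[OF F L2_poly, of y] by linarith
    also have "\<dots> \<le> L2_norm ?F * (4 * L2_norm (poly q))"
    proof (intro mult_left_mono L2_norm_nonneg)
      have "L2_norm (poly (- q)) = L2_norm (poly q)" by (simp add: L2_norm_def)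
      then show "L2_norm (poly y) \<le> 4 * L2_norm (poly q)"
        using poly_Dirichlet_estimate[OF y(2,3)] by (simp add: y(1))
    qed
    finally show ?thesis by simp
  qed
  have "(L2_norm ?v)\<^sup>2 \<le> 4 * L2_norm ?F * L2_norm ?v"
  proof (rule field_le_epsilon)
    fix e :: real assume e: "e > 0"
    \<comment> \<open>The test polynomial q only approximates u - z, and e' times the bracket
      collects the resulting errors; this choice makes that product e. The summand 1 keeps the
      denominator positive.\<close>
    define e' where "e' = e / (L2_norm ?v + 4 * L2_norm ?F + 1)"
    have den: "L2_norm ?v + 4 * L2_norm ?F + 1 > 0"
      using L2_norm_nonneg[of ?v] L2_norm_nonneg[of ?F] by linarith
    then have e': "e' > 0" using e by (simp add: e'_def)
    obtain q where q: "L2_norm (\<lambda>x. ?v x - poly q x) < e'"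
      using exists_poly_L2_approx[OF v e'] by blast
    have "L2_norm (\<lambda>x. - 1 * (?v x - poly q x) + ?v x) \<le> L2_norm (\<lambda>x. - 1 * (?v x - poly q x)) + L2_norm ?v"
      by (intro L2_norm_triangle L2_cmult L2_diff v L2_poly)
    moreover have "L2_norm (\<lambda>x. - 1 * (?v x - poly q x)) = L2_norm (\<lambda>x. ?v x - poly q x)"
      by (simp add: L2_norm_def power2_commute)
    ultimately have qn: "L2_norm (poly q) \<le> e' + L2_norm ?v" using q by simp
    have "(L2_norm ?v)\<^sup>2 = Lint_on Om (\<lambda>x. ?v x * (?v x - poly q x) + ?v x * poly q x)"
      unfolding L2_norm_power2 by (simp add: power2_eq_square algebra_simps)
    also have "\<dots> = Lint_on Om (\<lambda>x. ?v x * (?v x - poly q x)) + Lint_on Om (\<lambda>x. ?v x * poly q x)"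
      by (intro Bochner_Integration.integral_add L2_mult_integrable v L2_diff[OF v L2_poly] L2_poly)
    also have "\<dots> \<le> L2_norm ?v * e' + 4 * L2_norm ?F * (e' + L2_norm ?v)"
    proof (rule add_mono)
      have "Lint_on Om (\<lambda>x. ?v x * (?v x - poly q x)) \<le> L2_norm ?v * L2_norm (\<lambda>x. ?v x - poly q x)"
        using L2_Cauchy_Schwarz[OF v L2_diff[OF v L2_poly[of q]]] by linarith
      also have "\<dots> \<le> L2_norm ?v * e'" using q by (intro mult_left_mono L2_norm_nonneg) auto
      finally show "Lint_on Om (\<lambda>x. ?v x * (?v x - poly q x)) \<le> L2_norm ?v * e'" .
      show "Lint_on Om (\<lambda>x. ?v x * poly q x) \<le> 4 * L2_norm ?F * (e' + L2_norm ?v)"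
        using dual[of q] mult_left_mono[OF qn, of "4 * L2_norm ?F"] L2_norm_nonneg[of ?F] by linarith
    qed
    also have "\<dots> = 4 * L2_norm ?F * L2_norm ?v + e' * (L2_norm ?v + 4 * L2_norm ?F)"
      by (simp add: algebra_simps)
    also have "\<dots> \<le> 4 * L2_norm ?F * L2_norm ?v + e' * (L2_norm ?v + 4 * L2_norm ?F + 1)"
      using e' by (simp add: algebra_simps)
    also have "e' * (L2_norm ?v + 4 * L2_norm ?F + 1) = e"
      using den by (simp add: e'_def)
    finally show "(L2_norm ?v)\<^sup>2 \<le> 4 * L2_norm ?F * L2_norm ?v + e" by simp
  qed
  then show "L2_norm ?v \<le> 4 * L2_norm ?F"
    using L2_norm_nonneg[of ?v] L2_norm_nonneg[of ?F]
    by (cases "L2_norm ?v = 0") (auto simp: power2_eq_square mult_le_cancel_right)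
qed

subsection \<open>Quadratic forms on the unit square\<close>

abbreviation LL :: "(real \<times> real) measure" where "LL \<equiv> lborel \<Otimes>\<^sub>M lborel"

lemma integrable_product:
  fixes f g :: "real \<Rightarrow> real"
  assumes f: "integrable lborel f" and g: "integrable lborel g"
  shows "integrable LL (\<lambda>p. f (fst p) * g (snd p))"
proof (rule lborel_pair.Fubini_integrable)
  have [measurable]: "f \<in> borel_measurable borel" "g \<in> borel_measurable borel"
    using f g by auto
  show "(\<lambda>p. f (fst p) * g (snd p)) \<in> borel_measurable LL" by measurable
  show "integrable lborel (\<lambda>x. LINT y|lborel. norm (f (fst (x, y)) * g (snd (x, y))))"
    using f g by (simp add: abs_mult)
  show "AE x in lborel. integrable lborel (\<lambda>y. f (fst (x, y)) * g (snd (x, y)))"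
    using g by simp
qed

text \<open>One integrability criterion for all the double integrals below. The box [-1,2] x [-1,2]
  contains every pair of points at distance less than 1 of which at least one lies in the unit
  interval, the situation of functions extended by zero.\<close>

lemma integrable_dominated_by_squares:
  fixes v :: "real \<Rightarrow> real" and F :: "real \<times> real \<Rightarrow> real"
  assumes v: "integrable lborel (\<lambda>x. (v x)\<^sup>2)"
    and F [measurable]: "F \<in> borel_measurable LL"
    and bound: "\<And>x y. \<bar>F (x, y)\<bar> \<le> c * (indicator {-1..2} x * indicator {-1..2} y * ((v x)\<^sup>2 + (v y)\<^sup>2))"
  shows "integrable LL F"
proof (rule Bochner_Integration.integrable_bound)
  let ?i = "indicator {-1..2} :: real \<Rightarrow> real"
  have i: "integrable lborel ?i" by simp
  have iv: "integrable lborel (\<lambda>x. ?i x * (v x)\<^sup>2)"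
    using integrable_mult_indicator[OF _ v, of "{-1..2}"] by simp
  show "integrable LL (\<lambda>p. c * (?i (fst p) * (v (fst p))\<^sup>2 * ?i (snd p) + ?i (fst p) * (?i (snd p) * (v (snd p))\<^sup>2)))"
    by (intro integrable_mult_right Bochner_Integration.integrable_add integrable_product[OF iv i] integrable_product[OF i iv])
  show "AE p in LL. norm (F p) \<le> norm (c * (?i (fst p) * (v (fst p))\<^sup>2 * ?i (snd p) + ?i (fst p) * (?i (snd p) * (v (snd p))\<^sup>2)))"
  proof (rule AE_I2)
    fix p :: "real \<times> real"
    obtain x y where "p = (x, y)" by (cases p)
    then show "norm (F p) \<le> norm (c * (?i (fst p) * (v (fst p))\<^sup>2 * ?i (snd p) + ?i (fst p) * (?i (snd p) * (v (snd p))\<^sup>2)))"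
      using bound[of x y] by (simp add: algebra_simps)
  qed
qed measurable

lemma integral_prod_fst:
  fixes g :: "real \<Rightarrow> real" and k :: "real \<Rightarrow> real \<Rightarrow> real"
  assumes "integrable LL (\<lambda>p. k (fst p) (snd p) * g (fst p))"
  shows "(LINT p|LL. k (fst p) (snd p) * g (fst p)) = (LINT x|lborel. (LINT y|lborel. k x y) * g x)"
    and "integrable lborel (\<lambda>x. (LINT y|lborel. k x y) * g x)"
  using lborel_pair.integral_fst'[OF assms] lborel_pair.integrable_fst'[OF assms] by simp_all

lemma integral_prod_snd:
  fixes g :: "real \<Rightarrow> real" and k :: "real \<Rightarrow> real \<Rightarrow> real"
  assumes "integrable LL (\<lambda>p. k (fst p) (snd p) * g (snd p))"
  shows "(LINT p|LL. k (fst p) (snd p) * g (snd p)) = (LINT y|lborel. (LINT x|lborel. k x y) * g y)"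
    and "integrable lborel (\<lambda>y. (LINT x|lborel. k x y) * g y)"
proof -
  have 1: "integrable LL (\<lambda>p. k (snd p) (fst p) * g (fst p))"
    using lborel_pair.integrable_product_swap[OF assms] by (simp add: split_beta')
  have "(LINT p|LL. k (snd p) (fst p) * g (fst p)) = (LINT p|LL. k (fst p) (snd p) * g (snd p))"
    using lborel_pair.integral_product_swap[OF borel_measurable_integrable[OF assms]]
    by (simp add: split_beta')
  then show "(LINT p|LL. k (fst p) (snd p) * g (snd p)) = (LINT y|lborel. (LINT x|lborel. k x y) * g y)"
    using integral_prod_fst(1)[of "\<lambda>x y. k y x", OF 1] by simp
  show "integrable lborel (\<lambda>y. (LINT x|lborel. k x y) * g y)"
    using integral_prod_fst(2)[of "\<lambda>x y. k y x", OF 1] by simp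
qed

text \<open>Writing \<open>2 k v(x) v(y) \<le> \<bar>k\<bar> (v(x)\<^sup>2 + v(y)\<^sup>2)\<close> uses up one row sum and one column sum of \<open>\<bar>k\<bar>\<close>;
  on \<open>J\<close>, where the kernel is nonnegative, the defect in this inequality is kept.\<close>
lemma diagonally_dominant_coercive:
  fixes v a :: "real \<Rightarrow> real" and k :: "real \<Rightarrow> real \<Rightarrow> real"
  assumes v [measurable]: "v \<in> borel_measurable borel" and v2: "integrable lborel (\<lambda>x. (v x)\<^sup>2)"
    and v0: "\<And>x. x \<notin> Om \<Longrightarrow> v x = 0"
    and k [measurable]: "(\<lambda>p. k (fst p) (snd p)) \<in> borel_measurable LL"
    and k_bound: "\<And>x y. \<bar>k x y\<bar> \<le> M * (indicator Om x * indicator Om y)"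
    and a [measurable]: "a \<in> borel_measurable borel" and a_bound: "\<And>x. \<bar>a x\<bar> \<le> M'"
    and col: "\<And>x. x \<in> Om \<Longrightarrow> (LINT y|lborel. \<bar>k y x\<bar>) \<le> a x"
    and J [measurable]: "J \<in> sets borel" and kJ: "\<And>x y. x \<in> J \<Longrightarrow> k x y \<ge> 0"
  shows "(LINT x|lborel. (a x - (LINT y|lborel. \<bar>k x y\<bar>)) * (v x)\<^sup>2)
      + (LINT p|LL. indicator J (fst p) * k (fst p) (snd p) * (v (fst p) - v (snd p))\<^sup>2)
      \<le> 2 * (LINT x|lborel. v x * (a x * v x - (LINT y|lborel. k x y * v y)))" (is "?A + ?E \<le> 2 * ?Q")
proof -
  have M: "M \<ge> 0" using k_bound[of "1/2" "1/2"] by (simp add: Om_def)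
  have kb: "\<bar>k x y\<bar> * t \<le> M * (indicator {-1..2} x * indicator {-1..2} y * t)" if "t \<ge> 0" for x y t
  proof -
    have "\<bar>k x y\<bar> \<le> M * (indicator {-1..2} x * indicator {-1..2} y)"
      by (rule order_trans[OF k_bound mult_left_mono]) (use M in \<open>auto simp: Om_def indicator_def\<close>)
    from mult_right_mono[OF this that] show ?thesis by (simp add: mult_ac)
  qed
  have two: "2 * \<bar>s * t\<bar> \<le> s\<^sup>2 + t\<^sup>2" for s t :: real
    using sum_squares_bound[of "\<bar>s\<bar>" "\<bar>t\<bar>"] by (simp add: abs_mult)
  have i1: "integrable LL (\<lambda>p. \<bar>k (fst p) (snd p)\<bar> * (v (fst p))\<^sup>2)"
  proof (rule integrable_dominated_by_squares[OF v2, where c = M])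
    show "\<bar>\<bar>k (fst (x, y)) (snd (x, y))\<bar> * (v (fst (x, y)))\<^sup>2\<bar> \<le> M * (indicator {-1..2} x * indicator {-1..2} y * ((v x)\<^sup>2 + (v y)\<^sup>2))" for x y
      using kb[of "(v x)\<^sup>2 + (v y)\<^sup>2" x y] mult_left_mono[of "(v x)\<^sup>2" "(v x)\<^sup>2 + (v y)\<^sup>2" "\<bar>k x y\<bar>"] by (simp add: abs_mult)
  qed measurable
  have i2: "integrable LL (\<lambda>p. \<bar>k (fst p) (snd p)\<bar> * (v (snd p))\<^sup>2)"
  proof (rule integrable_dominated_by_squares[OF v2, where c = M])
    show "\<bar>\<bar>k (fst (x, y)) (snd (x, y))\<bar> * (v (snd (x, y)))\<^sup>2\<bar> \<le> M * (indicator {-1..2} x * indicator {-1..2} y * ((v x)\<^sup>2 + (v y)\<^sup>2))" for x y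
      using kb[of "(v x)\<^sup>2 + (v y)\<^sup>2" x y] mult_left_mono[of "(v y)\<^sup>2" "(v x)\<^sup>2 + (v y)\<^sup>2" "\<bar>k x y\<bar>"] by (simp add: abs_mult)
  qed measurable
  have i3: "integrable LL (\<lambda>p. k (fst p) (snd p) * v (snd p) * v (fst p))"
  proof (rule integrable_dominated_by_squares[OF v2, where c = M])
    show "\<bar>k (fst (x, y)) (snd (x, y)) * v (snd (x, y)) * v (fst (x, y))\<bar> \<le> M * (indicator {-1..2} x * indicator {-1..2} y * ((v x)\<^sup>2 + (v y)\<^sup>2))" for x y
    proof -
      have "\<bar>k x y * v y * v x\<bar> = \<bar>k x y\<bar> * \<bar>v x * v y\<bar>" by (simp add: abs_mult mult_ac)
      also have "\<dots> \<le> \<bar>k x y\<bar> * ((v x)\<^sup>2 + (v y)\<^sup>2)"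
        using two[of "v x" "v y"] by (intro mult_left_mono) linarith+
      finally show ?thesis using kb[of "(v x)\<^sup>2 + (v y)\<^sup>2" x y] by simp
    qed
  qed measurable
  have iE: "integrable LL (\<lambda>p. indicator J (fst p) * k (fst p) (snd p) * (v (fst p) - v (snd p))\<^sup>2)"
  proof (rule integrable_dominated_by_squares[OF v2, where c = "M * 2"])
    show "\<bar>indicator J (fst (x, y)) * k (fst (x, y)) (snd (x, y)) * (v (fst (x, y)) - v (snd (x, y)))\<^sup>2\<bar>
        \<le> M * 2 * (indicator {-1..2} x * indicator {-1..2} y * ((v x)\<^sup>2 + (v y)\<^sup>2))" for x y
    proof -
      have d: "(v x - v y)\<^sup>2 \<le> 2 * ((v x)\<^sup>2 + (v y)\<^sup>2)"
        using sum_squares_bound[of "v x" "- v y"] by (simp add: power2_diff)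
      have "\<bar>indicator J x * k x y * (v x - v y)\<^sup>2\<bar> \<le> \<bar>k x y\<bar> * (2 * ((v x)\<^sup>2 + (v y)\<^sup>2))"
        using d by (auto simp: abs_mult indicator_def intro!: mult_left_mono)
      then show ?thesis using kb[of "2 * ((v x)\<^sup>2 + (v y)\<^sup>2)" x y] by (simp add: algebra_simps)
    qed
  qed measurable
  have ia: "integrable lborel (\<lambda>x. a x * (v x)\<^sup>2)"
  proof (rule Bochner_Integration.integrable_bound)
    show "integrable lborel (\<lambda>x. M' * (v x)\<^sup>2)" using v2 by simp
    have "M' \<ge> 0" using a_bound[of 0] by linarith
    then show "AE x in lborel. norm (a x * (v x)\<^sup>2) \<le> norm (M' * (v x)\<^sup>2)"
      using a_bound by (intro AE_I2) (auto simp: abs_mult intro!: mult_right_mono)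
  qed measurable
  \<comment> \<open>T1 and T2 carry the row and column sums of |k|, T3 the off-diagonal form, S the
    diagonal. The pieces ?A = S - T1, ?Q = S - T3, ?E \<le> T1 + T2 - 2 T3 and T2 \<le> S add up to
    the claim.\<close>
  define T1 T2 T3 S where "T1 = (LINT x|lborel. (LINT y|lborel. \<bar>k x y\<bar>) * (v x)\<^sup>2)"
    and "T2 = (LINT x|lborel. (LINT y|lborel. \<bar>k y x\<bar>) * (v x)\<^sup>2)"
    and "T3 = (LINT x|lborel. (LINT y|lborel. k x y * v y) * v x)"
    and "S = (LINT x|lborel. a x * (v x)\<^sup>2)"
  have "?E \<le> (LINT p|LL. \<bar>k (fst p) (snd p)\<bar> * (v (fst p))\<^sup>2 + \<bar>k (fst p) (snd p)\<bar> * (v (snd p))\<^sup>2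
      - 2 * (k (fst p) (snd p) * v (snd p) * v (fst p)))"
  proof (rule integral_mono[OF iE])
    show "integrable LL (\<lambda>p. \<bar>k (fst p) (snd p)\<bar> * (v (fst p))\<^sup>2 + \<bar>k (fst p) (snd p)\<bar> * (v (snd p))\<^sup>2
      - 2 * (k (fst p) (snd p) * v (snd p) * v (fst p)))"
      using i1 i2 i3 by simp
    fix p :: "real \<times> real"
    obtain x y where p: "p = (x, y)" by (cases p)
    have "indicator J x * k x y * (v x - v y)\<^sup>2 \<le> \<bar>k x y\<bar> * (v x)\<^sup>2 + \<bar>k x y\<bar> * (v y)\<^sup>2 - 2 * (k x y * v y * v x)"
    proof (cases "x \<in> J")
      case True
      then show ?thesis using kJ[OF True, of y] by (simp add: power2_diff algebra_simps)
    next
      case False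
      have "2 * (k x y * v y * v x) \<le> \<bar>k x y\<bar> * (2 * \<bar>v x * v y\<bar>)"
        by (rule order_trans[OF abs_ge_self]) (simp add: abs_mult mult_ac)
      also have "\<dots> \<le> \<bar>k x y\<bar> * ((v x)\<^sup>2 + (v y)\<^sup>2)" by (intro mult_left_mono two) auto
      finally show ?thesis using False by (simp add: algebra_simps)
    qed
    then show "indicator J (fst p) * k (fst p) (snd p) * (v (fst p) - v (snd p))\<^sup>2 \<le>
      \<bar>k (fst p) (snd p)\<bar> * (v (fst p))\<^sup>2 + \<bar>k (fst p) (snd p)\<bar> * (v (snd p))\<^sup>2
      - 2 * (k (fst p) (snd p) * v (snd p) * v (fst p))"
      by (simp add: p)
  qed
  also have "\<dots> = T1 + T2 - 2 * T3"
    using i1 i2 i3 integral_prod_fst(1)[OF i1] integral_prod_snd(1)[OF i2] integral_prod_fst(1)[of "\<lambda>x y. k x y * v y", OF i3]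
    by (simp add: T1_def T2_def T3_def)
  finally have 1: "?E \<le> T1 + T2 - 2 * T3" .
  have 2: "T2 \<le> S"
    unfolding T2_def S_def
  proof (rule integral_mono[OF integral_prod_snd(2)[OF i2] ia])
    show "(LINT y|lborel. \<bar>k y x\<bar>) * (v x)\<^sup>2 \<le> a x * (v x)\<^sup>2" for x
      using col[of x] v0[of x] by (cases "x \<in> Om") (auto intro: mult_right_mono)
  qed
  have 3: "?A = S - T1"
    using ia integral_prod_fst(2)[OF i1] by (simp add: S_def T1_def left_diff_distrib)
  have "?Q = (LINT x|lborel. a x * (v x)\<^sup>2 - (LINT y|lborel. k x y * v y) * v x)"
    by (intro Bochner_Integration.integral_cong) (simp_all add: algebra_simps power2_eq_square)
  also have "\<dots> = S - T3"
    using ia integral_prod_fst(2)[of "\<lambda>x y. k x y * v y", OF i3] by (simp add: S_def T3_def)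
  finally show ?thesis using 1 2 3 by simp
qed

text \<open>Integrating \<open>x (q(y)\<^sup>2 - q(x)\<^sup>2)\<close> over the strip \<open>0 < y - x < r\<close> gives \<open>- r\<^sup>2/2 \<integral> q\<^sup>2\<close>; factor the
  difference of squares and apply the Cauchy-Schwarz inequality.\<close>
lemma nonlocal_Poincare:
  fixes q :: "real \<Rightarrow> real"
  assumes q [measurable]: "q \<in> borel_measurable borel" and q2: "integrable lborel (\<lambda>x. (q x)\<^sup>2)"
    and q0: "\<And>x. x \<notin> Om \<Longrightarrow> q x = 0" and r: "0 < r" "r < 1"
  shows "r ^ 3 * (LINT x|lborel. (q x)\<^sup>2)
    \<le> 16 * (LINT p|LL. indicator {0<..<r} (snd p - fst p) * (q (snd p) - q (fst p))\<^sup>2)"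
proof -
  define i :: "real \<Rightarrow> real \<Rightarrow> real" where "i x y = indicator {0<..<r} (y - x)" for x y
  define N where "N = (LINT x|lborel. (q x)\<^sup>2)"
  have [measurable]: "(\<lambda>p. i (fst p) (snd p)) \<in> borel_measurable LL"
    unfolding i_def by measurable
  have bnd: "i x y * t \<le> indicator {-1..2} x * indicator {-1..2} y * t"
    if "t \<ge> 0" "x \<notin> Om \<Longrightarrow> y \<notin> Om \<Longrightarrow> t = 0" for x y t
    using that r by (auto simp: i_def indicator_def Om_def)
  have i01: "0 \<le> i x y" "i x y \<le> 1" "i x y = 0 \<or> i x y = 1" for x y
    by (auto simp: i_def indicator_def)
  have two: "2 * \<bar>s * t\<bar> \<le> s\<^sup>2 + t\<^sup>2" for s t :: real
    using sum_squares_bound[of "\<bar>s\<bar>" "\<bar>t\<bar>"] by (simp add: abs_mult)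
  have int: "integrable LL (\<lambda>p. i (fst p) (snd p) * F (fst p) (snd p))"
    if [measurable]: "(\<lambda>p. F (fst p) (snd p)) \<in> borel_measurable LL"
      and F: "\<And>x y. \<bar>F x y\<bar> \<le> (\<bar>x\<bar> + \<bar>y\<bar> + 1)^2 * (2 * ((q x)\<^sup>2 + (q y)\<^sup>2))" for F
  proof (rule integrable_dominated_by_squares[OF q2, where c = 50])
    fix x y
    have "\<bar>i x y * F x y\<bar> = i x y * \<bar>F x y\<bar>" using i01 by (simp add: abs_mult)
    also have "\<dots> \<le> i x y * ((\<bar>x\<bar> + \<bar>y\<bar> + 1)^2 * (2 * ((q x)\<^sup>2 + (q y)\<^sup>2)))"
      using F i01 by (intro mult_left_mono) auto
    also have "\<dots> \<le> indicator {-1..2} x * indicator {-1..2} y * ((\<bar>x\<bar> + \<bar>y\<bar> + 1)^2 * (2 * ((q x)\<^sup>2 + (q y)\<^sup>2)))"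
      by (rule bnd) (use q0 in auto)
    also have "\<dots> \<le> indicator {-1..2} x * indicator {-1..2} y * (5^2 * (2 * ((q x)\<^sup>2 + (q y)\<^sup>2)))"
    proof (cases "x \<in> {-1..2} \<and> y \<in> {-1..2}")
      case True
      then have "(\<bar>x\<bar> + \<bar>y\<bar> + 1)^2 \<le> 5^2" by (intro power_mono) auto
      then show ?thesis by (intro mult_left_mono mult_right_mono) auto
    qed (auto simp: indicator_def)
    finally show "\<bar>i (fst (x, y)) (snd (x, y)) * F (fst (x, y)) (snd (x, y))\<bar> \<le> 50 * (indicator {-1..2} x * indicator {-1..2} y * ((q x)\<^sup>2 + (q y)\<^sup>2))"
      by (simp add: algebra_simps)
  qed measurable
  have sq1: "1 \<le> (\<bar>x\<bar> + \<bar>y\<bar> + 1)^2" "\<bar>x\<bar> \<le> (\<bar>x\<bar> + \<bar>y\<bar> + 1)^2" "x\<^sup>2 \<le> (\<bar>x\<bar> + \<bar>y\<bar> + 1)^2" for x y :: real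
    by (auto simp: power2_eq_square algebra_simps intro: add_nonneg_nonneg)
  have sq2: "s * t \<le> (\<bar>x\<bar> + \<bar>y\<bar> + 1)^2 * (2 * ((q x)\<^sup>2 + (q y)\<^sup>2))"
    if "0 \<le> s" "s \<le> (\<bar>x\<bar> + \<bar>y\<bar> + 1)^2" "0 \<le> t" "t \<le> 2 * ((q x)\<^sup>2 + (q y)\<^sup>2)" for s t x y
    using that by (intro mult_mono') auto
  have diff2: "(q y - q x)\<^sup>2 \<le> 2 * ((q x)\<^sup>2 + (q y)\<^sup>2)" "(q y + q x)\<^sup>2 \<le> 2 * ((q x)\<^sup>2 + (q y)\<^sup>2)" for x y
    using two[of "q x" "q y"] by (auto simp: power2_diff power2_sum abs_le_iff mult_ac)
  have j1: "integrable LL (\<lambda>p. i (fst p) (snd p) * (fst p * (q (snd p))\<^sup>2))"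
  proof (rule int[of "\<lambda>x y. x * (q y)\<^sup>2"])
    show "\<bar>x * (q y)\<^sup>2\<bar> \<le> (\<bar>x\<bar> + \<bar>y\<bar> + 1)\<^sup>2 * (2 * ((q x)\<^sup>2 + (q y)\<^sup>2))" for x y
      using sq2[of "\<bar>x\<bar>" x y "(q y)\<^sup>2"] sq1[where x=x and y=y] by (simp add: abs_mult)
  qed measurable
  have j2: "integrable LL (\<lambda>p. i (fst p) (snd p) * (fst p * (q (fst p))\<^sup>2))"
  proof (rule int[of "\<lambda>x y. x * (q x)\<^sup>2"])
    show "\<bar>x * (q x)\<^sup>2\<bar> \<le> (\<bar>x\<bar> + \<bar>y\<bar> + 1)\<^sup>2 * (2 * ((q x)\<^sup>2 + (q y)\<^sup>2))" for x y
      using sq2[of "\<bar>x\<bar>" x y "(q x)\<^sup>2"] sq1[where x=x and y=y] by (simp add: abs_mult)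
  qed measurable
  have j3: "integrable LL (\<lambda>p. i (fst p) (snd p) * (q (snd p) - q (fst p))\<^sup>2)"
  proof (rule int[of "\<lambda>x y. (q y - q x)\<^sup>2"])
    show "\<bar>(q y - q x)\<^sup>2\<bar> \<le> (\<bar>x\<bar> + \<bar>y\<bar> + 1)\<^sup>2 * (2 * ((q x)\<^sup>2 + (q y)\<^sup>2))" for x y
      using sq2[of 1 x y "(q y - q x)\<^sup>2"] sq1[where x=x and y=y] diff2(1)[where x=x and y=y] by (simp add: abs_mult)
  qed measurable
  have j4: "integrable LL (\<lambda>p. i (fst p) (snd p) * ((fst p)\<^sup>2 * (q (snd p) + q (fst p))\<^sup>2))"
  proof (rule int[of "\<lambda>x y. x\<^sup>2 * (q y + q x)\<^sup>2"])
    show "\<bar>x\<^sup>2 * (q y + q x)\<^sup>2\<bar> \<le> (\<bar>x\<bar> + \<bar>y\<bar> + 1)\<^sup>2 * (2 * ((q x)\<^sup>2 + (q y)\<^sup>2))" for x y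
      using sq2[of "x\<^sup>2" x y "(q y + q x)\<^sup>2"] sq1[where x=x and y=y] diff2(2)[where x=x and y=y] by (simp add: abs_mult)
  qed measurable
  have j5: "integrable LL (\<lambda>p. i (fst p) (snd p) * (q (snd p))\<^sup>2)"
  proof (rule int[of "\<lambda>x y. (q y)\<^sup>2"])
    show "\<bar>(q y)\<^sup>2\<bar> \<le> (\<bar>x\<bar> + \<bar>y\<bar> + 1)\<^sup>2 * (2 * ((q x)\<^sup>2 + (q y)\<^sup>2))" for x y
      using sq2[of 1 x y "(q y)\<^sup>2"] sq1[where x=x and y=y] by (simp add: abs_mult)
  qed measurable
  have j6: "integrable LL (\<lambda>p. i (fst p) (snd p) * (q (fst p))\<^sup>2)"
  proof (rule int[of "\<lambda>x y. (q x)\<^sup>2"])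
    show "\<bar>(q x)\<^sup>2\<bar> \<le> (\<bar>x\<bar> + \<bar>y\<bar> + 1)\<^sup>2 * (2 * ((q x)\<^sup>2 + (q y)\<^sup>2))" for x y
      using sq2[of 1 x y "(q x)\<^sup>2"] sq1[where x=x and y=y] by (simp add: abs_mult)
  qed measurable
  have I1: "(LINT y|lborel. i x y) = r" for x
  proof -
    have "i x = indicator {x<..<x + r}" by (auto simp: i_def indicator_def fun_eq_iff)
    then show ?thesis using r by simp
  qed
  have I2: "(LINT x|lborel. i x y) = r" for y
  proof -
    have "(\<lambda>x. i x y) = indicator {y - r<..<y}" by (auto simp: i_def indicator_def fun_eq_iff)
    then show ?thesis using r by simp
  qed
  \<comment> \<open>The mean of x over (y - r, y) lies r/2 to the left of y; the resulting -r^2/2 is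
    the only term that survives when the two weighted integrals are subtracted.\<close>
  have I3: "(LINT x|lborel. i x y * x) = r * y - r\<^sup>2 / 2" for y
  proof -
    have "(LINT x|lborel. i x y * x) = (LINT x|lborel. x * indicator {y - r..y} x)"
    proof (rule integral_cong_AE)
      have "AE x in lborel. x \<noteq> y" "AE x in lborel. x \<noteq> y - r"
        by (rule AE_lborel_singleton)+
      then show "AE x in lborel. i x y * x = x * indicator {y - r..y} x"
        by eventually_elim (auto simp: i_def indicator_def)
    qed (auto simp: i_def)
    also have "\<dots> = y\<^sup>2 / 2 - (y - r)\<^sup>2 / 2"
      using r by (intro integral_FTC_Icc_real[where F = "\<lambda>x. x\<^sup>2 / 2"]) (auto intro!: derivative_eq_intros)
    finally show ?thesis by (simp add: power2_diff field_simps)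
  qed
  have A: "(LINT p|LL. i (fst p) (snd p) * (fst p * (q (snd p))\<^sup>2)) = r * (LINT x|lborel. x * (q x)\<^sup>2) - r\<^sup>2 / 2 * N"
  proof -
    have xq: "integrable lborel (\<lambda>x. x * (q x)\<^sup>2)"
    proof (rule Bochner_Integration.integrable_bound[OF q2])
      have "norm (x * (q x)\<^sup>2) \<le> norm ((q x)\<^sup>2)" for x
        using q0[of x] by (cases "x \<in> Om") (auto simp: Om_def abs_mult intro!: mult_left_le_one_le)
      then show "AE x in lborel. norm (x * (q x)\<^sup>2) \<le> norm ((q x)\<^sup>2)" by simp
    qed measurable
    have "(LINT p|LL. i (fst p) (snd p) * (fst p * (q (snd p))\<^sup>2)) = (LINT y|lborel. (r * y - r\<^sup>2 / 2) * (q y)\<^sup>2)"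
      using integral_prod_snd(1)[of "\<lambda>x y. i x y * x" "\<lambda>y. (q y)\<^sup>2"] j1 by (simp add: mult_ac I3[unfolded mult.commute[of "i _ _"]])
    also have "\<dots> = (LINT y|lborel. r * (y * (q y)\<^sup>2) - r\<^sup>2 / 2 * (q y)\<^sup>2)"
      by (intro Bochner_Integration.integral_cong) (auto simp: algebra_simps)
    also have "\<dots> = r * (LINT x|lborel. x * (q x)\<^sup>2) - r\<^sup>2 / 2 * N"
      using xq q2 by (simp add: N_def)
    finally show ?thesis .
  qed
  have B: "(LINT p|LL. i (fst p) (snd p) * (fst p * (q (fst p))\<^sup>2)) = r * (LINT x|lborel. x * (q x)\<^sup>2)"
    using integral_prod_fst(1)[of i "\<lambda>x. x * (q x)\<^sup>2"] j2 by (simp add: I1)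
  define X where "X = (LINT p|LL. i (fst p) (snd p) * (q (snd p) - q (fst p))\<^sup>2)"
  \<comment> \<open>The indicator is idempotent, so it can be put into both factors of x (q(y)^2 -
    q(x)^2) = (q(y) - q(x)) (x (q(y) + q(x))).\<close>
  define f g where "f p = i (fst p) (snd p) * (q (snd p) - q (fst p))"
    and "g p = i (fst p) (snd p) * (fst p * (q (snd p) + q (fst p)))" for p :: "real \<times> real"
  have f2: "(f p)\<^sup>2 = i (fst p) (snd p) * (q (snd p) - q (fst p))\<^sup>2" for p
    using i01(3)[of "fst p" "snd p"] by (auto simp: f_def power_mult_distrib)
  have g2: "(g p)\<^sup>2 = i (fst p) (snd p) * ((fst p)\<^sup>2 * (q (snd p) + q (fst p))\<^sup>2)" for p
    using i01(3)[of "fst p" "snd p"] by (auto simp: g_def power_mult_distrib)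
  have fg: "f p * g p = i (fst p) (snd p) * (fst p * (q (snd p))\<^sup>2) - i (fst p) (snd p) * (fst p * (q (fst p))\<^sup>2)" for p
    using i01(3)[of "fst p" "snd p"] by (auto simp: f_def g_def power2_eq_square algebra_simps)
  have "(LINT p|LL. f p * g p) = - (r\<^sup>2 / 2 * N)"
    unfolding fg using j1 j2 A B by simp
  moreover have "(LINT p|LL. f p * g p)\<^sup>2 \<le> (LINT p|LL. (f p)\<^sup>2) * (LINT p|LL. (g p)\<^sup>2)"
    by (rule Cauchy_Schwarz_integral) (use j1 j2 j3 j4 in \<open>simp_all add: f2 g2 fg\<close>)
  \<comment> \<open>Where the integrand is nonzero, one of x, y lies in (0,1) and x < y < x + r with
    r < 1, so |x| \<le> 1. Then (q(x) + q(y))^2 \<le> 2 q(x)^2 + 2 q(y)^2, and each variable runs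
    over a section of length r.\<close>
  moreover have "(LINT p|LL. (g p)\<^sup>2) \<le> 4 * r * N"
  proof -
    have "(LINT p|LL. (g p)\<^sup>2) \<le> (LINT p|LL. 2 * (i (fst p) (snd p) * (q (snd p))\<^sup>2) + 2 * (i (fst p) (snd p) * (q (fst p))\<^sup>2))"
    proof (rule integral_mono)
      show "integrable LL (\<lambda>p. (g p)\<^sup>2)" using j4 by (simp add: g2)
      show "integrable LL (\<lambda>p. 2 * (i (fst p) (snd p) * (q (snd p))\<^sup>2) + 2 * (i (fst p) (snd p) * (q (fst p))\<^sup>2))"
        using j5 j6 by simp
      fix p :: "real \<times> real"
      obtain x y where p: "p = (x, y)" by (cases p)
      have "i x y * (x\<^sup>2 * (q y + q x)\<^sup>2) \<le> i x y * (1 * (2 * ((q x)\<^sup>2 + (q y)\<^sup>2)))"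
      proof (cases "i x y = 0 \<or> (x \<notin> Om \<and> y \<notin> Om)")
        case True
        then show ?thesis using q0[of x] q0[of y] by auto
      next
        case False
        then have "\<bar>x\<bar> \<le> 1" using r by (auto simp: i_def Om_def indicator_def split: if_splits)
        then have "x\<^sup>2 \<le> 1" by (simp add: abs_square_le_1)
        then show ?thesis using diff2 i01 by (intro mult_left_mono mult_mono) auto
      qed
      then show "(g p)\<^sup>2 \<le> 2 * (i (fst p) (snd p) * (q (snd p))\<^sup>2) + 2 * (i (fst p) (snd p) * (q (fst p))\<^sup>2)"
        by (simp add: g2 p algebra_simps)
    qed
    also have "\<dots> = 4 * r * N"
      using j5 j6 integral_prod_fst(1)[OF j6] integral_prod_snd(1)[OF j5] by (simp add: I1 I2 N_def)
    finally show ?thesis .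
  qed
  moreover have X: "(LINT p|LL. (f p)\<^sup>2) = X" by (simp add: f2 X_def)
  moreover have "X \<ge> 0" unfolding X_def using i01 by (intro integral_nonneg_AE AE_I2) auto
  ultimately have "(r\<^sup>2 / 2 * N)\<^sup>2 \<le> X * (4 * r * N)"
    by (smt (verit) mult_left_mono power2_minus)
  \<comment> \<open>Expanding the square gives r^4 N^2 / 4 \<le> 4 r N X; multiplying by 4 is the
    source of the constant 16.\<close>
  then have *: "(r * N) * (r ^ 3 * N) \<le> (r * N) * (16 * X)"
    by (simp add: power2_eq_square power3_eq_cube field_simps)
  have "N \<ge> 0" by (simp add: N_def)
  then have "r ^ 3 * N \<le> 16 * X"
  proof (cases "N = 0")
    case True
    then show ?thesis using \<open>X \<ge> 0\<close> by simp
  next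
    case False
    then have "r * N > 0" using \<open>N \<ge> 0\<close> r by simp
    then show ?thesis using * by (simp only: mult_le_cancel_left_pos)
  qed
  then show ?thesis by (simp add: N_def X_def i_def)
qed

subsection \<open>The rescaled kernel\<close>

lemma integrable_indicator_Icc: "integrable lborel (indicator {a..b} :: real \<Rightarrow> real)"
  by (rule integrable_real_indicator) (auto simp: emeasure_lborel_Icc_eq)

lemma integrable_bounded_support:
  fixes h :: "real \<Rightarrow> real"
  assumes [measurable]: "h \<in> borel_measurable borel" and "\<And>x. \<bar>h x\<bar> \<le> B * indicator {a..b} x"
  shows "integrable lborel h"
proof (rule Bochner_Integration.integrable_bound)
  show "integrable lborel (\<lambda>x. B * indicator {a..b} x :: real)"
    by (intro integrable_mult_right integrable_indicator_Icc)
  show "AE x in lborel. norm (h x) \<le> norm (B * indicator {a..b} x :: real)"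
    using assms(2) by (intro AE_I2) (auto intro: order_trans abs_ge_self)
qed measurable

text \<open>The values of \<open>w\<close> at negative arguments are unconstrained, so \<open>w\<close> itself need not be measurable.\<close>
definition W :: "(real \<Rightarrow> real) \<Rightarrow> real \<Rightarrow> real" where
  "W w z = (if \<bar>z\<bar> < 1 then w \<bar>z\<bar> else 0)"

locale nonlocal_kernel =
  fixes w :: "real \<Rightarrow> real" and d :: real
  assumes A1: "A1 w" and d: "0 < d" "d < 1/2"
begin

lemma W_abs: "w \<bar>z\<bar> = W w z"
  using A1 by (auto simp: A1_def W_def)

lemma W_borel [measurable]: "W w \<in> borel_measurable borel"
proof -
  have "continuous_on {z::real. \<bar>z\<bar> < 1} (\<lambda>z. w \<bar>z\<bar>)"
    by (rule continuous_on_compose2[of "{0..<1}" w]) (use A1 in \<open>auto simp: A1_def intro!: continuous_intros\<close>)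
  moreover have "{z::real. \<bar>z\<bar> < 1} \<in> sets borel" by measurable
  ultimately have "(\<lambda>z. if z \<in> {z. \<bar>z\<bar> < 1} then w \<bar>z\<bar> else 0) \<in> borel_measurable borel"
    by (intro borel_measurable_continuous_on_if) auto
  then show ?thesis by (simp add: W_def[abs_def])
qed

lemma W_bounds: "0 \<le> W w z" "W w z \<le> w 0"
  using A1 by (auto simp: A1_def W_def)

lemma w_pos: "0 < w (15/16)"
  using A1 by (auto simp: A1_def)

lemma w0_pos: "0 < w 0"
  using w_pos W_bounds(2)[of "15/16"] by (simp add: W_def)

text \<open>w is positive below 1 but may tend to 0 there, so a lower bound by monotonicity takes a
  fixed radius less than 1. The value 15/16 exceeds 3/4, the largest distance in units of d between
  points of the sets compared later, and leaves room for the interval [13/16, 15/16] used for the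
  moments.\<close>

lemma W_lower: "\<bar>z\<bar> \<le> 15/16 \<Longrightarrow> w (15/16) \<le> W w z"
  using A1 by (auto simp: A1_def W_def)

definition G :: "real \<Rightarrow> real" where "G z = W w (z / d) / d ^ 3"

lemma G_borel [measurable]: "G \<in> borel_measurable borel"
  unfolding G_def by measurable

lemma G_bounds: "0 \<le> G z" "G z \<le> w 0 / d ^ 3"
  using W_bounds[of "z / d"] d by (auto simp: G_def divide_right_mono)

lemma G_eq_0: "\<bar>z\<bar> \<ge> d \<Longrightarrow> G z = 0"
  using d by (simp add: G_def W_def)

lemma G_minus: "G (- z) = G z"
  by (simp add: G_def W_def)

lemma G_lower: "\<bar>z\<bar> \<le> 15/16 * d \<Longrightarrow> w (15/16) / d ^ 3 \<le> G z"
  using W_lower[of "z / d"] d by (auto simp: G_def field_simps intro!: divide_right_mono)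

lemma w_d_eq: "w_d w d x y = G (x - y)"
  using d W_abs[of "(x - y) / d"] by (simp add: w_d_def G_def)

text \<open>The first moment of the part of the kernel that reaches beyond an end point at distance
  t. Both integrals in \<open>b_d\<close> take this form once the distance from x is the variable,
  so the two ends share one analysis.\<close>

definition mom :: "real \<Rightarrow> real" where
  "mom t = (LINT s|lborel. (if t \<le> s \<and> s \<le> d then s * G s else 0))"

definition beta :: "real \<Rightarrow> real" where
  "beta t = (if 0 < t \<and> t < d then 2 / (t + d)\<^sup>2 * mom t else 0)"

lemma mom_borel [measurable]: "mom \<in> borel_measurable borel"
  unfolding mom_def by measurable

lemma beta_borel [measurable]: "beta \<in> borel_measurable borel"
  unfolding beta_def by measurable

lemma mom_integrable:
  assumes "0 \<le> t"
  shows "integrable lborel (\<lambda>s. if t \<le> s \<and> s \<le> d then s * G s else 0)"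
proof (rule integrable_bounded_support[where B = "d * (w 0 / d ^ 3)" and a = 0 and b = d])
  show "\<bar>if t \<le> s \<and> s \<le> d then s * G s else 0\<bar> \<le> d * (w 0 / d ^ 3) * indicator {0..d} s" for s
    using G_bounds[of s] assms d w0_pos mult_mono[of s d "G s" "w 0 / d ^ 3"] by (auto simp: abs_mult indicator_def)
qed measurable

lemma mom_le:
  assumes "0 \<le> t"
  shows "mom t \<le> w 0 / d"
proof -
  have "mom t \<le> (LINT s|lborel. d * (w 0 / d ^ 3) * indicator {0..d} s)"
    unfolding mom_def
  proof (rule integral_mono[OF mom_integrable[OF assms]])
    show "(if t \<le> s \<and> s \<le> d then s * G s else 0) \<le> d * (w 0 / d ^ 3) * indicator {0..d} s" for s
      using G_bounds[of s] assms d w0_pos mult_mono[of s d "G s" "w 0 / d ^ 3"] by (auto simp: indicator_def)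
  qed (intro integrable_mult_right integrable_indicator_Icc)
  also have "\<dots> = w 0 / d" using d by (simp add: power3_eq_cube)
  finally show ?thesis .
qed

lemma mom_nonneg: "0 \<le> t \<Longrightarrow> 0 \<le> mom t"
  unfolding mom_def using G_bounds by (intro integral_nonneg_AE AE_I2) auto

lemma mom_ge:
  assumes "0 \<le> t" "t \<le> 3/4 * d"
  shows "w (15/16) / (10 * d) \<le> mom t"
proof -
  \<comment> \<open>On [13/16 d, 15/16 d], which lies to the right of t \<le> 3/4 d and has length
    d/8, the integrand is at least 13/16 d times w(15/16) / d^3. The product 13/128 slightly exceeds
    1/10.\<close>
  have "w (15/16) / (10 * d) \<le> 13/128 * (w (15/16) / d)"
    using w_pos d by (simp add: field_simps)
  also have "\<dots> = (LINT s|lborel. 13/16 * d * (w (15/16) / d ^ 3) * indicator {13/16 * d..15/16 * d} s)"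
    using d by (simp add: power3_eq_cube)
  also have "\<dots> \<le> mom t"
    unfolding mom_def
  proof (rule integral_mono[OF _ mom_integrable[OF assms(1)]])
    show "13/16 * d * (w (15/16) / d ^ 3) * indicator {13/16 * d..15/16 * d} s \<le> (if t \<le> s \<and> s \<le> d then s * G s else 0)" for s
    proof (cases "s \<in> {13/16 * d..15/16 * d}")
      case True
      then have "13/16 * d * (w (15/16) / d ^ 3) \<le> s * G s"
        using G_lower[of s] d w_pos by (intro mult_mono) auto
      then show ?thesis using True assms d by auto
    next
      case False
      then show ?thesis using assms G_bounds[of s] by auto
    qed
  qed (intro integrable_mult_right integrable_indicator_Icc)
  finally show ?thesis .
qed

lemma beta_bounds: "0 \<le> beta t" "beta t \<le> 2 * w 0 / d ^ 3"
proof -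
  show "0 \<le> beta t" by (auto simp: beta_def mom_nonneg)
  show "beta t \<le> 2 * w 0 / d ^ 3"
  proof (cases "0 < t \<and> t < d")
    case True
    have "2 / (t + d)\<^sup>2 * mom t \<le> 2 / d\<^sup>2 * (w 0 / d)"
      using True d mom_le[of t] mom_nonneg[of t] by (intro mult_mono divide_left_mono power_mono) auto
    then show ?thesis using True by (simp add: beta_def power3_eq_cube power2_eq_square)
  next
    case False
    then show ?thesis using w0_pos d by (auto simp: beta_def)
  qed
qed

lemma beta_ge:
  assumes "0 < t" "t \<le> 3/4 * d"
  shows "w (15/16) / (20 * d ^ 3) \<le> beta t"
proof -
  have "w (15/16) / (20 * d ^ 3) = 2 / (2 * d)\<^sup>2 * (w (15/16) / (10 * d))"
    by (simp add: power3_eq_cube power2_eq_square)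
  also have "\<dots> \<le> 2 / (t + d)\<^sup>2 * mom t"
    using assms d mom_ge[of t] w_pos by (intro mult_mono divide_left_mono power_mono) auto
  finally show ?thesis using assms d by (simp add: beta_def)
qed

text \<open>The substitutions s = x - y and s = y - x turn the integrals over the missing parts of
  the window into \<open>mom\<close>. Since d < 1/2 the two boundary layers are disjoint, so at most
  one summand is nonzero and a sum can replace the case distinction.\<close>

lemma b_d_eq: "b_d w d x = beta x + beta (1 - x)"
proof -
  have left: "Lint_on {x - d..0} (\<lambda>y. (x - y) * w_d w d x y) = mom x"
  proof -
    have "Lint_on {x - d..0} (\<lambda>y. (x - y) * w_d w d x y) = (LINT y|lborel. indicator {x - d..0} y * ((x - y) * G (x - y)))"
      unfolding w_d_eq by (rule lebesgue_on_eq_lborel) measurable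
    also have "\<dots> = (LINT s|lborel. indicator {x - d..0} (x + (- 1) * s) * ((x - (x + (- 1) * s)) * G (x - (x + (- 1) * s))))"
      by (subst lborel_integral_real_affine[of "-1" _ x]) simp_all
    also have "\<dots> = mom x"
      unfolding mom_def by (intro Bochner_Integration.integral_cong) (auto simp: indicator_def)
    finally show ?thesis .
  qed
  have right: "Lint_on {1..x + d} (\<lambda>y. (y - x) * w_d w d x y) = mom (1 - x)"
  proof -
    have "Lint_on {1..x + d} (\<lambda>y. (y - x) * w_d w d x y) = (LINT y|lborel. indicator {1..x + d} y * ((y - x) * G (x - y)))"
      unfolding w_d_eq by (rule lebesgue_on_eq_lborel) measurable
    also have "\<dots> = (LINT s|lborel. indicator {1..x + d} (x + 1 * s) * ((x + 1 * s - x) * G (x - (x + 1 * s))))"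
      by (subst lborel_integral_real_affine[of 1 _ x]) simp_all
    also have "\<dots> = mom (1 - x)"
      unfolding mom_def by (intro Bochner_Integration.integral_cong) (auto simp: indicator_def G_minus)
    finally show ?thesis .
  qed
  show ?thesis
    unfolding b_d_def left right beta_def using d by auto
qed

lemma b_d_borel [measurable]: "b_d w d \<in> borel_measurable borel"
  unfolding b_d_eq[abs_def] by measurable

lemma b_d_bounds: "0 \<le> b_d w d x" "b_d w d x \<le> 4 * w 0 / d ^ 3"
  using beta_bounds[of x] beta_bounds[of "1 - x"] by (auto simp: b_d_eq)

lemma K_d_eq: "K_d w d x y = G (x - y) - b_d w d x * indicator {x - d..x + d} y"
  by (auto simp: K_d_def w_d_eq indicator_def abs_le_iff)

lemma K_d_borel [measurable]: "(\<lambda>p. K_d w d (fst p) (snd p)) \<in> borel_measurable (borel \<Otimes>\<^sub>M borel)"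
proof -
  have "(\<lambda>p. K_d w d (fst p) (snd p)) =
      (\<lambda>p. G (fst p - snd p) - b_d w d (fst p) * (if fst p - d \<le> snd p \<and> snd p \<le> fst p + d then 1 else 0))"
    by (auto simp: K_d_eq indicator_def fun_eq_iff)
  then show ?thesis by simp
qed

lemma K_d_interior: "d \<le> x \<Longrightarrow> x \<le> 1 - d \<Longrightarrow> K_d w d x y = G (x - y)"
  by (simp add: K_d_eq b_d_eq beta_def)

lemma K_d_bound: "\<bar>K_d w d x y\<bar> \<le> 5 * w 0 / d ^ 3"
proof -
  have "\<bar>b_d w d x * indicator {x - d..x + d} y\<bar> \<le> 4 * w 0 / d ^ 3"
    using b_d_bounds[of x] w0_pos d by (auto simp: indicator_def)
  then show ?thesis
    using G_bounds[of "x - y"] by (simp add: K_d_eq abs_le_iff)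
qed

lemma a_d_eq: "a_d w d x = (LINT y|lborel. indicator Om y * G (x - y))"
  unfolding a_d_def w_d_eq by (rule lebesgue_on_eq_lborel) measurable

lemma a_d_borel [measurable]: "a_d w d \<in> borel_measurable borel"
  unfolding a_d_eq[abs_def] by measurable

lemma a_d_bounds: "0 \<le> a_d w d x" "a_d w d x \<le> w 0 / d ^ 3"
proof -
  show "0 \<le> a_d w d x"
    unfolding a_d_eq using G_bounds by (intro integral_nonneg_AE AE_I2) auto
  have "a_d w d x \<le> (LINT y|lborel. indicator {0..1::real} y * (w 0 / d ^ 3))"
    unfolding a_d_eq
  proof (rule integral_mono)
    show "integrable lborel (\<lambda>y. indicator Om y * G (x - y))"
      using G_bounds w0_pos d by (intro integrable_bounded_support[where B = "w 0 / d ^ 3" and a = 0 and b = 1])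
        (auto simp: indicator_def Om_def)
    show "indicator Om y * G (x - y) \<le> indicator {0..1} y * (w 0 / d ^ 3)" for y
      using G_bounds[of "x - y"] w0_pos d by (auto simp: indicator_def Om_def)
  qed simp
  then show "a_d w d x \<le> w 0 / d ^ 3" by simp
qed

subsection \<open>Row and column sums\<close>

text \<open>Extending the kernel by zero to the whole plane lets integrals over the unit interval be
  written over \<open>lborel\<close>, where Fubini and the lemmas on double integrals apply.\<close>

definition k :: "real \<Rightarrow> real \<Rightarrow> real" where
  "k x y = indicator Om x * indicator Om y * K_d w d x y"

lemma k_borel: "(\<lambda>p. k (fst p) (snd p)) \<in> borel_measurable (borel \<Otimes>\<^sub>M borel)"
  unfolding k_def by measurable

lemma k_bound: "\<bar>k x y\<bar> \<le> 5 * w 0 / d ^ 3 * (indicator Om x * indicator Om y)"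
  using K_d_bound[of x y] by (auto simp: k_def indicator_def)

text \<open>(A3) is stated with the indicator of the open interval (0,d), which also excludes the
  diagonal, while \<open>K_d\<close> uses the closed one. They differ only at y = x, x - d, x + d, a
  null set, so (A3) bounds the column sums of |k|.\<close>

lemma column_sum_le:
  assumes "A3 w d" "x \<in> Om"
  shows "(LINT y|lborel. \<bar>k y x\<bar>) \<le> a_d w d x"
proof -
  have K: "(\<lambda>y. K_d w d y x) \<in> borel_measurable borel"
    using measurable_compose[OF _ K_d_borel, of "\<lambda>y. (y, x)" borel] by simp
  have wt: "wt_d w d y x = \<bar>G (y - x) - b_d w d y * (if y \<noteq> x \<and> \<bar>x - y\<bar> < d then 1 else 0)\<bar>" for y
    by (auto simp: wt_d_def w_d_eq indicator_def)
  have [measurable]: "(\<lambda>y. wt_d w d y x) \<in> borel_measurable borel"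
    unfolding wt by measurable
  have "(LINT y|lborel. \<bar>k y x\<bar>) = (LINT y|lborel. indicator Om y * wt_d w d y x)"
  proof (rule integral_cong_AE)
    have "AE y in lborel. y \<noteq> x" "AE y in lborel. y \<noteq> x - d" "AE y in lborel. y \<noteq> x + d"
      by (rule AE_lborel_singleton)+
    then show "AE y in lborel. \<bar>k y x\<bar> = indicator Om y * wt_d w d y x"
      by eventually_elim (use \<open>x \<in> Om\<close> in \<open>auto simp: k_def wt K_d_eq indicator_def abs_mult\<close>)
    show "(\<lambda>y. \<bar>k y x\<bar>) \<in> borel_measurable lborel"
      unfolding k_def using K by measurable
  qed measurable
  also have "\<dots> = Lint_on Om (\<lambda>y. wt_d w d y x)"
    by (rule lebesgue_on_eq_lborel(2)[symmetric]) measurable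
  also have "\<dots> \<le> a_d w d x" using assms by (simp add: A3_def)
  finally show ?thesis .
qed

end

section \<open>Counting signs in a row of the kernel\<close>

lemma measure_disjoint_Un_Om:
  assumes "A \<in> sets borel" "B \<in> sets borel" "A \<inter> B = {}" "A \<subseteq> Om" "B \<subseteq> Om"
  shows "measure lborel (A \<union> B) = measure lborel A + measure lborel B"
proof (rule measure_Union)
  have "emeasure lborel S \<noteq> \<infinity>" if "S \<subseteq> Om" "S \<in> sets borel" for S
  proof -
    have "emeasure lborel S \<le> emeasure lborel Om" using that by (intro emeasure_mono) auto
    also have "\<dots> < \<infinity>" by (simp add: Om_def)
    finally show ?thesis by simp
  qed
  then show "emeasure lborel A \<noteq> \<infinity>" "emeasure lborel B \<noteq> \<infinity>" using assms by auto
qed (use assms in auto)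

lemma integrable_indicator_Om:
  fixes g :: "real \<Rightarrow> real"
  assumes [measurable]: "g \<in> borel_measurable borel" and "A \<in> sets borel" "A \<subseteq> Om"
    and "\<And>y. \<bar>g y\<bar> \<le> C"
  shows "integrable lborel (\<lambda>y. indicator A y * g y)"
proof (rule integrable_bounded_support[where B = C and a = 0 and b = 1])
  show "\<bar>indicator A y * g y\<bar> \<le> C * indicator {0..1} y" for y
    using assms(3) assms(4)[of y] order_trans[OF abs_ge_zero assms(4)] by (auto simp: indicator_def Om_def)
qed (use assms in measurable)

text \<open>On P the kernel equals g - b and on N its modulus is b - g, so g minus the modulus is b
  on P, 2 g - b on N and 0 off I. Points of Om off I belong to both level sets of the majority
  condition and cancel from it, which leaves |N| \<le> |P|.\<close>

lemma sign_surplus: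
  fixes g :: "real \<Rightarrow> real"
  assumes g [measurable]: "g \<in> borel_measurable borel" and I [measurable]: "I \<in> sets borel"
    and g_bounds: "\<And>y. 0 \<le> g y" "\<And>y. g y \<le> C" and gI: "\<And>y. y \<notin> I \<Longrightarrow> g y = 0"
    and maj: "measure lborel {y\<in>Om. g y - b * indicator I y \<ge> 0} \<ge> measure lborel {y\<in>Om. g y - b * indicator I y \<le> 0}"
  defines "P \<equiv> {y\<in>Om \<inter> I. b \<le> g y}" and "N \<equiv> {y\<in>Om \<inter> I. g y < b}"
  shows "measure lborel N \<le> measure lborel P"
    and "(LINT y|lborel. indicator Om y * g y) - (LINT y|lborel. \<bar>indicator Om y * (g y - b * indicator I y)\<bar>)
      = b * (measure lborel P - measure lborel N) + 2 * (LINT y|lborel. indicator N y * g y)"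
proof -
  have PNm [measurable]: "P \<in> sets borel" "N \<in> sets borel"
    unfolding P_def N_def by measurable
  have PN: "P \<subseteq> Om" "N \<subseteq> Om" "P \<inter> N = {}" by (auto simp: P_def N_def)
  have "{y\<in>Om. g y - b * indicator I y \<ge> 0} = P \<union> (Om - I)"
    using gI by (auto simp: P_def indicator_def)
  then have 1: "measure lborel {y\<in>Om. g y - b * indicator I y \<ge> 0} = measure lborel P + measure lborel (Om - I)"
    using measure_disjoint_Un_Om[of P "Om - I"] PN by (auto simp: P_def)
  have NI: "N \<inter> (Om - I) = {}" by (auto simp: N_def)
  \<comment> \<open>Only an inclusion: points of I with g = b are counted in P but also lie in the
    set on the right.\<close>
  have sub: "N \<union> (Om - I) \<subseteq> {y\<in>Om. g y - b * indicator I y \<le> 0}"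
    using gI by (auto simp: N_def indicator_def)
  have "measure lborel (N \<union> (Om - I)) \<le> measure lborel {y\<in>Om. g y - b * indicator I y \<le> 0}"
  proof (rule measure_mono_fmeasurable[OF sub])
    show "{y\<in>Om. g y - b * indicator I y \<le> 0} \<in> fmeasurable lborel"
      by (rule fmeasurableI2[of Om]) (auto simp: Om_def fmeasurable_def)
  qed auto
  then have 2: "measure lborel N + measure lborel (Om - I) \<le> measure lborel {y\<in>Om. g y - b * indicator I y \<le> 0}"
    using measure_disjoint_Un_Om[of N "Om - I"] PN NI by auto
  show "measure lborel N \<le> measure lborel P" using 1 2 maj by linarith
  have int: "integrable lborel (\<lambda>y. indicator Om y * g y)" "integrable lborel (\<lambda>y. indicator N y * g y)"
    using g_bounds PN by (auto intro!: integrable_indicator_Om[where C = C])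
  have intP: "integrable lborel (indicator P :: real \<Rightarrow> real)" "integrable lborel (indicator N :: real \<Rightarrow> real)"
    using integrable_indicator_Om[of "\<lambda>_. 1" P 1] integrable_indicator_Om[of "\<lambda>_. 1" N 1] PN by auto
  have "integrable lborel (\<lambda>y. indicator Om y * (g y - b * indicator I y))"
  proof (rule integrable_indicator_Om[where C = "C + \<bar>b\<bar>"])
    show "\<bar>g y - b * indicator I y\<bar> \<le> C + \<bar>b\<bar>" for y
      using g_bounds[of y] by (auto simp: indicator_def)
  qed auto
  then have int2: "integrable lborel (\<lambda>y. \<bar>indicator Om y * (g y - b * indicator I y)\<bar>)"
    by (rule integrable_abs)
  have "(LINT y|lborel. indicator Om y * g y) - (LINT y|lborel. \<bar>indicator Om y * (g y - b * indicator I y)\<bar>)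
    = (LINT y|lborel. indicator Om y * g y - \<bar>indicator Om y * (g y - b * indicator I y)\<bar>)"
    using int int2 by simp
  also have "\<dots> = (LINT y|lborel. b * indicator P y - b * indicator N y + 2 * (indicator N y * g y))"
    using gI by (intro Bochner_Integration.integral_cong) (auto simp: P_def N_def indicator_def)
  also have "\<dots> = b * (measure lborel P - measure lborel N) + 2 * (LINT y|lborel. indicator N y * g y)"
    using int intP by (simp add: right_diff_distrib)
  finally show "(LINT y|lborel. indicator Om y * g y) - (LINT y|lborel. \<bar>indicator Om y * (g y - b * indicator I y)\<bar>)
      = b * (measure lborel P - measure lborel N) + 2 * (LINT y|lborel. indicator N y * g y)" .
qed

context nonlocal_kernel
begin

text \<open>On the set \<open>N\<close> where the kernel is negative the surplus gains \<open>2 \<integral>\<^sub>N w\<close>; if \<open>N\<close> is small, then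
  \<open>b (\<bar>P\<bar> - \<bar>N\<bar>)\<close> is large instead.\<close>
lemma row_surplus:
  assumes A2s: "A2s w d" and x: "x \<in> Om"
  shows "(LINT y|lborel. \<bar>k x y\<bar>) \<le> a_d w d x"
    and "x \<le> 3/4 * d \<or> 1 - 3/4 * d \<le> x \<Longrightarrow> w (15/16) / (40 * d\<^sup>2) \<le> a_d w d x - (LINT y|lborel. \<bar>k x y\<bar>)"
proof -
  define g where "g y = G (x - y)" for y
  define I where "I = {x - d..x + d}"
  define b where "b = b_d w d x"
  define P where "P = {y\<in>Om \<inter> I. b \<le> g y}"
  define N where "N = {y\<in>Om \<inter> I. g y < b}"
  have [measurable]: "g \<in> borel_measurable borel" "I \<in> sets borel"
    unfolding g_def I_def by measurable
  have PNm [measurable]: "P \<in> sets borel" "N \<in> sets borel"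
    unfolding P_def N_def by measurable
  have gI: "g y = 0" if "y \<notin> I" for y
    using that G_eq_0[of "x - y"] by (auto simp: g_def I_def)
  have gb: "0 \<le> g y" "g y \<le> w 0 / d ^ 3" for y
    using G_bounds by (auto simp: g_def)
  have KK: "K_d w d x y = g y - b * indicator I y" for y
    by (simp add: K_d_eq g_def b_def I_def)
  have maj: "measure lborel {y\<in>Om. g y - b * indicator I y \<ge> 0} \<ge> measure lborel {y\<in>Om. g y - b * indicator I y \<le> 0}"
  proof -
    have "measure lebesgue {y\<in>Om. K_d w d x y \<le> 0} \<le> measure lebesgue {y\<in>Om. K_d w d x y \<ge> 0}"
      using A2s x by (simp add: A2s_def)
    moreover have "{y\<in>Om. g y - b * indicator I y \<ge> 0} \<in> sets borel" "{y\<in>Om. g y - b * indicator I y \<le> 0} \<in> sets borel"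
      by measurable
    ultimately show ?thesis by (simp add: KK measure_completion)
  qed
  have b: "b \<ge> 0" using b_d_bounds by (simp add: b_def)
  define D where "D = a_d w d x - (LINT y|lborel. \<bar>k x y\<bar>)"
  define F where "F = (LINT y|lborel. indicator N y * g y)"
  have NP: "measure lborel N \<le> measure lborel P"
    using sign_surplus(1)[OF _ _ gb gI maj] by (simp add: P_def N_def)
  have "D = (LINT y|lborel. indicator Om y * g y) - (LINT y|lborel. \<bar>indicator Om y * (g y - b * indicator I y)\<bar>)"
    using x by (simp add: D_def a_d_eq g_def[symmetric] k_def KK)
  also have "\<dots> = b * (measure lborel P - measure lborel N) + 2 * F"
    using sign_surplus(2)[OF _ _ gb gI maj] by (simp add: P_def N_def F_def)
  finally have D: "D = b * (measure lborel P - measure lborel N) + 2 * F" .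
  have F: "F \<ge> 0" unfolding F_def using gb by (intro integral_nonneg_AE AE_I2) auto
  have "D \<ge> 0" unfolding D using b NP F by simp
  then show "(LINT y|lborel. \<bar>k x y\<bar>) \<le> a_d w d x" by (simp add: D_def)
  assume near: "x \<le> 3/4 * d \<or> 1 - 3/4 * d \<le> x"
  have "b \<ge> w (15/16) / (20 * d ^ 3)"
    using near
  proof
    assume "x \<le> 3/4 * d"
    then show ?thesis using beta_ge[of x] beta_bounds(1)[of "1 - x"] x by (simp add: b_def b_d_eq Om_def)
  next
    assume "1 - 3/4 * d \<le> x"
    then show ?thesis using beta_ge[of "1 - x"] beta_bounds(1)[of x] x by (simp add: b_def b_d_eq Om_def)
  qed
  have "measure lborel P + measure lborel N = measure lborel (P \<union> N)"
    by (rule measure_disjoint_Un_Om[symmetric]) (auto simp: P_def N_def)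
  also have "P \<union> N = Om \<inter> I" by (auto simp: P_def N_def)
  also have "measure lborel (Om \<inter> I) \<ge> d"
  proof -
    \<comment> \<open>On the side of x that faces the middle of the unit interval, a half-window of
      full length d stays inside Om.\<close>
    define z where "z = (if x \<le> 1/2 then x else x - d)"
    have "{z<..<z + d} \<subseteq> Om \<inter> I"
      using x d by (auto simp: z_def Om_def I_def)
    moreover have "Om \<inter> I \<in> fmeasurable lborel"
      by (rule fmeasurableI2[of Om]) (auto simp: Om_def fmeasurable_def I_def)
    ultimately have "measure lborel {z<..<z + d} \<le> measure lborel (Om \<inter> I)"
      by (intro measure_mono_fmeasurable) auto
    then show ?thesis using d by simp
  qed
  finally have sum: "d \<le> measure lborel P + measure lborel N" .
  have "w (15/16) / (40 * d\<^sup>2) \<le> D"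
  \<comment> \<open>The pieces of the window with |x - y| \<ge> 15/16 d have total length d/8, so
    |N| \<ge> d/4 leaves at least d/8 on which g is at least w(15/16) / d^3. Otherwise |P| + |N|
    \<ge> d forces |P| - |N| \<ge> d/2.\<close>
  proof (cases "measure lborel N \<ge> d / 4")
    case True
    define R1 R2 where "R1 = {x - d..x - 15/16 * d}" and "R2 = {x + 15/16 * d..x + d}"
    have intN: "integrable lborel (indicator N :: real \<Rightarrow> real)"
      using integrable_indicator_Om[of "\<lambda>_. 1" N 1] by (auto simp: N_def)
    have intg: "integrable lborel (\<lambda>y. indicator N y * g y)"
      using gb by (intro integrable_indicator_Om[where C = "w 0 / d ^ 3"]) (auto simp: N_def)
    have intR: "integrable lborel (indicator R1 :: real \<Rightarrow> real)" "integrable lborel (indicator R2 :: real \<Rightarrow> real)"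
      unfolding R1_def R2_def by (rule integrable_indicator_Icc)+
    have "w (15/16) / d ^ 3 * (d / 8) \<le> w (15/16) / d ^ 3 * (measure lborel N - d / 16 - d / 16)"
      using True w_pos d by (intro mult_left_mono) auto
    also have "\<dots> = (LINT y|lborel. w (15/16) / d ^ 3 * (indicator N y - indicator R1 y - indicator R2 y))"
      using intN intR d by (simp add: R1_def R2_def)
    also have "\<dots> \<le> F"
      unfolding F_def
    proof (rule integral_mono[OF _ intg])
      show "integrable lborel (\<lambda>y. w (15/16) / d ^ 3 * (indicator N y - indicator R1 y - indicator R2 y :: real))"
        using intN intR by simp
      fix y
      show "w (15/16) / d ^ 3 * (indicator N y - indicator R1 y - indicator R2 y) \<le> indicator N y * g y"
      proof (cases "y \<in> N \<and> y \<notin> R1 \<and> y \<notin> R2")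
        case True
        then have "x - 15/16 * d < y" "y < x + 15/16 * d" by (auto simp: N_def I_def R1_def R2_def)
        then have "\<bar>x - y\<bar> \<le> 15/16 * d" by linarith
        then show ?thesis using True G_lower by (simp add: g_def)
      next
        case False
        then have "indicator N y - indicator R1 y - indicator R2 y \<le> (0 :: real)" by (auto simp: indicator_def)
        then have "w (15/16) / d ^ 3 * (indicator N y - indicator R1 y - indicator R2 y) \<le> 0"
          using w_pos d by (intro mult_nonneg_nonpos) auto
        also have "0 \<le> indicator N y * g y" using gb by simp
        finally show ?thesis .
      qed
    qed
    finally have "w (15/16) / (8 * d\<^sup>2) \<le> F"
      using d by (simp add: power3_eq_cube power2_eq_square)
    moreover have "w (15/16) / (40 * d\<^sup>2) \<le> w (15/16) / (8 * d\<^sup>2)"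
      using w_pos d by (intro divide_left_mono) auto
    moreover have "b * (measure lborel P - measure lborel N) \<ge> 0" using b NP by simp
    ultimately show ?thesis using F unfolding D by linarith
  next
    case False
    then have "measure lborel P - measure lborel N \<ge> d / 2" using sum by linarith
    then have "w (15/16) / (20 * d ^ 3) * (d / 2) \<le> b * (measure lborel P - measure lborel N)"
      using \<open>b \<ge> w (15/16) / (20 * d ^ 3)\<close> b d by (intro mult_mono) auto
    moreover have "w (15/16) / (20 * d ^ 3) * (d / 2) = w (15/16) / (40 * d\<^sup>2)"
      using d by (simp add: power3_eq_cube power2_eq_square)
    ultimately show ?thesis using F unfolding D by linarith
  qed
  then show "w (15/16) / (40 * d\<^sup>2) \<le> a_d w d x - (LINT y|lborel. \<bar>k x y\<bar>)" by (simp add: D_def)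
qed

end

subsection \<open>Stability\<close>

lemma integrable_bounded_kernel:
  fixes v :: "real \<Rightarrow> real" and \<kappa> :: "real \<Rightarrow> real \<Rightarrow> real"
  assumes v [measurable]: "v \<in> borel_measurable borel" and v2: "integrable lborel (\<lambda>x. (v x)\<^sup>2)"
    and \<kappa> [measurable]: "(\<lambda>p. \<kappa> (fst p) (snd p)) \<in> borel_measurable LL"
    and bound: "\<And>x y. \<bar>\<kappa> x y\<bar> \<le> M * (indicator {-1..2} x * indicator {-1..2} y)"
  shows "integrable LL (\<lambda>p. \<kappa> (fst p) (snd p) * (v (fst p))\<^sup>2)" (is ?F)
    and "integrable LL (\<lambda>p. \<kappa> (fst p) (snd p) * (v (snd p))\<^sup>2)" (is ?S)
    and "integrable LL (\<lambda>p. \<kappa> (fst p) (snd p) * (v (fst p) - v (snd p))\<^sup>2)" (is ?D)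
proof -
  have *: "\<bar>\<kappa> x y * t\<bar> \<le> 2 * M * (indicator {-1..2} x * indicator {-1..2} y * ((v x)\<^sup>2 + (v y)\<^sup>2))"
    if "0 \<le> t" "t \<le> 2 * ((v x)\<^sup>2 + (v y)\<^sup>2)" for x y t
  proof -
    have "\<bar>\<kappa> x y * t\<bar> = \<bar>\<kappa> x y\<bar> * t" using that by (simp add: abs_mult)
    also have "\<dots> \<le> \<bar>\<kappa> x y\<bar> * (2 * ((v x)\<^sup>2 + (v y)\<^sup>2))" using that by (intro mult_left_mono) auto
    also have "\<dots> \<le> (M * (indicator {-1..2} x * indicator {-1..2} y)) * (2 * ((v x)\<^sup>2 + (v y)\<^sup>2))"
      by (intro mult_right_mono bound) auto
    finally show ?thesis by (simp only: mult_ac)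
  qed
  have "(v x - v y)\<^sup>2 \<le> 2 * ((v x)\<^sup>2 + (v y)\<^sup>2)" for x y
    using sum_squares_bound[of "v x" "- v y"] by (simp add: power2_diff)
  then have 3: "\<bar>\<kappa> x y * (v x - v y)\<^sup>2\<bar> \<le> 2 * M * (indicator {-1..2} x * indicator {-1..2} y * ((v x)\<^sup>2 + (v y)\<^sup>2))" for x y
    by (intro *) auto
  have 1: "\<bar>\<kappa> x y * (v x)\<^sup>2\<bar> \<le> 2 * M * (indicator {-1..2} x * indicator {-1..2} y * ((v x)\<^sup>2 + (v y)\<^sup>2))" for x y
    by (intro *) auto
  have 2: "\<bar>\<kappa> x y * (v y)\<^sup>2\<bar> \<le> 2 * M * (indicator {-1..2} x * indicator {-1..2} y * ((v x)\<^sup>2 + (v y)\<^sup>2))" for x y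
    by (intro *) auto
  show ?F by (rule integrable_dominated_by_squares[OF v2, where c = "2 * M"]) (measurable, use 1 in simp)
  show ?S by (rule integrable_dominated_by_squares[OF v2, where c = "2 * M"]) (measurable, use 2 in simp)
  show ?D by (rule integrable_dominated_by_squares[OF v2, where c = "2 * M"]) (measurable, use 3 in simp)
qed

section \<open>Energy and mass in neighbouring layers\<close>

locale nonlocal_energy = nonlocal_kernel +
  fixes v :: "real \<Rightarrow> real"
  assumes v_borel [measurable]: "v \<in> borel_measurable borel"
    and v2: "integrable lborel (\<lambda>x. (v x)\<^sup>2)"
    and v0: "\<And>x. x \<notin> Om \<Longrightarrow> v x = 0"
    and d4: "d \<le> 1/4"
begin

definition J :: "real set" where "J = {d..1 - d}"

text \<open>Only the first variable is confined to the interior J. Pairs whose second point lies in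
  a boundary layer remain, and they are the link between the layers and the interior.\<close>

definition E :: real where
  "E = (LINT p|LL. indicator J (fst p) * k (fst p) (snd p) * (v (fst p) - v (snd p))\<^sup>2)"

definition mass :: "real set \<Rightarrow> real" where
  "mass S = (LINT x|lborel. indicator S x * (v x)\<^sup>2)"

lemma J_borel [measurable]: "J \<in> sets borel"
  by (simp add: J_def)

lemma J_Om: "J \<subseteq> Om"
  using d by (auto simp: J_def Om_def)

lemma k_interior: "x \<in> J \<Longrightarrow> k x y = indicator Om y * G (x - y)"
  using J_Om K_d_interior[of x y] by (auto simp: k_def J_def)

lemma k_interior_ge: "x \<in> J \<Longrightarrow> y \<in> Om \<Longrightarrow> \<bar>x - y\<bar> \<le> 15/16 * d \<Longrightarrow> w (15/16) / d ^ 3 \<le> k x y"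
  using G_lower[of "x - y"] by (simp add: k_interior)

lemma integrable_mass: "S \<in> sets borel \<Longrightarrow> integrable lborel (\<lambda>x. indicator S x * (v x)\<^sup>2)"
  using integrable_mult_indicator[OF _ v2, of S] by simp

lemma mass_nonneg: "0 \<le> mass S"
  unfolding mass_def by (intro integral_nonneg_AE AE_I2) auto

lemma mass_mono: "S \<subseteq> T \<Longrightarrow> S \<in> sets borel \<Longrightarrow> T \<in> sets borel \<Longrightarrow> mass S \<le> mass T"
  unfolding mass_def by (intro integral_mono integrable_mass) (auto simp: indicator_def)

lemma mass_Un_le:
  assumes "S \<in> sets borel" "T \<in> sets borel"
  shows "mass (S \<union> T) \<le> mass S + mass T"
proof -
  have "mass (S \<union> T) \<le> (LINT x|lborel. indicator S x * (v x)\<^sup>2 + indicator T x * (v x)\<^sup>2)"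
    unfolding mass_def using assms
    by (intro integral_mono Bochner_Integration.integrable_add integrable_mass) (auto simp: indicator_def)
  also have "\<dots> = mass S + mass T"
    using assms integrable_mass by (simp add: mass_def)
  finally show ?thesis .
qed

lemma E_integrable:
  "integrable LL (\<lambda>p. indicator J (fst p) * k (fst p) (snd p) * (v (fst p) - v (snd p))\<^sup>2)"
proof (rule integrable_bounded_kernel(3)[OF v_borel v2, of "\<lambda>x y. indicator J x * k x y" "5 * w 0 / d ^ 3"])
  show "(\<lambda>p. indicator J (fst p) * k (fst p) (snd p)) \<in> borel_measurable LL"
    using k_borel by measurable
  show "\<bar>indicator J x * k x y\<bar> \<le> 5 * w 0 / d ^ 3 * (indicator {-1..2} x * indicator {-1..2} y)" for x y
  proof -
    have "\<bar>k x y\<bar> \<le> 5 * w 0 / d ^ 3 * (indicator {-1..2} x * indicator {-1..2} y)"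
      by (rule order_trans[OF k_bound mult_left_mono]) (use w0_pos d in \<open>auto simp: indicator_def Om_def\<close>)
    moreover have "\<bar>indicator J x * k x y\<bar> \<le> \<bar>k x y\<bar>" by (simp add: indicator_def)
    ultimately show ?thesis by linarith
  qed
qed

lemma E_nonneg: "0 \<le> E"
  unfolding E_def
proof (intro integral_nonneg_AE AE_I2)
  show "0 \<le> indicator J (fst p) * k (fst p) (snd p) * (v (fst p) - v (snd p))\<^sup>2" for p
    using k_interior[of "fst p" "snd p"] G_bounds by (cases "fst p \<in> J") auto
qed

text \<open>Integrate v(x)^2 \<le> 2 v(y)^2 + 2 (v(x) - v(y))^2 over A x B, and the same with x and
  y exchanged. Each section has measure d/4, and the kernel is at least w(15/16) / d^3 on A x B, so
  the difference term is at most 2 d^3 / w(15/16) times E; division by d/4 gives 8 d^2. Only A is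
  placed in J, so B may be part of a boundary layer.\<close>

lemma energy_close_sets:
  assumes [measurable]: "A \<in> sets borel" "B \<in> sets borel"
    and AB: "A \<subseteq> J" "B \<subseteq> Om" "\<And>x y. x \<in> A \<Longrightarrow> y \<in> B \<Longrightarrow> \<bar>x - y\<bar> \<le> 15/16 * d"
    and m: "measure lborel A = d / 4" "measure lborel B = d / 4"
  shows "mass A \<le> 2 * mass B + 8 * d\<^sup>2 / w (15/16) * E"
    and "mass B \<le> 2 * mass A + 8 * d\<^sup>2 / w (15/16) * E"
proof -
  define \<kappa> :: "real \<Rightarrow> real \<Rightarrow> real" where "\<kappa> x y = indicator A x * indicator B y" for x y
  have \<kappa>m [measurable]: "(\<lambda>p. \<kappa> (fst p) (snd p)) \<in> borel_measurable LL"
    unfolding \<kappa>_def by measurable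
  have "\<bar>\<kappa> x y\<bar> \<le> 1 * (indicator {-1..2} x * indicator {-1..2} y)" for x y
    using AB J_Om by (auto simp: \<kappa>_def indicator_def Om_def subset_iff)
  note int = integrable_bounded_kernel[OF v_borel v2 \<kappa>m this]
  define X where "X = (LINT p|LL. \<kappa> (fst p) (snd p) * (v (fst p) - v (snd p))\<^sup>2)"
  have "X \<le> (LINT p|LL. d ^ 3 / w (15/16) * (indicator J (fst p) * k (fst p) (snd p) * (v (fst p) - v (snd p))\<^sup>2))"
    unfolding X_def
  proof (rule integral_mono[OF int(3) integrable_mult_right[OF E_integrable]])
    fix p
    show "\<kappa> (fst p) (snd p) * (v (fst p) - v (snd p))\<^sup>2 \<le>
        d ^ 3 / w (15/16) * (indicator J (fst p) * k (fst p) (snd p) * (v (fst p) - v (snd p))\<^sup>2)"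
    proof (cases "fst p \<in> A \<and> snd p \<in> B")
      case True
      then have "w (15/16) / d ^ 3 \<le> k (fst p) (snd p)" and J: "fst p \<in> J"
        using AB by (auto intro!: k_interior_ge)
      then have "d ^ 3 / w (15/16) * (w (15/16) / d ^ 3) \<le> d ^ 3 / w (15/16) * k (fst p) (snd p)"
        using d w_pos by (intro mult_left_mono) auto
      then have "1 \<le> d ^ 3 / w (15/16) * k (fst p) (snd p)" using d w_pos by simp
      then have "1 * (v (fst p) - v (snd p))\<^sup>2 \<le> (d ^ 3 / w (15/16) * k (fst p) (snd p)) * (v (fst p) - v (snd p))\<^sup>2"
        by (intro mult_right_mono) auto
      then show ?thesis using True J by (simp add: \<kappa>_def)
    next
      case False
      then have "\<kappa> (fst p) (snd p) = 0" by (auto simp: \<kappa>_def)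
      moreover have "0 \<le> indicator J (fst p) * k (fst p) (snd p) * (v (fst p) - v (snd p))\<^sup>2"
        using k_interior[of "fst p" "snd p"] G_bounds by (cases "fst p \<in> J") auto
      ultimately show ?thesis using d w_pos by simp
    qed
  qed
  also have "\<dots> = d ^ 3 / w (15/16) * E" by (simp add: E_def)
  finally have X: "X \<le> d ^ 3 / w (15/16) * E" .
  have I1: "(LINT y|lborel. \<kappa> x y) = indicator A x * (d / 4)" for x
    using m by (simp add: \<kappa>_def)
  have F: "(LINT p|LL. \<kappa> (fst p) (snd p) * (v (fst p))\<^sup>2) = d / 4 * mass A"
    unfolding integral_prod_fst(1)[OF int(1)] I1 by (simp add: mass_def mult_ac)
  have I2: "(LINT x|lborel. \<kappa> x y) = indicator B y * (d / 4)" for y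
    using m by (simp add: \<kappa>_def)
  have S: "(LINT p|LL. \<kappa> (fst p) (snd p) * (v (snd p))\<^sup>2) = d / 4 * mass B"
    unfolding integral_prod_snd(1)[OF int(2)] I2 by (simp add: mass_def mult_ac)
  have \<kappa>0: "0 \<le> \<kappa> x y" for x y by (simp add: \<kappa>_def)
  have sq: "a\<^sup>2 \<le> 2 * b\<^sup>2 + 2 * (a - b)\<^sup>2" "b\<^sup>2 \<le> 2 * a\<^sup>2 + 2 * (a - b)\<^sup>2" for a b :: real
    using zero_le_power2[of "a - 2 * b"] zero_le_power2[of "b - 2 * a"]
    by (simp_all add: power2_eq_square algebra_simps)
  have "d / 4 * mass A \<le> (LINT p|LL. 2 * (\<kappa> (fst p) (snd p) * (v (snd p))\<^sup>2) + 2 * (\<kappa> (fst p) (snd p) * (v (fst p) - v (snd p))\<^sup>2))"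
    unfolding F[symmetric]
  proof (rule integral_mono[OF int(1)])
    show "\<kappa> (fst p) (snd p) * (v (fst p))\<^sup>2 \<le> 2 * (\<kappa> (fst p) (snd p) * (v (snd p))\<^sup>2) + 2 * (\<kappa> (fst p) (snd p) * (v (fst p) - v (snd p))\<^sup>2)" for p
      using mult_left_mono[OF sq(1) \<kappa>0, of "fst p" "snd p" "v (fst p)" "v (snd p)"] by (simp add: algebra_simps)
  qed (use int in simp)
  also have "\<dots> = d / 4 * (2 * mass B) + 2 * X"
    using int S by (simp add: X_def)
  also have "\<dots> \<le> d / 4 * (2 * mass B) + 2 * (d ^ 3 / w (15/16) * E)" using X by simp
  also have "\<dots> = d / 4 * (2 * mass B + 8 * d\<^sup>2 / w (15/16) * E)"
    using d w_pos by (simp add: field_simps power3_eq_cube power2_eq_square)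
  finally show "mass A \<le> 2 * mass B + 8 * d\<^sup>2 / w (15/16) * E"
    using d by simp
  have "d / 4 * mass B \<le> (LINT p|LL. 2 * (\<kappa> (fst p) (snd p) * (v (fst p))\<^sup>2) + 2 * (\<kappa> (fst p) (snd p) * (v (fst p) - v (snd p))\<^sup>2))"
    unfolding S[symmetric]
  proof (rule integral_mono[OF int(2)])
    show "\<kappa> (fst p) (snd p) * (v (snd p))\<^sup>2 \<le> 2 * (\<kappa> (fst p) (snd p) * (v (fst p))\<^sup>2) + 2 * (\<kappa> (fst p) (snd p) * (v (fst p) - v (snd p))\<^sup>2)" for p
      using mult_left_mono[OF sq(2) \<kappa>0, of "fst p" "snd p" "v (snd p)" "v (fst p)"] by (simp add: algebra_simps)
  qed (use int in simp)
  also have "\<dots> = d / 4 * (2 * mass A) + 2 * X"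
    using int F by (simp add: X_def)
  also have "\<dots> \<le> d / 4 * (2 * mass A) + 2 * (d ^ 3 / w (15/16) * E)" using X by simp
  also have "\<dots> = d / 4 * (2 * mass A + 8 * d\<^sup>2 / w (15/16) * E)"
    using d w_pos by (simp add: field_simps power3_eq_cube power2_eq_square)
  finally show "mass B \<le> 2 * mass A + 8 * d\<^sup>2 / w (15/16) * E"
    using d by simp
qed

text \<open>The nonlocal Poincare inequality with r = d/4 for v cut off outside J. The cut creates
  jumps, but only in pairs with exactly one point in J; that point lies within d/4 of an end of J
  and is charged to the mass of the strip there. The constant 1024 is 16 * 4^3.\<close>

lemma mass_interior_le:
  "mass J \<le> 1024 * (E / w (15/16) + (mass {d..5/4 * d} + mass {1 - 5/4 * d..1 - d}) / (4 * d\<^sup>2))"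
proof -
  define q where "q x = indicator J x * v x" for x
  define i :: "real \<Rightarrow> real \<Rightarrow> real" where "i x y = indicator {0<..<d/4} (y - x)" for x y
  define L R where "L = {d..5/4 * d}" and "R = {1 - 5/4 * d..1 - d}"
  define Z where "Z = E / w (15/16) + (mass L + mass R) / (4 * d\<^sup>2)"
  have [measurable]: "L \<in> sets borel" "R \<in> sets borel" by (simp_all add: L_def R_def)
  have [measurable]: "(\<lambda>p. i (fst p) (snd p)) \<in> borel_measurable LL"
    unfolding i_def by measurable
  have qm [measurable]: "q \<in> borel_measurable borel" unfolding q_def by measurable
  have q2: "(q x)\<^sup>2 = indicator J x * (v x)\<^sup>2" for x by (simp add: q_def power_mult_distrib power2_eq_square indicator_def)
  have q2i: "integrable lborel (\<lambda>x. (q x)\<^sup>2)" unfolding q2 by (rule integrable_mass) simp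
  have q0: "q x = 0" if "x \<notin> Om" for x using that J_Om by (auto simp: q_def indicator_def)
  define X where "X = (LINT p|LL. i (fst p) (snd p) * (q (snd p) - q (fst p))\<^sup>2)"
  have "(d / 4) ^ 3 * mass J \<le> 16 * X"
    using nonlocal_Poincare[OF qm q2i q0, of "d / 4"] d by (simp add: q2 mass_def X_def i_def)
  then have 1: "d ^ 3 * mass J \<le> 1024 * X" by (simp add: power_divide)
  have i01: "i x y = 0 \<or> i x y = 1" for x y by (auto simp: i_def indicator_def)
  have bR: "\<bar>indicator R x * i x y\<bar> \<le> 1 * (indicator {-1..2} x * indicator {-1..2} y)" for x y
    using d d4 by (auto simp: i_def R_def indicator_def)
  have bL: "\<bar>i x y * indicator L y\<bar> \<le> 1 * (indicator {-1..2} x * indicator {-1..2} y)" for x y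
    using d d4 by (auto simp: i_def L_def indicator_def)
  have intR: "integrable LL (\<lambda>p. indicator R (fst p) * i (fst p) (snd p) * (v (fst p))\<^sup>2)"
    by (rule integrable_bounded_kernel(1)[of v "\<lambda>x y. indicator R x * i x y" 1]) (measurable, use v2 bR in auto)
  have intL: "integrable LL (\<lambda>p. i (fst p) (snd p) * indicator L (snd p) * (v (snd p))\<^sup>2)"
    by (rule integrable_bounded_kernel(2)[of v "\<lambda>x y. i x y * indicator L y" 1]) (measurable, use v2 bL in auto)
  have I1: "(LINT y|lborel. i x y) = d / 4" for x
  proof -
    have "i x = indicator {x<..<x + d / 4}" by (auto simp: i_def indicator_def fun_eq_iff)
    then show ?thesis using d by simp
  qed
  have I2: "(LINT x|lborel. i x y) = d / 4" for y
  proof -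
    have "(\<lambda>x. i x y) = indicator {y - d / 4<..<y}" by (auto simp: i_def indicator_def fun_eq_iff)
    then show ?thesis using d by simp
  qed
  have mR: "(LINT p|LL. indicator R (fst p) * i (fst p) (snd p) * (v (fst p))\<^sup>2) = d / 4 * mass R"
    using integral_prod_fst(1)[of "\<lambda>x y. indicator R x * i x y", OF intR] by (simp add: mass_def I1 mult_ac)
  have mL: "(LINT p|LL. i (fst p) (snd p) * indicator L (snd p) * (v (snd p))\<^sup>2) = d / 4 * mass L"
    using integral_prod_snd(1)[of "\<lambda>x y. i x y * indicator L y", OF intL] by (simp add: mass_def I2 mult_ac)
  have "X \<le> (LINT p|LL. d ^ 3 / w (15/16) * (indicator J (fst p) * k (fst p) (snd p) * (v (fst p) - v (snd p))\<^sup>2)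
      + (indicator R (fst p) * i (fst p) (snd p) * (v (fst p))\<^sup>2 + i (fst p) (snd p) * indicator L (snd p) * (v (snd p))\<^sup>2))"
    unfolding X_def
  proof (rule integral_mono')
    show "integrable LL (\<lambda>p. d ^ 3 / w (15/16) * (indicator J (fst p) * k (fst p) (snd p) * (v (fst p) - v (snd p))\<^sup>2)
      + (indicator R (fst p) * i (fst p) (snd p) * (v (fst p))\<^sup>2 + i (fst p) (snd p) * indicator L (snd p) * (v (snd p))\<^sup>2))"
      by (intro Bochner_Integration.integrable_add integrable_mult_right E_integrable intR intL)
    fix p :: "real \<times> real"
    obtain x y where p: "p = (x, y)" by (cases p)
    define e where "e = indicator J x * k x y * (v x - v y)\<^sup>2"
    have e: "0 \<le> e"
      unfolding e_def using k_interior[of x y] G_bounds by (cases "x \<in> J") auto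
    have c: "0 < d ^ 3 / w (15/16)" using d w_pos by simp
    have ce: "0 \<le> d ^ 3 / w (15/16) * e" using c e by (intro mult_nonneg_nonneg) auto
    have "i x y * (q y - q x)\<^sup>2 \<le> d ^ 3 / w (15/16) * e + (indicator R x * i x y * (v x)\<^sup>2 + i x y * indicator L y * (v y)\<^sup>2)"
    proof (cases "i x y = 0")
      case True
      then show ?thesis using ce by simp
    next
      case False
      then have i: "i x y = 1" and xy: "x < y" "y < x + d / 4" by (auto simp: i_def indicator_def split: if_splits)
      consider "x \<in> J" "y \<in> J" | "x \<in> J" "y \<notin> J" | "x \<notin> J" "y \<in> J" | "x \<notin> J" "y \<notin> J" by blast
      then show ?thesis
      proof cases
        case 1
        have "w (15/16) / d ^ 3 \<le> k x y"
          using 1 xy d J_Om by (intro k_interior_ge) auto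
        then have "w (15/16) / d ^ 3 * (v x - v y)\<^sup>2 \<le> e"
          using 1 mult_right_mono[of _ _ "(v x - v y)\<^sup>2"] unfolding e_def by fastforce
        then have "d ^ 3 / w (15/16) * (w (15/16) / d ^ 3 * (v x - v y)\<^sup>2) \<le> d ^ 3 / w (15/16) * e"
          using c by (intro mult_left_mono) auto
        then have "(v x - v y)\<^sup>2 \<le> d ^ 3 / w (15/16) * e" using d w_pos by simp
        moreover have "(q y - q x)\<^sup>2 = (v x - v y)\<^sup>2" using 1 by (simp add: q_def power2_commute)
        moreover have "0 \<le> indicator R x * (v x)\<^sup>2 + indicator L y * (v y)\<^sup>2" by simp
        ultimately show ?thesis by (simp only: i mult_1 mult_1_right)
      next
        case 2
        then have "x \<in> R" using xy d by (auto simp: J_def R_def)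
        then show ?thesis using 2 i ce by (simp add: q_def)
      next
        case 3
        then have "y \<in> L" using xy d by (auto simp: J_def L_def)
        then show ?thesis using 3 i ce by (simp add: q_def)
      next
        case 4
        then show ?thesis using i ce by (simp add: q_def)
      qed
    qed
    then show "i (fst p) (snd p) * (q (snd p) - q (fst p))\<^sup>2 \<le> d ^ 3 / w (15/16) * (indicator J (fst p) * k (fst p) (snd p) * (v (fst p) - v (snd p))\<^sup>2)
      + (indicator R (fst p) * i (fst p) (snd p) * (v (fst p))\<^sup>2 + i (fst p) (snd p) * indicator L (snd p) * (v (snd p))\<^sup>2)"
      by (simp add: p e_def)
    have "0 \<le> i x y" using i01[of x y] by auto
    then show "0 \<le> d ^ 3 / w (15/16) * (indicator J (fst p) * k (fst p) (snd p) * (v (fst p) - v (snd p))\<^sup>2)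
      + (indicator R (fst p) * i (fst p) (snd p) * (v (fst p))\<^sup>2 + i (fst p) (snd p) * indicator L (snd p) * (v (snd p))\<^sup>2)"
      using ce by (simp add: p e_def)
  qed
  also have "\<dots> = d ^ 3 / w (15/16) * E + (d / 4 * mass R + d / 4 * mass L)"
    unfolding E_def mR[symmetric] mL[symmetric] using E_integrable intR intL
    by (subst Bochner_Integration.integral_add; (intro Bochner_Integration.integrable_add integrable_mult_right)?; simp)
  also have "\<dots> = d ^ 3 * Z"
    using d w_pos by (simp add: Z_def field_simps power3_eq_cube power2_eq_square)
  finally have "d ^ 3 * mass J \<le> d ^ 3 * (1024 * Z)"
    using 1 by simp
  then have "mass J \<le> 1024 * Z"
    using d by (simp only: mult_le_cancel_left_pos zero_less_power)
  then show ?thesis by (simp add: L_def R_def Z_def)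
qed

text \<open>The row surplus controls the mass of the points within 3/4 d of an end point. The energy
  passes this bound on from [d/2, 3/4 d] to [d, 5/4 d] inside J, and from there back to the gap
  [3/4 d, d]; likewise at the other end. With the outer strips of J bounded, the Poincare estimate
  gives all of J.\<close>

lemma stability:
  assumes A2s: "A2s w d" and A3: "A3 w d"
  shows "(LINT x|lborel. (v x)\<^sup>2)
    \<le> 100000 / w (15/16) * (LINT x|lborel. v x * (a_d w d x * v x - (LINT y|lborel. k x y * v y)))"
proof -
  define e where "e = 1 / w (15/16)"
  have e: "e > 0" using w_pos by (simp add: e_def)
  define Y where "Y = 2 * (LINT x|lborel. v x * (a_d w d x * v x - (LINT y|lborel. k x y * v y)))"
  define B where "B = {x\<in>Om. x \<le> 3/4 * d \<or> 1 - 3/4 * d \<le> x}"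
  have Bm [measurable]: "B \<in> sets borel" unfolding B_def by measurable
  have km [measurable]: "(\<lambda>p. k (fst p) (snd p)) \<in> borel_measurable LL"
    using k_borel by simp
  have km' [measurable]: "(\<lambda>x. LINT y|lborel. \<bar>k x y\<bar>) \<in> borel_measurable borel"
  proof (rule lborel.borel_measurable_lebesgue_integral)
    show "(\<lambda>(x, y). \<bar>k x y\<bar>) \<in> borel_measurable (borel \<Otimes>\<^sub>M lborel)"
      using k_borel unfolding split_beta' by measurable
  qed
  have coercive: "(LINT x|lborel. (a_d w d x - (LINT y|lborel. \<bar>k x y\<bar>)) * (v x)\<^sup>2) + E \<le> Y"
    unfolding E_def Y_def
  proof (rule diagonally_dominant_coercive[OF v_borel v2 v0 km k_bound a_d_borel])
    show "\<bar>a_d w d x\<bar> \<le> w 0 / d ^ 3" for x using a_d_bounds[of x] by simp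
    show "(LINT y|lborel. \<bar>k y x\<bar>) \<le> a_d w d x" if "x \<in> Om" for x by (rule column_sum_le[OF A3 that])
    show "0 \<le> k x y" if "x \<in> J" for x y using that G_bounds by (simp add: k_interior)
  qed auto
  have row0: "0 \<le> a_d w d x - (LINT y|lborel. \<bar>k x y\<bar>)" for x
    using row_surplus(1)[OF A2s, of x] a_d_bounds[of x] by (cases "x \<in> Om") (auto simp: k_def)
  have "w (15/16) / (40 * d\<^sup>2) * mass B \<le> (LINT x|lborel. (a_d w d x - (LINT y|lborel. \<bar>k x y\<bar>)) * (v x)\<^sup>2)"
  proof -
    have "w (15/16) / (40 * d\<^sup>2) * mass B = (LINT x|lborel. w (15/16) / (40 * d\<^sup>2) * (indicator B x * (v x)\<^sup>2))"
      by (simp add: mass_def)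
    also have "\<dots> \<le> (LINT x|lborel. (a_d w d x - (LINT y|lborel. \<bar>k x y\<bar>)) * (v x)\<^sup>2)"
    proof (rule integral_mono)
      show "integrable lborel (\<lambda>x. w (15/16) / (40 * d\<^sup>2) * (indicator B x * (v x)\<^sup>2))"
        by (intro integrable_mult_right integrable_mass) simp
      show "integrable lborel (\<lambda>x. (a_d w d x - (LINT y|lborel. \<bar>k x y\<bar>)) * (v x)\<^sup>2)"
      proof (rule Bochner_Integration.integrable_bound)
        show "integrable lborel (\<lambda>x. w 0 / d ^ 3 * (v x)\<^sup>2)" using v2 by simp
        have "\<bar>a_d w d x - (LINT y|lborel. \<bar>k x y\<bar>)\<bar> \<le> w 0 / d ^ 3" for x
        proof -
          have "0 \<le> (LINT y|lborel. \<bar>k x y\<bar>)" by (intro integral_nonneg_AE AE_I2) auto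
          then show ?thesis using row0[of x] a_d_bounds[of x] by linarith
        qed
        then show "AE x in lborel. norm ((a_d w d x - (LINT y|lborel. \<bar>k x y\<bar>)) * (v x)\<^sup>2) \<le> norm (w 0 / d ^ 3 * (v x)\<^sup>2)"
          using w0_pos d by (intro AE_I2) (simp only: real_norm_def abs_mult, intro mult_right_mono, auto intro: order_trans)
      qed measurable
      show "w (15/16) / (40 * d\<^sup>2) * (indicator B x * (v x)\<^sup>2) \<le> (a_d w d x - (LINT y|lborel. \<bar>k x y\<bar>)) * (v x)\<^sup>2" for x
      proof (cases "x \<in> B")
        case True
        then have "w (15/16) / (40 * d\<^sup>2) \<le> a_d w d x - (LINT y|lborel. \<bar>k x y\<bar>)"
          by (intro row_surplus(2)[OF A2s]) (auto simp: B_def)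
        then show ?thesis using True by (simp only: indicator_simps mult_1, intro mult_right_mono) auto
      next
        case False
        then show ?thesis using row0[of x] by simp
      qed
    qed
    finally show ?thesis .
  qed
  then have "w (15/16) / (40 * d\<^sup>2) * mass B + E \<le> Y" using coercive by linarith
  moreover have "0 \<le> w (15/16) / (40 * d\<^sup>2) * mass B" using w_pos mass_nonneg by simp
  ultimately have EY: "E \<le> Y" and BY: "w (15/16) / (40 * d\<^sup>2) * mass B \<le> Y" using E_nonneg by linarith+
  have Y: "0 \<le> Y" using EY E_nonneg by linarith
  have mB: "mass B \<le> 40 * d\<^sup>2 * e * Y"
    using BY d w_pos by (simp add: e_def field_simps)
  have eE: "8 * d\<^sup>2 / w (15/16) * E \<le> 8 * d\<^sup>2 * e * Y"
    using mult_left_mono[OF EY, of "8 * d\<^sup>2 * e"] e by (simp add: e_def)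
  \<comment> \<open>88 = 2 * 40 + 8, where 40 comes from the row surplus. In the same way the gap
    strips get 184 = 2 * 88 + 8, and J gets 46080 = 1024 * (1 + 44) with 44 = 2 * 88 / 4.\<close>
  have L: "mass {d..5/4 * d} \<le> 88 * d\<^sup>2 * e * Y"
  proof -
    have "mass {d..5/4 * d} \<le> 2 * mass {1/2 * d..3/4 * d} + 8 * d\<^sup>2 / w (15/16) * E"
      by (rule energy_close_sets) (use d d4 in \<open>auto simp: J_def Om_def\<close>)
    moreover have "mass {1/2 * d..3/4 * d} \<le> mass B"
      by (rule mass_mono) (use d d4 Bm in \<open>auto simp: B_def Om_def\<close>)
    ultimately show ?thesis using mB eE by linarith
  qed
  have R: "mass {1 - 5/4 * d..1 - d} \<le> 88 * d\<^sup>2 * e * Y"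
  proof -
    have "mass {1 - 5/4 * d..1 - d} \<le> 2 * mass {1 - 3/4 * d..1 - 1/2 * d} + 8 * d\<^sup>2 / w (15/16) * E"
      by (rule energy_close_sets) (use d d4 in \<open>auto simp: J_def Om_def\<close>)
    moreover have "mass {1 - 3/4 * d..1 - 1/2 * d} \<le> mass B"
      by (rule mass_mono) (use d d4 Bm in \<open>auto simp: B_def Om_def\<close>)
    ultimately show ?thesis using mB eE by linarith
  qed
  have L': "mass {3/4 * d..d} \<le> 184 * d\<^sup>2 * e * Y"
  proof -
    have "mass {3/4 * d..d} \<le> 2 * mass {d..5/4 * d} + 8 * d\<^sup>2 / w (15/16) * E"
      by (rule energy_close_sets) (use d d4 in \<open>auto simp: J_def Om_def\<close>)
    then show ?thesis using L eE by linarith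
  qed
  have R': "mass {1 - d..1 - 3/4 * d} \<le> 184 * d\<^sup>2 * e * Y"
  proof -
    have "mass {1 - d..1 - 3/4 * d} \<le> 2 * mass {1 - 5/4 * d..1 - d} + 8 * d\<^sup>2 / w (15/16) * E"
      by (rule energy_close_sets) (use d d4 in \<open>auto simp: J_def Om_def\<close>)
    then show ?thesis using R eE by linarith
  qed
  define Z where "Z = (mass {d..5/4 * d} + mass {1 - 5/4 * d..1 - d}) / (4 * d\<^sup>2)"
  have "Z \<le> (176 * d\<^sup>2 * e * Y) / (4 * d\<^sup>2)"
    unfolding Z_def using L R by (intro divide_right_mono) auto
  also have "\<dots> = 44 * (e * Y)" using d by simp
  finally have "Z \<le> 44 * (e * Y)" .
  moreover have "E / w (15/16) \<le> e * Y"
    using mult_left_mono[OF EY less_imp_le[OF e]] by (simp add: e_def)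
  ultimately have "1024 * (E / w (15/16) + Z) \<le> 1024 * (e * Y + 44 * (e * Y))"
    by (intro mult_left_mono add_mono) auto
  from order_trans[OF mass_interior_le[folded Z_def] this]
  have mJ: "mass J \<le> 46080 * (e * Y)" by (simp add: algebra_simps)
  have "d\<^sup>2 \<le> (1/4)\<^sup>2" using d d4 by (intro power_mono) auto
  then have "d\<^sup>2 * (e * Y) \<le> 1/16 * (e * Y)"
    using e Y by (intro mult_right_mono) (auto simp: power2_eq_square)
  moreover have "0 \<le> e * Y" using e Y by simp
  moreover have "(LINT x|lborel. (v x)\<^sup>2) = mass Om"
    unfolding mass_def using v0 by (intro Bochner_Integration.integral_cong) (auto simp: indicator_def)
  moreover have "mass Om \<le> mass ((J \<union> B) \<union> ({3/4 * d..d} \<union> {1 - d..1 - 3/4 * d}))"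
    by (rule mass_mono) (auto simp: J_def B_def)
  moreover have "\<dots> \<le> (mass J + mass B) + (mass {3/4 * d..d} + mass {1 - d..1 - 3/4 * d})"
    by (rule order_trans[OF mass_Un_le add_mono[OF mass_Un_le mass_Un_le]]) auto
  \<comment> \<open>As d^2 \<le> 1/16, the terms 40 + 2 * 184 add less than 26 to 46080, so 50000
    suffices; the factor 2 inside Y makes it 100000.\<close>
  ultimately have "(LINT x|lborel. (v x)\<^sup>2) \<le> 50000 * (e * Y)"
    using mB mJ L' R' by (simp add: mult.assoc)
  then show ?thesis by (simp add: e_def Y_def)
qed

end

subsection \<open>Consistency\<close>

text \<open>The Lagrange remainder with its factor 1 / n! dropped, since only the order in |x - c|
  matters for consistency. The centre is the evaluation point in the interior and the nearby end
  point in the boundary layers.\<close>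

lemma poly_Taylor:
  fixes z :: "real poly"
  assumes "x \<in> {0..1}" "c \<in> {0..1}" "0 < n"
    and M: "\<And>t. t \<in> {0..1} \<Longrightarrow> \<bar>poly ((pderiv ^^ n) z) t\<bar> \<le> M"
  shows "\<bar>poly z x - (\<Sum>m<n. poly ((pderiv ^^ m) z) c / fact m * (x - c) ^ m)\<bar> \<le> M * \<bar>x - c\<bar> ^ n"
proof -
  have M0: "0 \<le> M" by (rule order_trans[OF abs_ge_zero M[of 0]]) simp
  show ?thesis
  proof (cases "x = c")
    case True
    have "(\<Sum>m<n. poly ((pderiv ^^ m) z) c / fact m * (x - c) ^ m) = (\<Sum>m<n. if m = 0 then poly z c else 0)"
      by (rule sum.cong) (auto simp: True)
    also have "\<dots> = poly z c" using \<open>0 < n\<close> by simp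
    finally show ?thesis using M0 True by simp
  next
    case False
    have "\<exists>t. (if x < c then x < t \<and> t < c else c < t \<and> t < x) \<and>
        poly z x = (\<Sum>m<n. poly ((pderiv ^^ m) z) c / fact m * (x - c) ^ m) + poly ((pderiv ^^ n) z) t / fact n * (x - c) ^ n"
      by (rule Taylor[of n "\<lambda>m. poly ((pderiv ^^ m) z)" "poly z" 0 1]) (use assms False in auto)
    then obtain t where "if x < c then x < t \<and> t < c else c < t \<and> t < x"
      and eq: "poly z x = (\<Sum>m<n. poly ((pderiv ^^ m) z) c / fact m * (x - c) ^ m) + poly ((pderiv ^^ n) z) t / fact n * (x - c) ^ n"
      by blast
    then have t: "t \<in> {0..1}" using assms(1,2) by (auto split: if_splits)
    have "\<bar>poly ((pderiv ^^ n) z) t / fact n\<bar> \<le> M"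
    proof -
      have "\<bar>poly ((pderiv ^^ n) z) t / fact n\<bar> \<le> M / 1"
        unfolding abs_divide by (rule frac_le) (use M[OF t] M0 in auto)
      then show ?thesis by simp
    qed
    from mult_right_mono[OF this, of "\<bar>x - c\<bar> ^ n"] show ?thesis
      unfolding eq by (simp add: abs_mult power_abs)
  qed
qed

section \<open>Moments of the kernel and the operator on polynomials\<close>

context nonlocal_kernel
begin

lemma integrable_G_moment: "integrable lborel (\<lambda>s. G s * s ^ n)"
proof (rule integrable_bounded_support[where B = "w 0 / d ^ 3" and a = "-1" and b = 1])
  fix s
  show "\<bar>G s * s ^ n\<bar> \<le> w 0 / d ^ 3 * indicator {-1..1} s"
  proof (cases "\<bar>s\<bar> \<le> 1")
    case True
    then have "\<bar>s\<bar> ^ n \<le> 1" by (intro power_le_one) auto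
    then have "G s * \<bar>s\<bar> ^ n \<le> w 0 / d ^ 3 * 1"
      using G_bounds[of s] w0_pos d by (intro mult_mono) auto
    then show ?thesis using True G_bounds[of s] by (simp add: abs_mult power_abs abs_le_iff)
  next
    case False
    then have "G s = 0" using d by (intro G_eq_0) auto
    then show ?thesis using False w0_pos d by simp
  qed
qed measurable

lemma G_first_moment: "(LINT s|lborel. G s * s) = 0"
proof -
  have "(LINT s|lborel. G s * s) = (LINT s|lborel. G (0 + (- 1) * s) * (0 + (- 1) * s))"
    by (subst lborel_integral_real_affine[of "-1" _ 0]) simp_all
  also have "\<dots> = - (LINT s|lborel. G s * s)" by (simp add: G_minus)
  finally show ?thesis by simp
qed

text \<open>The power d^3 in the kernel is the one that makes the second moment independent of d:
  under the scaling of s by d, one factor comes from the measure and two from s^2. The value 2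
  cancels the 1/2 in Taylor's formula, so the limit operator is -u''.\<close>

lemma G_second_moment: "(LINT s|lborel. G s * s\<^sup>2) = 2"
proof -
  have W2: "(LINT z|lborel. W w z * z\<^sup>2) = 2"
    using A1 W_abs by (simp add: A1_def has_bochner_integral_iff)
  have "(LINT s|lborel. G s * s\<^sup>2) = \<bar>d\<bar> *\<^sub>R (LINT s|lborel. G (0 + d * s) * (0 + d * s)\<^sup>2)"
    using d by (intro lborel_integral_real_affine) simp
  also have "(\<lambda>s. G (0 + d * s) * (0 + d * s)\<^sup>2) = (\<lambda>s. W w s * s\<^sup>2 / d)"
    using d by (auto simp: G_def power2_eq_square power3_eq_cube)
  finally show ?thesis using d W2 by simp
qed

text \<open>By oddness the full first moment is zero, so cutting off s \<ge> t leaves minus the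
  moment that was removed. For a linear function at distance t from an end point this is the effect
  of the missing part of the window.\<close>

lemma G_tail_moment: "0 < t \<Longrightarrow> (LINT s|lborel. indicator {..<t} s * (G s * s)) = - mom t"
proof -
  assume t: "0 < t"
  have i: "integrable lborel (\<lambda>s. G s * s)" using integrable_G_moment[of 1] by simp
  have "(LINT s|lborel. indicator {..<t} s * (G s * s)) = (LINT s|lborel. G s * s - (if t \<le> s \<and> s \<le> d then s * G s else 0))"
    using G_eq_0 by (intro Bochner_Integration.integral_cong) (auto simp: indicator_def)
  also have "\<dots> = - mom t"
    using i mom_integrable[of t] t G_first_moment by (simp add: mom_def)
  finally show ?thesis .
qed

text \<open>Absorbing \<open>a_d\<close> times u(x) into the integral leaves differences u(x) - u(y)
  against the kernel, plus a correction that integrates u itself over the window and is present only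
  in the boundary layers.\<close>

lemma N_d_eq:
  assumes u [measurable]: "u \<in> borel_measurable borel" and B: "\<And>y. y \<in> Om \<Longrightarrow> \<bar>u y\<bar> \<le> B"
  shows "N_d w d u x = (LINT y|lborel. indicator Om y * (G (x - y) * (u x - u y)))
    + b_d w d x * (LINT y|lborel. indicator Om y * (indicator {x - d..x + d} y * u y))"
proof -
  have K: "(\<lambda>y. K_d w d x y) \<in> borel_measurable borel"
    using measurable_compose[OF _ K_d_borel, of "\<lambda>y. (x, y)" borel] by simp
  have 1: "integrable lborel (\<lambda>y. indicator Om y * G (x - y))"
    using G_bounds by (intro integrable_indicator_Om[where C = "w 0 / d ^ 3"]) auto
  have B0: "0 \<le> B" using B[of "1/2"] by (simp add: Om_def)
  have 2: "integrable lborel (\<lambda>y. indicator Om y * (G (x - y) * u y))"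
  proof (rule integrable_bounded_support[where a = 0 and b = 1 and B = "w 0 / d ^ 3 * B"])
    show "\<bar>indicator Om y * (G (x - y) * u y)\<bar> \<le> w 0 / d ^ 3 * B * indicator {0..1} y" for y
    proof (cases "y \<in> Om")
      case True
      then have "G (x - y) * \<bar>u y\<bar> \<le> w 0 / d ^ 3 * B"
        using G_bounds[of "x - y"] B B0 by (intro mult_mono) auto
      then show ?thesis using True G_bounds[of "x - y"] by (simp add: abs_mult Om_def)
    next
      case False
      then show ?thesis using B0 w0_pos d by simp
    qed
  qed measurable
  have 3: "integrable lborel (\<lambda>y. indicator Om y * (indicator {x - d..x + d} y * u y))"
    by (rule integrable_bounded_support[where a = 0 and b = 1 and B = B])
      (use B B0 in \<open>auto simp: indicator_def Om_def\<close>)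
  have "Lint_on Om (\<lambda>y. u y * K_d w d x y) = (LINT y|lborel. indicator Om y * (u y * K_d w d x y))"
    using K by (intro lebesgue_on_eq_lborel(2)) measurable
  then have "N_d w d u x = a_d w d x * u x - (LINT y|lborel. indicator Om y * (u y * K_d w d x y))"
    by (simp add: N_d_def)
  also have "(LINT y|lborel. indicator Om y * (u y * K_d w d x y))
      = (LINT y|lborel. indicator Om y * (G (x - y) * u y) - b_d w d x * (indicator Om y * (indicator {x - d..x + d} y * u y)))"
    by (intro Bochner_Integration.integral_cong) (auto simp: K_d_eq algebra_simps)
  also have "\<dots> = (LINT y|lborel. indicator Om y * (G (x - y) * u y)) - b_d w d x * (LINT y|lborel. indicator Om y * (indicator {x - d..x + d} y * u y))"
    using 2 3 by simp
  also have "a_d w d x * u x = (LINT y|lborel. u x * (indicator Om y * G (x - y)))"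
    by (simp add: a_d_eq)
  also have "(LINT y|lborel. u x * (indicator Om y * G (x - y)))
      - ((LINT y|lborel. indicator Om y * (G (x - y) * u y)) - b_d w d x * (LINT y|lborel. indicator Om y * (indicator {x - d..x + d} y * u y)))
      = (LINT y|lborel. u x * (indicator Om y * G (x - y)) - indicator Om y * (G (x - y) * u y)) + b_d w d x * (LINT y|lborel. indicator Om y * (indicator {x - d..x + d} y * u y))"
    using 1 2 by simp
  also have "(LINT y|lborel. u x * (indicator Om y * G (x - y)) - indicator Om y * (G (x - y) * u y)) = (LINT y|lborel. indicator Om y * (G (x - y) * (u x - u y)))"
    by (intro Bochner_Integration.integral_cong) (auto simp: algebra_simps)
  finally show ?thesis .
qed

lemma N_d_add:
  assumes [measurable]: "u \<in> borel_measurable borel" "v \<in> borel_measurable borel"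
    and B: "\<And>y. y \<in> Om \<Longrightarrow> \<bar>u y\<bar> \<le> B" "\<And>y. y \<in> Om \<Longrightarrow> \<bar>v y\<bar> \<le> B'"
  shows "N_d w d (\<lambda>x. u x + v x) x = N_d w d u x + N_d w d v x"
proof -
  have K: "(\<lambda>y. K_d w d x y) \<in> borel_measurable borel"
    using measurable_compose[OF _ K_d_borel, of "\<lambda>y. (x, y)" borel] by simp
  have "integrable LOm (\<lambda>y. f y * K_d w d x y)"
    if [measurable]: "f \<in> borel_measurable borel" and f: "\<And>y. y \<in> Om \<Longrightarrow> \<bar>f y\<bar> \<le> C" for f C
  proof (rule integrable_LOm_bounded[where B = "C * (5 * w 0 / d ^ 3)"])
    show "(\<lambda>y. f y * K_d w d x y) \<in> borel_measurable LOm"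
      using K by (intro borel_measurable_LOm) measurable
    show "\<bar>f y * K_d w d x y\<bar> \<le> C * (5 * w 0 / d ^ 3)" if "y \<in> Om" for y
      unfolding abs_mult using f[OF that] K_d_bound[of x y] by (intro mult_mono) auto
  qed
  from this[OF _ B(1)] this[OF _ B(2)] show ?thesis
    by (simp add: N_d_def algebra_simps)
qed

text \<open>The window has length 2 d and the kernel is at most w(0) / d^3, so differences of size 2
  C d^2 contribute 4 w(0) C. The correction contributes at most 4 w(0) / d^3 times 2 d times C d^2,
  which is 8 w(0) C. Values of order d^2 near x thus give a bound independent of d.\<close>

lemma N_d_boundary_bound:
  assumes R [measurable]: "R \<in> borel_measurable borel" and B: "\<And>y. y \<in> Om \<Longrightarrow> \<bar>R y\<bar> \<le> B"
    and C: "\<And>y. y \<in> Om \<Longrightarrow> \<bar>y - x\<bar> \<le> d \<Longrightarrow> \<bar>R y\<bar> \<le> C * d\<^sup>2" and x: "x \<in> Om"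
  shows "\<bar>N_d w d R x\<bar> \<le> 12 * w 0 * C"
proof -
  have Cd: "0 \<le> C * d\<^sup>2" using C[OF x] d by (auto intro: order_trans[OF abs_ge_zero])
  have I: "integrable lborel (\<lambda>y. c * indicator {x - d..x + d} y :: real)" for c
    by (intro integrable_mult_right integrable_indicator_Icc)
  have 1: "\<bar>LINT y|lborel. indicator Om y * (G (x - y) * (R x - R y))\<bar> \<le> (LINT y|lborel. w 0 / d ^ 3 * (2 * (C * d\<^sup>2)) * indicator {x - d..x + d} y)"
  proof (rule order_trans[OF integral_abs_bound integral_mono'[OF I]])
    fix y
    show "\<bar>indicator Om y * (G (x - y) * (R x - R y))\<bar> \<le> w 0 / d ^ 3 * (2 * (C * d\<^sup>2)) * indicator {x - d..x + d} y"
    proof (cases "y \<in> Om \<and> \<bar>y - x\<bar> \<le> d")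
      case True
      then have "\<bar>R x - R y\<bar> \<le> 2 * (C * d\<^sup>2)" using C[of y] C[of x] x d by auto
      then have "G (x - y) * \<bar>R x - R y\<bar> \<le> w 0 / d ^ 3 * (2 * (C * d\<^sup>2))"
        using G_bounds[of "x - y"] w0_pos d by (intro mult_mono) auto
      moreover have "y \<in> {x - d..x + d}" using True by auto
      ultimately show ?thesis using True G_bounds[of "x - y"] by (simp add: abs_mult)
    next
      case False
      then have zero: "indicator Om y * (G (x - y) * (R x - R y)) = 0" using G_eq_0[of "x - y"] by auto
      show ?thesis unfolding zero using w0_pos d Cd by simp
    qed
    show "0 \<le> w 0 / d ^ 3 * (2 * (C * d\<^sup>2)) * indicator {x - d..x + d} y" using w0_pos d Cd by simp
  qed
  have "(LINT y|lborel. w 0 / d ^ 3 * (2 * (C * d\<^sup>2)) * indicator {x - d..x + d} y) = 4 * w 0 * C"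
    using d by (simp add: power2_eq_square power3_eq_cube)
  with 1 have 1: "\<bar>LINT y|lborel. indicator Om y * (G (x - y) * (R x - R y))\<bar> \<le> 4 * w 0 * C" by simp
  have 2: "\<bar>LINT y|lborel. indicator Om y * (indicator {x - d..x + d} y * R y)\<bar> \<le> (LINT y|lborel. C * d\<^sup>2 * indicator {x - d..x + d} y)"
  proof (rule order_trans[OF integral_abs_bound integral_mono'[OF I]])
    fix y
    show "\<bar>indicator Om y * (indicator {x - d..x + d} y * R y)\<bar> \<le> C * d\<^sup>2 * indicator {x - d..x + d} y"
      using C[of y] Cd by (cases "y \<in> Om \<and> y \<in> {x - d..x + d}") (auto simp: indicator_def)
    show "0 \<le> C * d\<^sup>2 * indicator {x - d..x + d} y" using Cd by simp
  qed
  have "b_d w d x * \<bar>LINT y|lborel. indicator Om y * (indicator {x - d..x + d} y * R y)\<bar> \<le> 4 * w 0 / d ^ 3 * (2 * d * (C * d\<^sup>2))"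
  proof (rule mult_mono)
    show "\<bar>LINT y|lborel. indicator Om y * (indicator {x - d..x + d} y * R y)\<bar> \<le> 2 * d * (C * d\<^sup>2)"
      using 2 d by (simp add: mult_ac)
  qed (use b_d_bounds w0_pos d in auto)
  also have "\<dots> = 8 * w 0 * C" using d by (simp add: power2_eq_square power3_eq_cube)
  finally have 3: "\<bar>b_d w d x * (LINT y|lborel. indicator Om y * (indicator {x - d..x + d} y * R y))\<bar> \<le> 8 * w 0 * C"
    using b_d_bounds(1)[of x] by (simp add: abs_mult)
  show ?thesis
    using N_d_eq[of R B x, OF R B] 1 3 by linarith
qed

text \<open>The part of the window beyond 0 is missing, so the difference term leaves -m times
  \<open>mom x\<close>. The correction is \<open>b_d\<close> times the integral of m y over
  [0, x + d], that is m (x + d)^2 / 2; the prefactor 2 / (x + d)^2 of \<open>b_d\<close> makes the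
  two cancel.\<close>

lemma N_d_linear_left:
  assumes x: "0 < x" "x < d"
  shows "N_d w d (\<lambda>y. m * y) x = 0"
proof -
  have N: "N_d w d (\<lambda>y. m * y) x = (LINT y|lborel. indicator Om y * (G (x - y) * (m * x - m * y)))
    + b_d w d x * (LINT y|lborel. indicator Om y * (indicator {x - d..x + d} y * (m * y)))"
    by (rule N_d_eq[where B = "\<bar>m\<bar>"]) (auto simp: Om_def abs_mult intro!: mult_left_le)
  have "(LINT y|lborel. indicator Om y * (G (x - y) * (m * x - m * y)))
      = (LINT s|lborel. indicator Om (x + (- 1) * s) * (G (x - (x + (- 1) * s)) * (m * x - m * (x + (- 1) * s))))"
    by (subst lborel_integral_real_affine[of "-1" _ x]) simp_all
  also have "\<dots> = (LINT s|lborel. m * (indicator {..<x} s * (G s * s)))"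
  proof (rule Bochner_Integration.integral_cong)
    fix s
    show "indicator Om (x + (- 1) * s) * (G (x - (x + (- 1) * s)) * (m * x - m * (x + (- 1) * s))) = m * (indicator {..<x} s * (G s * s))"
      using x d G_eq_0[of s] by (cases "\<bar>s\<bar> < d") (auto simp: Om_def indicator_def algebra_simps)
  qed simp
  also have "\<dots> = - (m * mom x)" using G_tail_moment[of x] x by simp
  finally have 1: "(LINT y|lborel. indicator Om y * (G (x - y) * (m * x - m * y))) = - (m * mom x)" .
  have "(LINT y|lborel. indicator Om y * (indicator {x - d..x + d} y * (m * y))) = (LINT y|lborel. (m * y) * indicator {0..x + d} y)"
    using x d by (intro Bochner_Integration.integral_cong) (auto simp: indicator_def Om_def)
  also have "\<dots> = m * (x + d)\<^sup>2 / 2 - m * 0\<^sup>2 / 2"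
    using x d by (intro integral_FTC_Icc_real[where F = "\<lambda>y. m * y\<^sup>2 / 2"]) (auto intro!: derivative_eq_intros)
  finally have 2: "(LINT y|lborel. indicator Om y * (indicator {x - d..x + d} y * (m * y))) = m * (x + d)\<^sup>2 / 2" by simp
  have "b_d w d x = 2 / (x + d)\<^sup>2 * mom x" using x d by (simp add: b_d_eq beta_def)
  then have "b_d w d x * (m * (x + d)\<^sup>2 / 2) = m * mom x" using x d by simp
  then show ?thesis unfolding N 1 2 by simp
qed

lemma N_d_linear_right:
  assumes x: "1 - d < x" "x < 1"
  shows "N_d w d (\<lambda>y. m * (1 - y)) x = 0"
proof -
  have N: "N_d w d (\<lambda>y. m * (1 - y)) x = (LINT y|lborel. indicator Om y * (G (x - y) * (m * (1 - x) - m * (1 - y))))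
    + b_d w d x * (LINT y|lborel. indicator Om y * (indicator {x - d..x + d} y * (m * (1 - y))))"
    by (rule N_d_eq[where B = "\<bar>m\<bar>"]) (auto simp: Om_def abs_mult intro!: mult_left_le)
  have "(LINT y|lborel. indicator Om y * (G (x - y) * (m * (1 - x) - m * (1 - y))))
      = (LINT s|lborel. indicator Om (x + 1 * s) * (G (x - (x + 1 * s)) * (m * (1 - x) - m * (1 - (x + 1 * s)))))"
    by (subst lborel_integral_real_affine[of 1 _ x]) simp_all
  also have "\<dots> = (LINT s|lborel. m * (indicator {..<1 - x} s * (G s * s)))"
  proof (rule Bochner_Integration.integral_cong)
    fix s
    show "indicator Om (x + 1 * s) * (G (x - (x + 1 * s)) * (m * (1 - x) - m * (1 - (x + 1 * s)))) = m * (indicator {..<1 - x} s * (G s * s))"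
      using x d G_eq_0[of s] by (cases "\<bar>s\<bar> < d") (auto simp: Om_def indicator_def algebra_simps G_minus)
  qed simp
  also have "\<dots> = - (m * mom (1 - x))" using G_tail_moment[of "1 - x"] x by simp
  finally have 1: "(LINT y|lborel. indicator Om y * (G (x - y) * (m * (1 - x) - m * (1 - y)))) = - (m * mom (1 - x))" .
  have "(LINT y|lborel. indicator Om y * (indicator {x - d..x + d} y * (m * (1 - y)))) = (LINT y|lborel. (m * (1 - y)) * indicator {x - d..1} y)"
    using x d by (intro Bochner_Integration.integral_cong) (auto simp: indicator_def Om_def)
  also have "\<dots> = - (m * (1 - 1)\<^sup>2 / 2) - - (m * (1 - (x - d))\<^sup>2 / 2)"
    using x d by (intro integral_FTC_Icc_real[where F = "\<lambda>y. - (m * (1 - y)\<^sup>2 / 2)"]) (auto intro!: derivative_eq_intros simp: field_simps)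
  finally have 2: "(LINT y|lborel. indicator Om y * (indicator {x - d..x + d} y * (m * (1 - y)))) = m * (1 - x + d)\<^sup>2 / 2"
    by (simp add: algebra_simps)
  have "b_d w d x = 2 / (1 - x + d)\<^sup>2 * mom (1 - x)" using x d by (simp add: b_d_eq beta_def)
  then have "b_d w d x * (m * (1 - x + d)\<^sup>2 / 2) = m * mom (1 - x)" using x d by simp
  then show ?thesis unfolding N 1 2 by simp
qed

text \<open>Expanding around x, the vanishing first moment removes the z' term and the second moment
  turns the quadratic term into -z''. The remainder is at most M |x - y|^3 \<le> M d (x - y)^2
  within the window, and the second moment 2 makes its integral at most 2 M d.\<close>

lemma N_d_poly_interior:
  assumes M: "\<And>t. t \<in> {0..1} \<Longrightarrow> \<bar>poly ((pderiv ^^ 3) z) t\<bar> \<le> M" and x: "d \<le> x" "x \<le> 1 - d"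
  shows "\<bar>N_d w d (poly z) x + poly (pderiv (pderiv z)) x\<bar> \<le> 2 * M * d"
proof -
  let ?z1 = "poly (pderiv z) x" and ?z2 = "poly (pderiv (pderiv z)) x"
  have M0: "0 \<le> M" by (rule order_trans[OF abs_ge_zero M[of 0]]) simp
  have "bounded (poly z ` {0..1})"
    by (intro compact_imp_bounded compact_continuous_image continuous_intros) auto
  then obtain B where B: "\<forall>y\<in>{0..1}. \<bar>poly z y\<bar> \<le> B" unfolding bounded_iff by auto
  have zm [measurable]: "poly z \<in> borel_measurable borel"
    by (intro borel_measurable_continuous_onI continuous_intros)
  have N: "N_d w d (poly z) x = (LINT y|lborel. indicator Om y * (G (x - y) * (poly z x - poly z y)))"
    using N_d_eq[of "poly z" B x, OF zm] B x d by (simp add: Om_def b_d_eq beta_def)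
  define r where "r y = poly z x - poly z y + ?z1 * (y - x) + ?z2 / 2 * (y - x)\<^sup>2" for y
  have r_bound: "\<bar>r y\<bar> \<le> M * \<bar>y - x\<bar> ^ 3" if "y \<in> {0..1}" for y
  proof -
    have "(\<Sum>m<3. poly ((pderiv ^^ m) z) x / fact m * (y - x) ^ m) = poly z x + ?z1 * (y - x) + ?z2 / 2 * (y - x)\<^sup>2"
      by (simp add: eval_nat_numeral lessThan_Suc)
    then have "r y = - (poly z y - (\<Sum>m<3. poly ((pderiv ^^ m) z) x / fact m * (y - x) ^ m))"
      by (simp add: r_def)
    then show ?thesis
      using poly_Taylor[OF that _ _ M, of x] x d by (simp only: abs_minus_cancel) simp
  qed
  have rm [measurable]: "r \<in> borel_measurable borel"
    unfolding r_def by measurable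
  have Gr_bound: "\<bar>G (x - y) * (indicator Om y * r y)\<bar> \<le> M * d * (G (x - y) * (x - y)\<^sup>2)" for y
  proof (cases "\<bar>x - y\<bar> < d \<and> y \<in> Om")
    case True
    then have "\<bar>r y\<bar> \<le> M * \<bar>y - x\<bar> ^ 3" by (intro r_bound) (auto simp: Om_def)
    also have "\<dots> = M * \<bar>x - y\<bar> * (x - y)\<^sup>2" by (simp add: power3_eq_cube power2_eq_square abs_minus_commute abs_mult_self)
    also have "\<dots> \<le> M * d * (x - y)\<^sup>2" using True M0 by (intro mult_right_mono mult_left_mono) auto
    finally have "G (x - y) * \<bar>r y\<bar> \<le> G (x - y) * (M * d * (x - y)\<^sup>2)"
      using G_bounds by (intro mult_left_mono) auto
    then show ?thesis using True G_bounds[of "x - y"] by (simp add: abs_mult mult_ac)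
  next
    case False
    then have zero: "G (x - y) * (indicator Om y * r y) = 0" using G_eq_0[of "x - y"] by auto
    show ?thesis unfolding zero using M0 d G_bounds[of "x - y"] by simp
  qed
  have shift: "integrable lborel (\<lambda>y. G (x - y) * (x - y) ^ n)"
    "(LINT y|lborel. G (x - y) * (x - y) ^ n) = (LINT s|lborel. G s * s ^ n)" for n
  proof -
    show "integrable lborel (\<lambda>y. G (x - y) * (x - y) ^ n)"
      using lborel_integrable_real_affine[OF integrable_G_moment[of n], of "-1" x] by simp
    show "(LINT y|lborel. G (x - y) * (x - y) ^ n) = (LINT s|lborel. G s * s ^ n)"
      using lborel_integral_real_affine[of "-1" "\<lambda>s. G s * s ^ n" x] by simp
  qed
  have intr: "integrable lborel (\<lambda>y. G (x - y) * (indicator Om y * r y))"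
  proof (rule Bochner_Integration.integrable_bound)
    show "integrable lborel (\<lambda>y. M * d * (G (x - y) * (x - y)\<^sup>2))" using shift(1)[of 2] by simp
    show "AE y in lborel. norm (G (x - y) * (indicator Om y * r y)) \<le> norm (M * d * (G (x - y) * (x - y)\<^sup>2))"
      using Gr_bound by (intro AE_I2) (auto intro: order_trans abs_ge_self)
  qed measurable
  have "N_d w d (poly z) x = (LINT y|lborel. G (x - y) * (indicator Om y * r y) + (?z1 * (G (x - y) * (x - y) ^ 1) - ?z2 / 2 * (G (x - y) * (x - y) ^ 2)))"
    unfolding N
  proof (rule Bochner_Integration.integral_cong)
    fix y
    show "indicator Om y * (G (x - y) * (poly z x - poly z y)) = G (x - y) * (indicator Om y * r y) + (?z1 * (G (x - y) * (x - y) ^ 1) - ?z2 / 2 * (G (x - y) * (x - y) ^ 2))"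
    \<comment> \<open>In the interior the whole open window lies in Om, so the indicator may be
      dropped from the moment terms.\<close>
    proof (cases "\<bar>x - y\<bar> < d")
      case True
      then have "y \<in> Om" using x by (auto simp: Om_def)
      then show ?thesis by (simp add: r_def power2_eq_square algebra_simps)
    next
      case False
      then have "G (x - y) = 0" by (intro G_eq_0) auto
      then show ?thesis by simp
    qed
  qed simp
  also have "\<dots> = (LINT y|lborel. G (x - y) * (indicator Om y * r y)) + (?z1 * (LINT s|lborel. G s * s ^ 1) - ?z2 / 2 * (LINT s|lborel. G s * s ^ 2))"
    using intr shift(1)[of 1] shift(1)[of 2] shift(2)[of 1] shift(2)[of 2]
    by (simp del: power_one_right)
  also have "\<dots> = (LINT y|lborel. G (x - y) * (indicator Om y * r y)) - ?z2"
    using G_first_moment G_second_moment by simp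
  finally have "N_d w d (poly z) x + ?z2 = (LINT y|lborel. G (x - y) * (indicator Om y * r y))" by simp
  also have "\<bar>\<dots>\<bar> \<le> (LINT y|lborel. M * d * (G (x - y) * (x - y)\<^sup>2))"
  proof (rule order_trans[OF integral_abs_bound integral_mono'])
    show "integrable lborel (\<lambda>y. M * d * (G (x - y) * (x - y)\<^sup>2))" using shift(1)[of 2] by simp
    show "0 \<le> M * d * (G (x - y) * (x - y)\<^sup>2)" for y using M0 d G_bounds[of "x - y"] by simp
  qed (use Gr_bound in auto)
  also have "\<dots> = 2 * M * d" using shift(2)[of 2] G_second_moment by simp
  finally show ?thesis .
qed

text \<open>Because z vanishes at the nearby end point, its tangent line there is a multiple of y or
  of 1 - y, which \<open>N_d\<close> annihilates. What remains is at most M (2 d)^2 on the window,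
  and 12 * 4 = 48.\<close>

lemma N_d_poly_boundary:
  assumes M: "\<And>t. t \<in> {0..1} \<Longrightarrow> \<bar>poly ((pderiv ^^ 2) z) t\<bar> \<le> M"
    and z: "poly z 0 = 0" "poly z 1 = 0" and x: "x \<in> Om" "x < d \<or> 1 - d < x"
  shows "\<bar>N_d w d (poly z) x\<bar> \<le> 48 * w 0 * M"
proof -
  have M0: "0 \<le> M" by (rule order_trans[OF abs_ge_zero M[of 0]]) simp
  have bounded_R: "\<exists>B. \<forall>y\<in>Om. \<bar>R y\<bar> \<le> B" if "continuous_on {0..1} R" for R :: "real \<Rightarrow> real"
  proof -
    have "bounded (R ` {0..1})" using that by (intro compact_imp_bounded compact_continuous_image) auto
    then obtain B where "\<forall>y\<in>{0..1}. \<bar>R y\<bar> \<le> B" unfolding bounded_iff by auto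
    then show ?thesis by (intro exI[of _ B]) (auto simp: Om_def)
  qed
  have key: "\<bar>N_d w d (poly z) x\<bar> \<le> 48 * w 0 * M"
    if l: "N_d w d l x = 0" and lc: "continuous_on UNIV l"
      and R: "\<And>y. y \<in> Om \<Longrightarrow> \<bar>y - x\<bar> \<le> d \<Longrightarrow> \<bar>poly z y - l y\<bar> \<le> 4 * M * d\<^sup>2" for l
  proof -
    have lm: "l \<in> borel_measurable borel" "(\<lambda>y. poly z y - l y) \<in> borel_measurable borel"
      using lc by (auto intro!: borel_measurable_continuous_onI continuous_intros)
    have lc': "continuous_on {0..1} l" using lc by (rule continuous_on_subset) auto
    obtain B1 where B1: "\<forall>y\<in>Om. \<bar>l y\<bar> \<le> B1" using bounded_R[OF lc'] by blast
    have "continuous_on {0..1} (\<lambda>y. poly z y - l y)" by (intro continuous_intros lc')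
    then obtain B2 where B2: "\<forall>y\<in>Om. \<bar>poly z y - l y\<bar> \<le> B2" using bounded_R by blast
    have "N_d w d (\<lambda>y. l y + (poly z y - l y)) x = N_d w d l x + N_d w d (\<lambda>y. poly z y - l y) x"
      by (rule N_d_add[OF lm, of B1 B2]) (use B1 B2 in auto)
    then have "N_d w d (poly z) x = N_d w d (\<lambda>y. poly z y - l y) x" using l by simp
    also have "\<bar>\<dots>\<bar> \<le> 12 * w 0 * (4 * M)"
      by (rule N_d_boundary_bound[OF lm(2) _ R x(1)]) (use B2 in auto)
    finally show ?thesis by simp
  qed
  from x(2) show ?thesis
  proof
    assume xd: "x < d"
    show ?thesis
    proof (rule key)
      show "N_d w d (\<lambda>y. poly (pderiv z) 0 * y) x = 0"
        using x xd by (intro N_d_linear_left) (auto simp: Om_def)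
      fix y assume y: "y \<in> Om" "\<bar>y - x\<bar> \<le> d"
      then have "\<bar>poly z y - poly (pderiv z) 0 * y\<bar> \<le> M * y\<^sup>2"
        using poly_Taylor[of y 0 2 z M] M z by (simp add: Om_def eval_nat_numeral lessThan_Suc)
      also have "\<dots> \<le> M * (2 * d)\<^sup>2" using y xd M0 by (intro mult_left_mono power_mono) (auto simp: Om_def)
      finally show "\<bar>poly z y - poly (pderiv z) 0 * y\<bar> \<le> 4 * M * d\<^sup>2" by (simp add: power_mult_distrib)
    qed (intro continuous_intros)
  next
    assume xd: "1 - d < x"
    show ?thesis
    proof (rule key)
      show "N_d w d (\<lambda>y. (- poly (pderiv z) 1) * (1 - y)) x = 0"
        using x xd by (intro N_d_linear_right) (auto simp: Om_def)
      fix y assume y: "y \<in> Om" "\<bar>y - x\<bar> \<le> d"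
      then have "\<bar>poly z y - (- poly (pderiv z) 1) * (1 - y)\<bar> \<le> M * (1 - y)\<^sup>2"
        using poly_Taylor[of y 1 2 z M] M z by (simp add: Om_def eval_nat_numeral lessThan_Suc algebra_simps)
      also have "\<dots> \<le> M * (2 * d)\<^sup>2" using y xd M0 by (intro mult_left_mono power_mono) (auto simp: Om_def)
      finally show "\<bar>poly z y - (- poly (pderiv z) 1) * (1 - y)\<bar> \<le> 4 * M * d\<^sup>2" by (simp add: power_mult_distrib)
    qed (intro continuous_intros)
  qed
qed

lemma N_d_borel [measurable]:
  assumes [measurable]: "u \<in> borel_measurable borel"
  shows "N_d w d u \<in> borel_measurable borel"
proof -
  have K: "(\<lambda>y. K_d w d x y) \<in> borel_measurable borel" for x
    using measurable_compose[OF _ K_d_borel, of "\<lambda>y. (x, y)" borel] by simp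
  have "Lint_on Om (\<lambda>y. u y * K_d w d x y) = (LINT y|lborel. indicator Om y * (u y * K_d w d x y))" for x
    using K by (intro lebesgue_on_eq_lborel(2)) measurable
  then have "N_d w d u = (\<lambda>x. a_d w d x * u x - (LINT y|lborel. indicator Om y * (u y * K_d w d x y)))"
    by (simp add: N_d_def fun_eq_iff)
  moreover have "(\<lambda>x. LINT y|lborel. indicator Om y * (u y * K_d w d x y)) \<in> borel_measurable borel"
  proof (rule lborel.borel_measurable_lebesgue_integral)
    show "(\<lambda>(x, y). indicator Om y * (u y * K_d w d x y)) \<in> borel_measurable (borel \<Otimes>\<^sub>M lborel)"
      using K_d_borel unfolding split_beta' by measurable
  qed
  ultimately show ?thesis by simp
qed

text \<open>The boundary error is bounded but not small; it enters the squared norm weighted with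
  the total length 2 d of the two layers.\<close>

lemma N_d_poly_L2_norm:
  assumes M: "\<And>t. t \<in> {0..1} \<Longrightarrow> \<bar>poly ((pderiv ^^ 2) z) t\<bar> \<le> M"
    and M': "\<And>t. t \<in> {0..1} \<Longrightarrow> \<bar>poly ((pderiv ^^ 3) z) t\<bar> \<le> M'"
    and z: "poly z 0 = 0" "poly z 1 = 0"
  shows "L2_norm (\<lambda>x. N_d w d (poly z) x + poly (pderiv (pderiv z)) x) \<le> sqrt ((2 * M' * d)\<^sup>2 + (48 * w 0 * M + M)\<^sup>2 * (2 * d))"
  unfolding L2_norm_def
proof (rule real_sqrt_le_mono)
  define h where "h x = N_d w d (poly z) x + poly (pderiv (pderiv z)) x" for x
  have [measurable]: "poly p \<in> borel_measurable borel" for p :: "real poly"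
    by (intro borel_measurable_continuous_onI continuous_intros)
  have hm [measurable]: "h \<in> borel_measurable borel" unfolding h_def by measurable
  have hb: "(h x)\<^sup>2 \<le> (2 * M' * d)\<^sup>2 * indicator {0..1} x + (48 * w 0 * M + M)\<^sup>2 * (indicator {0..d} x + indicator {1 - d..1} x)"
    if x: "x \<in> Om" for x
  proof (cases "x < d \<or> 1 - d < x")
    case True
    have "\<bar>h x\<bar> \<le> 48 * w 0 * M + M"
    proof -
      have "\<bar>poly (pderiv (pderiv z)) x\<bar> \<le> M"
        using M[of x] x by (simp add: Om_def numeral_2_eq_2)
      then show ?thesis
        unfolding h_def using N_d_poly_boundary[OF M z x True] by linarith
    qed
    from power_mono[OF this abs_ge_zero, of 2] have "(h x)\<^sup>2 \<le> (48 * w 0 * M + M)\<^sup>2" by simp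
    also have "\<dots> \<le> (48 * w 0 * M + M)\<^sup>2 * (indicator {0..d} x + indicator {1 - d..1} x)"
    proof -
      have "1 \<le> (indicator {0..d} x + indicator {1 - d..1} x :: real)"
        using x True by (auto simp: indicator_def Om_def)
      from mult_left_mono[OF this, of "(48 * w 0 * M + M)\<^sup>2"] show ?thesis by simp
    qed
    finally show ?thesis by (simp add: add_increasing)
  next
    case False
    then have "\<bar>h x\<bar> \<le> 2 * M' * d"
      using N_d_poly_interior[OF M', of x] by (simp add: h_def)
    from power_mono[OF this abs_ge_zero, of 2] have "(h x)\<^sup>2 \<le> (2 * M' * d)\<^sup>2" by simp
    then show ?thesis using x by (simp add: Om_def add_increasing2)
  qed
  have int: "integrable lborel (\<lambda>x. (2 * M' * d)\<^sup>2 * indicator {0..1} x + (48 * w 0 * M + M)\<^sup>2 * (indicator {0..d} x + indicator {1 - d..1} x) :: real)"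
    by (intro Bochner_Integration.integrable_add integrable_mult_right integrable_indicator_Icc)
  have "Lint_on Om (\<lambda>x. (h x)\<^sup>2) = (LINT x|lborel. indicator Om x * (h x)\<^sup>2)"
    by (rule lebesgue_on_eq_lborel) measurable
  also have "\<dots> \<le> (LINT x|lborel. (2 * M' * d)\<^sup>2 * indicator {0..1} x + (48 * w 0 * M + M)\<^sup>2 * (indicator {0..d} x + indicator {1 - d..1} x))"
  proof (rule integral_mono'[OF int])
    fix x :: real
    show "0 \<le> (2 * M' * d)\<^sup>2 * indicator {0..1} x + (48 * w 0 * M + M)\<^sup>2 * (indicator {0..d} x + indicator {1 - d..1} x)" by simp
    then show "indicator Om x * (h x)\<^sup>2 \<le> (2 * M' * d)\<^sup>2 * indicator {0..1} x + (48 * w 0 * M + M)\<^sup>2 * (indicator {0..d} x + indicator {1 - d..1} x)"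
      using hb[of x] by (cases "x \<in> Om") auto
  qed
  also have "\<dots> = (2 * M' * d)\<^sup>2 + (48 * w 0 * M + M)\<^sup>2 * (2 * d)"
    using d by (subst Bochner_Integration.integral_add) (simp_all add: integrable_indicator_Icc)
  finally show "Lint_on Om (\<lambda>x. (N_d w d (poly z) x + poly (pderiv (pderiv z)) x)\<^sup>2) \<le> (2 * M' * d)\<^sup>2 + (48 * w 0 * M + M)\<^sup>2 * (2 * d)"
    by (simp add: h_def)
qed

end

lemma consistency:
  assumes A1: "A1 w" and z: "poly z 0 = 0" "poly z 1 = 0"
  shows "((\<lambda>d. L2_norm (\<lambda>x. N_d w d (poly z) x + poly (pderiv (pderiv z)) x)) \<longlongrightarrow> 0) (at_right 0)"
proof -
  have "\<exists>B. \<forall>t\<in>{0..1}. \<bar>poly p t\<bar> \<le> B" for p :: "real poly"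
  proof -
    have "bounded (poly p ` {0..1})"
      by (intro compact_imp_bounded compact_continuous_image continuous_intros) auto
    then show ?thesis unfolding bounded_iff by auto
  qed
  then obtain M M' where M: "\<And>t. t \<in> {0..1} \<Longrightarrow> \<bar>poly ((pderiv ^^ 2) z) t\<bar> \<le> M"
    and M': "\<And>t. t \<in> {0..1} \<Longrightarrow> \<bar>poly ((pderiv ^^ 3) z) t\<bar> \<le> M'" by metis
  show ?thesis
  proof (rule tendsto_sandwich[OF _ _ tendsto_const])
    show "\<forall>\<^sub>F d in at_right 0. L2_norm (\<lambda>x. N_d w d (poly z) x + poly (pderiv (pderiv z)) x) \<le> sqrt ((2 * M' * d)\<^sup>2 + (48 * w 0 * M + M)\<^sup>2 * (2 * d))"
      unfolding eventually_at_right_field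
    proof (intro exI[of _ "1/2"] conjI allI impI)
      fix d :: real assume "0 < d" "d < 1/2"
      then interpret nonlocal_kernel w d using A1 by unfold_locales
      show "L2_norm (\<lambda>x. N_d w d (poly z) x + poly (pderiv (pderiv z)) x) \<le> sqrt ((2 * M' * d)\<^sup>2 + (48 * w 0 * M + M)\<^sup>2 * (2 * d))"
        by (rule N_d_poly_L2_norm[OF M M' z])
    qed auto
    have "((\<lambda>d. sqrt ((2 * M' * d)\<^sup>2 + (48 * w 0 * M + M)\<^sup>2 * (2 * d))) \<longlongrightarrow> sqrt ((2 * M' * 0)\<^sup>2 + (48 * w 0 * M + M)\<^sup>2 * (2 * 0))) (at_right 0)"
      by (intro tendsto_intros)
    then show "((\<lambda>d. sqrt ((2 * M' * d)\<^sup>2 + (48 * w 0 * M + M)\<^sup>2 * (2 * d))) \<longlongrightarrow> 0) (at_right 0)" by simp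
  qed (auto simp: L2_norm_nonneg)
qed

subsection \<open>Convergence\<close>

lemma AE_lborel_imp_LOm:
  assumes "AE x in lborel. P x"
  shows "AE x in LOm. P x"
proof -
  have "AE x in lebesgue. P x" using assms by (rule AE_completion)
  then show ?thesis by (subst AE_restrict_space_iff) (auto simp: Om_def elim: eventually_mono)
qed

lemma L2_norm_cong_AE:
  assumes "AE x in LOm. f x = g x" "f \<in> borel_measurable LOm" "g \<in> borel_measurable LOm"
  shows "L2_norm f = L2_norm g"
  unfolding L2_norm_def using assms
  by (intro arg_cong[of _ _ sqrt] integral_cong_AE) (auto intro: borel_measurable_power)

context nonlocal_kernel
begin

lemma integrable_L2_mult_K_d:
  assumes "L2 u"
  shows "integrable LOm (\<lambda>y. u y * K_d w d x y)"
proof (rule L2_mult_integrable[OF assms L2_bounded])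
  show "(\<lambda>y. K_d w d x y) \<in> borel_measurable LOm"
    using measurable_compose[OF _ K_d_borel, of "\<lambda>y. (x, y)" borel] by (intro borel_measurable_LOm) simp
qed (rule K_d_bound)

lemma N_d_diff:
  assumes "L2 u" "L2 v"
  shows "N_d w d (\<lambda>x. u x - v x) x = N_d w d u x - N_d w d v x"
  using integrable_L2_mult_K_d[OF assms(1), of x] integrable_L2_mult_K_d[OF assms(2), of x]
  by (simp add: N_d_def algebra_simps)

text \<open>The energy argument is for Borel functions vanishing off Om, so v is replaced by such a
  representative. Its integral against the kernel is the same at every x of Om, and the remaining
  terms agree almost everywhere. Stability then bounds ||v||^2 by a multiple of <v, h>, and
  Cauchy-Schwarz allows one factor ||v|| to be cancelled.\<close>

lemma L2_stability:
  assumes A2s: "A2s w d" and A3: "A3 w d" and d4: "d \<le> 1/4"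
    and v: "L2 v" and h: "L2 h" and N: "AE x in LOm. N_d w d v x = h x"
  shows "L2_norm v \<le> 100000 / w (15/16) * L2_norm h"
proof -
  have vm: "v \<in> borel_measurable LOm" using v by (simp add: L2_def)
  then have "(\<lambda>x. if x \<in> Om then v x else 0) \<in> borel_measurable lebesgue"
    by (subst borel_measurable_if) (auto simp: Om_def)
  from completion_ex_borel_measurable_real[OF this] obtain v1
    where v1 [measurable]: "v1 \<in> borel_measurable lborel" and ae1: "AE x in lborel. (if x \<in> Om then v x else 0) = v1 x" by blast
  define v' where "v' x = indicator Om x * v1 x" for x
  have v'm [measurable]: "v' \<in> borel_measurable borel" using v1 unfolding v'_def by measurable
  have ae: "AE x in LOm. v x = v' x"
    using AE_lborel_imp_LOm[OF ae1] AE_space by eventually_elim (auto simp: v'_def)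
  have v'0: "v' x = 0" if "x \<notin> Om" for x using that by (simp add: v'_def)
  have v'L: "v' \<in> borel_measurable LOm" by (intro borel_measurable_LOm v'm)
  have "integrable LOm (\<lambda>x. (v' x)\<^sup>2)"
  proof (rule integrable_cong_AE_imp)
    show "integrable LOm (\<lambda>x. (v x)\<^sup>2)" using v by (simp add: L2_def)
    show "AE x in LOm. (v x)\<^sup>2 = (v' x)\<^sup>2" using ae by eventually_elim simp
  qed (use v'L in measurable)
  then have L2v': "L2 v'" using v'L by (simp add: L2_def)
  have sq: "indicator Om x * (v' x)\<^sup>2 = (v' x)\<^sup>2" for x using v'0[of x] by (auto simp: indicator_def)
  have v'2: "integrable lborel (\<lambda>x. (v' x)\<^sup>2)"
    using \<open>integrable LOm (\<lambda>x. (v' x)\<^sup>2)\<close> by (subst (asm) lebesgue_on_eq_lborel(1)) (auto simp: sq)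
  interpret nonlocal_energy w d v'
    by unfold_locales (use v'2 v'0 d4 in auto)
  have Nk: "N_d w d v x = a_d w d x * v x - (LINT y|lborel. k x y * v' y)" if x: "x \<in> Om" for x
  proof -
    have K: "(\<lambda>y. K_d w d x y) \<in> borel_measurable borel"
      using measurable_compose[OF _ K_d_borel, of "\<lambda>y. (x, y)" borel] by simp
    have "Lint_on Om (\<lambda>y. v y * K_d w d x y) = Lint_on Om (\<lambda>y. v' y * K_d w d x y)"
    proof (rule integral_cong_AE)
      show "AE y in LOm. v y * K_d w d x y = v' y * K_d w d x y" using ae by eventually_elim simp
      show "(\<lambda>y. v y * K_d w d x y) \<in> borel_measurable LOm" "(\<lambda>y. v' y * K_d w d x y) \<in> borel_measurable LOm"
        by (intro borel_measurable_times vm v'L borel_measurable_LOm K)+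
    qed
    also have "\<dots> = (LINT y|lborel. indicator Om y * (v' y * K_d w d x y))"
      using K by (intro lebesgue_on_eq_lborel(2)) measurable
    also have "\<dots> = (LINT y|lborel. k x y * v' y)"
      using x by (simp add: k_def mult_ac)
    finally show ?thesis by (simp add: N_d_def)
  qed
  define g where "g x = (LINT y|lborel. k x y * v' y)" for x
  have gm [measurable]: "g \<in> borel_measurable borel"
    unfolding g_def
  proof (rule lborel.borel_measurable_lebesgue_integral)
    show "(\<lambda>(x, y). k x y * v' y) \<in> borel_measurable (borel \<Otimes>\<^sub>M lborel)"
      using k_borel unfolding split_beta' by measurable
  qed
  have "(L2_norm v)\<^sup>2 = (L2_norm v')\<^sup>2"
    using L2_norm_cong_AE[OF ae vm v'L] by simp
  also have "\<dots> = (LINT x|lborel. indicator Om x * (v' x)\<^sup>2)"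
    unfolding L2_norm_power2 by (rule lebesgue_on_eq_lborel) measurable
  also have "\<dots> \<le> 100000 / w (15/16) * (LINT x|lborel. v' x * (a_d w d x * v' x - g x))"
    unfolding sq g_def by (rule stability[OF A2s A3])
  also have "(LINT x|lborel. v' x * (a_d w d x * v' x - g x))
      = (LINT x|lborel. indicator Om x * (v' x * (a_d w d x * v' x - g x)))"
    using v'0 by (intro Bochner_Integration.integral_cong) (auto simp: indicator_def)
  also have "\<dots> = Lint_on Om (\<lambda>x. v' x * (a_d w d x * v' x - g x))"
    by (intro lebesgue_on_eq_lborel(2)[symmetric]) measurable
  also have "\<dots> = Lint_on Om (\<lambda>x. v x * h x)"
  proof (rule integral_cong_AE)
    show "(\<lambda>x. v' x * (a_d w d x * v' x - g x)) \<in> borel_measurable LOm"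
      by (intro borel_measurable_LOm) measurable
    show "(\<lambda>x. v x * h x) \<in> borel_measurable LOm"
      using vm h by (intro borel_measurable_times) (auto simp: L2_def)
    show "AE x in LOm. v' x * (a_d w d x * v' x - g x) = v x * h x"
      using ae N AE_space
    proof eventually_elim
      case (elim x)
      then show ?case using Nk[of x] by (simp add: g_def)
    qed
  qed
  also have "100000 / w (15/16) * Lint_on Om (\<lambda>x. v x * h x) \<le> 100000 / w (15/16) * (L2_norm v * L2_norm h)"
    using L2_Cauchy_Schwarz[OF v h] w_pos by (intro mult_left_mono) auto
  finally have *: "L2_norm v * L2_norm v \<le> L2_norm v * (100000 / w (15/16) * L2_norm h)"
    by (simp add: power2_eq_square mult_ac)
  show ?thesis
  proof (cases "L2_norm v = 0")
    case True
    then show ?thesis using w_pos L2_norm_nonneg[of h] by simp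
  next
    case False
    then have "0 < L2_norm v" using L2_norm_nonneg[of v] by linarith
    then show ?thesis using * by (simp only: mult_le_cancel_left_pos)
  qed
qed

lemma L2_N_d_poly: "L2 (N_d w d (poly z))"
proof -
  have zm: "poly z \<in> borel_measurable borel"
    by (intro borel_measurable_continuous_onI continuous_intros)
  have "bounded (poly z ` {0..1})"
    by (intro compact_imp_bounded compact_continuous_image continuous_intros) auto
  then obtain B where "\<forall>y\<in>{0..1}. \<bar>poly z y\<bar> \<le> B" unfolding bounded_iff by auto
  then have B: "\<bar>poly z y\<bar> \<le> B" if "y \<in> Om" for y using that by (auto simp: Om_def)
  show ?thesis
  proof (rule L2_bounded)
    show "N_d w d (poly z) \<in> borel_measurable LOm"
      by (intro borel_measurable_LOm N_d_borel zm)
    \<comment> \<open>Taking B / d^2 for the constant reduces the smallness hypothesis of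
      \<open>N_d_boundary_bound\<close> to plain boundedness. The bound depends on d, which is
      harmless for membership in L2.\<close>
    show "\<bar>N_d w d (poly z) x\<bar> \<le> 12 * w 0 * (B / d\<^sup>2)" if "x \<in> Om" for x
      by (rule N_d_boundary_bound[OF zm B _ that]) (use B d in auto)
  qed
qed

text \<open>Stability for u - z, whose image under \<open>N_d\<close> is f - N z = (f + z'') - (N z
  + z''): the approximation error of the data and the consistency error.\<close>

lemma error_estimate:
  assumes A2s: "A2s w d" and A3: "A3 w d" and d4: "d \<le> 1/4" and f: "L2 f"
    and u: "L2 u" "AE x in LOm. N_d w d u x = f x"
  shows "L2_norm (\<lambda>x. u x - poly z x) \<le> 100000 / w (15/16) *
    (L2_norm (\<lambda>x. f x + poly (pderiv (pderiv z)) x) + L2_norm (\<lambda>x. N_d w d (poly z) x + poly (pderiv (pderiv z)) x))"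
proof -
  have "L2_norm (\<lambda>x. u x - poly z x) \<le> 100000 / w (15/16) * L2_norm (\<lambda>x. f x - N_d w d (poly z) x)"
  proof (rule L2_stability[OF A2s A3 d4])
    show "AE x in LOm. N_d w d (\<lambda>x. u x - poly z x) x = f x - N_d w d (poly z) x"
      using u(2) by eventually_elim (simp add: N_d_diff[OF u(1) L2_poly])
  qed (intro L2_diff u f L2_poly L2_N_d_poly)+
  also have "\<dots> \<le> 100000 / w (15/16) *
    (L2_norm (\<lambda>x. f x + poly (pderiv (pderiv z)) x) + L2_norm (\<lambda>x. N_d w d (poly z) x + poly (pderiv (pderiv z)) x))"
  proof (rule mult_left_mono)
    have "L2_norm (\<lambda>x. f x - N_d w d (poly z) x) \<le>
        L2_norm (\<lambda>x. f x + poly (pderiv (pderiv z)) x) + L2_norm (\<lambda>x. - (N_d w d (poly z) x + poly (pderiv (pderiv z)) x))"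
      using L2_norm_triangle[OF L2_add[OF f L2_poly] L2_minus[OF L2_add[OF L2_N_d_poly L2_poly]], of "pderiv (pderiv z)" z "pderiv (pderiv z)"]
      by simp
    also have "L2_norm (\<lambda>x. - (N_d w d (poly z) x + poly (pderiv (pderiv z)) x)) = L2_norm (\<lambda>x. N_d w d (poly z) x + poly (pderiv (pderiv z)) x)"
      unfolding L2_norm_def by (simp only: power2_minus)
    finally show "L2_norm (\<lambda>x. f x - N_d w d (poly z) x) \<le>
        L2_norm (\<lambda>x. f x + poly (pderiv (pderiv z)) x) + L2_norm (\<lambda>x. N_d w d (poly z) x + poly (pderiv (pderiv z)) x)" .
  qed (use w_pos in simp)
  finally show ?thesis .
qed

end

theorem mainTheorem9:
  fixes w f u0 :: "real \<Rightarrow> real" and u :: "real \<Rightarrow> real \<Rightarrow> real"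
  assumes "A1 w"
    and "\<And>\<delta>. 0 < \<delta> \<Longrightarrow> \<delta> < 1/2 \<Longrightarrow> A2s w \<delta>"
    and "\<And>\<delta>. 0 < \<delta> \<Longrightarrow> \<delta> < 1/2 \<Longrightarrow> A3 w \<delta>"
    and "L2 f"
    and "weak_sol f u0"
    and "\<forall>\<^sub>F \<delta> in at_right 0. L2 (u \<delta>) \<and>
           (AE x in lebesgue_on Om. N_d w \<delta> (u \<delta>) x = f x)"
  shows "((\<lambda>\<delta>. L2_norm (\<lambda>x. u \<delta> x - u0 x)) \<longlongrightarrow> 0) (at_right 0)"
proof (rule tendstoI)
  fix e :: real assume e: "0 < e"
  define C where "C = 100000 / w (15/16)"
  have C: "0 < C" using assms(1) by (simp add: C_def A1_def)
  \<comment> \<open>The nonlocal error is at most C (\<eta> + \<eta>) and the local one is below 4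
    \<eta>, so this \<eta> makes their sum less than e.\<close>
  define \<eta> where "\<eta> = e / (2 * C + 4)"
  have \<eta>: "0 < \<eta>" using e C by (simp add: \<eta>_def)
  have "(2 * C + 4) * \<eta> = e"
    using C by (simp add: \<eta>_def)
  then have C\<eta>: "C * (\<eta> + \<eta>) + 4 * \<eta> = e"
    by (simp add: algebra_simps)
  obtain p where p: "L2_norm (\<lambda>x. f x - poly p x) < \<eta>"
    using exists_poly_L2_approx[OF assms(4) \<eta>] by blast
  obtain z where z: "pderiv (pderiv z) = - p" "poly z 0 = 0" "poly z 1 = 0"
    using exists_poly_Dirichlet[of p] by blast
  have fz: "L2_norm (\<lambda>x. f x + poly (pderiv (pderiv z)) x) < \<eta>" using p by (simp add: z(1))
  note u0 = weak_sol_poly_estimate[OF assms(5,4) z(2,3)]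
  have "\<forall>\<^sub>F \<delta> in at_right 0. L2_norm (\<lambda>x. N_d w \<delta> (poly z) x + poly (pderiv (pderiv z)) x) < \<eta>"
    using consistency[OF assms(1) z(2,3)] \<eta> by (rule order_tendstoD)
  moreover have "\<forall>\<^sub>F \<delta>::real in at_right 0. 0 < \<delta> \<and> \<delta> < 1/4"
    unfolding eventually_at_right_field by (intro exI[of _ "1/4"]) auto
  ultimately show "\<forall>\<^sub>F \<delta> in at_right 0. dist (L2_norm (\<lambda>x. u \<delta> x - u0 x)) 0 < e"
    using assms(6)
  proof eventually_elim
    case (elim \<delta>)
    interpret nonlocal_kernel w \<delta>
      using assms(1) elim by unfold_locales auto
    have u\<delta>: "L2 (u \<delta>)" "AE x in LOm. N_d w \<delta> (u \<delta>) x = f x" using elim by auto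
    have "L2_norm (\<lambda>x. (u \<delta> x - poly z x) + (poly z x - u0 x)) \<le> L2_norm (\<lambda>x. u \<delta> x - poly z x) + L2_norm (\<lambda>x. poly z x - u0 x)"
      by (intro L2_norm_triangle L2_diff u\<delta> L2_poly u0(1))
    also have "L2_norm (\<lambda>x. poly z x - u0 x) = L2_norm (\<lambda>x. u0 x - poly z x)"
      by (rule L2_norm_minus_commute)
    finally have "L2_norm (\<lambda>x. u \<delta> x - u0 x) \<le> L2_norm (\<lambda>x. u \<delta> x - poly z x) + L2_norm (\<lambda>x. u0 x - poly z x)"
      by simp
    moreover have "L2_norm (\<lambda>x. u \<delta> x - poly z x) \<le> C * (\<eta> + \<eta>)"
    proof -
      have "L2_norm (\<lambda>x. u \<delta> x - poly z x) \<le> C * (L2_norm (\<lambda>x. f x + poly (pderiv (pderiv z)) x)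
          + L2_norm (\<lambda>x. N_d w \<delta> (poly z) x + poly (pderiv (pderiv z)) x))"
        unfolding C_def using elim assms(2,3) by (intro error_estimate assms(4) u\<delta>) auto
      also have "\<dots> \<le> C * (\<eta> + \<eta>)"
        using fz elim C by (intro mult_left_mono add_mono) auto
      finally show ?thesis .
    qed
    moreover have "L2_norm (\<lambda>x. u0 x - poly z x) < 4 * \<eta>"
      using u0(2) fz by linarith
    ultimately show ?case
      using C\<eta> L2_norm_nonneg[of "\<lambda>x. u \<delta> x - u0 x"] by (simp add: dist_real_def)
  qed
qed

end
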